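(* For every $n\ge 3$, the flip graph of labeled combinatorial 4-PPTs with $n$ vertices and a fixed triangular outer face is connected with diameter $O(n^2)$: any two labeled combinatorial 4-PPTs on the same $n$ labeled vertices whose outer face consists of the same three labeled vertices in the same cyclic order can be transformed into each other by at most $Cn^2$ flips, for an absolute constant $C$.
   Context: An angle is a vertex–face incidence of a plane embedded graph. A combinatorial pseudo-triangulation is a combinatorial embedding in the plane (rotation system with designated outer face) of a connected planar simple graph, with a tag "reflex" or "convex" on each angle, such that every interior face has exactly three convex angles, all angles of the outer face are reflex, and no vertex is incident to more than one reflex angle; it is pointed if every vertex is incident to exactly one reflex angle. A combinatorial 4-PPT is a combinatorial pointed pseudo-triangulation whose interior faces all have size 3 or 4. In a labeled combinatorial 4-PPT the vertices carry distinct labels. Flip: for an interior triangular face $\triangle$, an edge $e$ of $\triangle$ not on the outer face, the other face $F$ at $e$, and the region $R$ obtained by deleting $e$, a flip replaces $e$ by an edge $e'\ne e$ inside $R$ that splits $R$ into a triangular face and a face of the same size as $F$, such that the result (tags outside $R$ unchanged) is again a combinatorial 4-PPT; in particular $e'$ may not join two vertices already adjacent. Flips preserve labels and the outer face. *)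

theory Defs
  imports Complex_Main
begin

text \<open>A combinatorial embedding with angle tags.  Vertices are the labels themselves.
  cadj: symmetric irreflexive adjacency (simple graph);
  crot v: the rotation at v, a cyclic permutation of the neighbours of v;
  creflex v w: tag of the angle (corner) at v lying between neighbour w and crot v w
  (True = reflex, False = convex).\<close>
record 'a tagged_emb =
  cadj :: "'a \<Rightarrow> 'a \<Rightarrow> bool"
  crot :: "'a \<Rightarrow> 'a \<Rightarrow> 'a"
  creflex :: "'a \<Rightarrow> 'a \<Rightarrow> bool"

definition darts :: "('a \<Rightarrow> 'a \<Rightarrow> bool) \<Rightarrow> ('a \<times> 'a) set" where
  "darts A = {(u, v). A u v}"

definition uedges :: "('a \<Rightarrow> 'a \<Rightarrow> bool) \<Rightarrow> 'a set set" where
  "uedges A = {{u, v} | u v. A u v}"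

definition fnext :: "('a \<Rightarrow> 'a \<Rightarrow> 'a) \<Rightarrow> 'a \<times> 'a \<Rightarrow> 'a \<times> 'a" where
  "fnext r d = (snd d, r (snd d) (fst d))"

definition face :: "('a \<Rightarrow> 'a \<Rightarrow> 'a) \<Rightarrow> 'a \<times> 'a \<Rightarrow> ('a \<times> 'a) set" where
  "face r d = {(fnext r ^^ k) d | k. True}"

definition faces :: "('a \<Rightarrow> 'a \<Rightarrow> bool) \<Rightarrow> ('a \<Rightarrow> 'a \<Rightarrow> 'a) \<Rightarrow> ('a \<times> 'a) set set" where
  "faces A r = face r ` darts A"

definition simple_graph :: "'a set \<Rightarrow> ('a \<Rightarrow> 'a \<Rightarrow> bool) \<Rightarrow> bool" where
  "simple_graph V A \<longleftrightarrow> (\<forall>u v. A u v \<longrightarrow> u \<in> V \<and> v \<in> V \<and> u \<noteq> v \<and> A v u)"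

definition connected_graph :: "'a set \<Rightarrow> ('a \<Rightarrow> 'a \<Rightarrow> bool) \<Rightarrow> bool" where
  "connected_graph V A \<longleftrightarrow> (\<forall>u\<in>V. \<forall>v\<in>V. A\<^sup>*\<^sup>* u v)"

definition rotation_system :: "'a set \<Rightarrow> ('a \<Rightarrow> 'a \<Rightarrow> bool) \<Rightarrow> ('a \<Rightarrow> 'a \<Rightarrow> 'a) \<Rightarrow> bool" where
  "rotation_system V A r \<longleftrightarrow>
     (\<forall>v\<in>V. bij_betw (r v) {w. A v w} {w. A v w} \<and>
            (\<forall>w w'. A v w \<longrightarrow> A v w' \<longrightarrow> (\<exists>k. (r v ^^ k) w = w')))"

text \<open>Planarity of a rotation system of a connected graph: Euler genus 0, V - E + F = 2.\<close>
definition planar_rotation :: "'a set \<Rightarrow> ('a \<Rightarrow> 'a \<Rightarrow> bool) \<Rightarrow> ('a \<Rightarrow> 'a \<Rightarrow> 'a) \<Rightarrow> bool" where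
  "planar_rotation V A r \<longleftrightarrow> card V + card (faces A r) = card (uedges A) + 2"

text \<open>Combinatorial plane embedding on vertex set V with outer face designated by dart od.\<close>
definition comb_embedding :: "'a set \<Rightarrow> 'a \<times> 'a \<Rightarrow> 'a tagged_emb \<Rightarrow> bool" where
  "comb_embedding V od P \<longleftrightarrow> finite V \<and> simple_graph V (cadj P) \<and> connected_graph V (cadj P) \<and>
     rotation_system V (cadj P) (crot P) \<and> planar_rotation V (cadj P) (crot P) \<and>
     od \<in> darts (cadj P)"

text \<open>Angle (corner) at v after neighbour w belongs to the face of dart (w,v).
  Interior faces: all faces other than the outer one.\<close>
definition interior_face :: "'a \<times> 'a \<Rightarrow> 'a tagged_emb \<Rightarrow> ('a \<times> 'a) set \<Rightarrow> bool" where
  "interior_face od P f \<longleftrightarrow> f \<in> faces (cadj P) (crot P) \<and> f \<noteq> face (crot P) od"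

definition comb_pt :: "'a set \<Rightarrow> 'a \<times> 'a \<Rightarrow> 'a tagged_emb \<Rightarrow> bool" where
  "comb_pt V od P \<longleftrightarrow> comb_embedding V od P \<and>
     (\<forall>f. interior_face od P f \<longrightarrow> card {(w, v). (w, v) \<in> f \<and> \<not> creflex P v w} = 3) \<and>
     (\<forall>w v. (w, v) \<in> face (crot P) od \<longrightarrow> creflex P v w) \<and>
     (\<forall>v\<in>V. card {w. cadj P v w \<and> creflex P v w} \<le> 1)"

definition comb_ppt :: "'a set \<Rightarrow> 'a \<times> 'a \<Rightarrow> 'a tagged_emb \<Rightarrow> bool" where
  "comb_ppt V od P \<longleftrightarrow> comb_pt V od P \<and>
     (\<forall>v\<in>V. card {w. cadj P v w \<and> creflex P v w} = 1)"

definition comb_4ppt :: "'a set \<Rightarrow> 'a \<times> 'a \<Rightarrow> 'a tagged_emb \<Rightarrow> bool" where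
  "comb_4ppt V od P \<longleftrightarrow> comb_ppt V od P \<and>
     (\<forall>f. interior_face od P f \<longrightarrow> card f = 3 \<or> card f = 4)"

definition del_adj :: "('a \<Rightarrow> 'a \<Rightarrow> bool) \<Rightarrow> 'a \<Rightarrow> 'a \<Rightarrow> 'a \<Rightarrow> 'a \<Rightarrow> bool" where
  "del_adj A u v = (\<lambda>a b. A a b \<and> {a, b} \<noteq> {u, v})"

definition del_rot :: "('a \<Rightarrow> 'a \<Rightarrow> 'a) \<Rightarrow> 'a \<Rightarrow> 'a \<Rightarrow> 'a \<Rightarrow> 'a \<Rightarrow> 'a" where
  "del_rot r u v = (\<lambda>z w.
     if z = u then (if r u w = v then r u v else r u w)
     else if z = v then (if r v w = u then r v u else r v w)
     else r z w)"

definition region :: "('a \<Rightarrow> 'a \<Rightarrow> 'a) \<Rightarrow> 'a \<Rightarrow> 'a \<Rightarrow> ('a \<times> 'a) set" where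
  "region r u v = (face r (u, v) \<union> face r (v, u)) - {(u, v), (v, u)}"

text \<open>A flip from P to P' (same labelled vertex set V, same outer face designated by od):
  e = {u,v} is an edge of the interior triangular face of dart (u,v), not on the outer face,
  F is the face of dart (v,u); e is replaced by a new edge e' = {x,y} (joining non-adjacent
  vertices) placed inside R (the rest of the embedding is unchanged), splitting R into a
  triangle and a face of the size of F; tags outside R are unchanged; and P' is a 4-PPT.\<close>
definition flip :: "'a set \<Rightarrow> 'a \<times> 'a \<Rightarrow> 'a tagged_emb \<Rightarrow> 'a tagged_emb \<Rightarrow> bool" where
  "flip V od P P' \<longleftrightarrow> comb_4ppt V od P \<and> comb_4ppt V od P' \<and>
    (\<exists>u v x y.
       cadj P u v \<and> \<not> cadj P x y \<and> cadj P' x y \<and>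
       card (face (crot P) (u, v)) = 3 \<and>
       od \<notin> face (crot P) (u, v) \<and> od \<notin> face (crot P) (v, u) \<and>
       del_adj (cadj P) u v = del_adj (cadj P') x y \<and>
       (\<forall>a b. del_adj (cadj P) u v a b \<longrightarrow>
              del_rot (crot P) u v a b = del_rot (crot P') x y a b) \<and>
       region (crot P) u v = region (crot P') x y \<and>
       ((card (face (crot P') (x, y)) = 3 \<and>
         card (face (crot P') (y, x)) = card (face (crot P) (v, u))) \<or>
        (card (face (crot P') (y, x)) = 3 \<and>
         card (face (crot P') (x, y)) = card (face (crot P) (v, u)))) \<and>
       (\<forall>a b. cadj P a b \<and> (b, a) \<notin> face (crot P) (u, v) \<union> face (crot P) (v, u) \<longrightarrow>
              creflex P' a b = creflex P a b))"

text \<open>Two tagged embeddings represent the same object: same graph, same rotations at all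
  darts, same tags at all angles (values off the structure are irrelevant).\<close>
definition same_emb :: "'a tagged_emb \<Rightarrow> 'a tagged_emb \<Rightarrow> bool" where
  "same_emb P Q \<longleftrightarrow> cadj P = cadj Q \<and>
     (\<forall>a b. cadj P a b \<longrightarrow> crot P a b = crot Q a b \<and> creflex P a b = creflex Q a b)"

end

theory Submission
  imports Defs
begin

text \<open>Counting angles against Euler's formula shows that there is exactly one interior triangle \<open>T\<close>, and
  that every other interior face is a quadrilateral carrying the reflex angle of one interior vertex.
  Removing an edge of \<open>T\<close> leaves a pentagon, and a flip inserts any other chord that neither joins
  adjacent vertices nor cuts off the reflex vertex; so flips move \<open>T\<close> around.

  Over GF(2), planarity means that every even edge set bounds a set of faces. By parity, a 3-cycle
  separates \<open>T\<close> from the outer face, and a second Euler count shows that no vertex of a 3-cycle has its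
  reflex angle on the side of \<open>T\<close>. Hence at least one of the two flips that rotate \<open>T\<close> around a vertex
  is always available, and \<open>T\<close> can be walked to the outer triangle \<open>abc\<close>.

  Once there, \<open>c\<close> is stripped down to degree 2 in \<open>O(n)\<close> flips. Then \<open>c\<close> lies in a quadrilateral
  \<open>c b c' a\<close> with \<open>c'\<close> reflex, and \<open>abc'\<close> takes over the role of the outer triangle. This ends in a fan: all
  remaining vertices have degree 2 and are joined to \<open>a\<close> and \<open>b\<close>. Neighbours in a fan are exchanged
  by boundedly many flips once \<open>T\<close> is next to them, so insertion sort relates any two fans by \<open>O(n\<^sup>2)\<close>
  flips, and flips are reversible.\<close>

section \<open>Faces and rotations\<close>

text \<open>As there is a single interior triangle \<open>T\<close>, every flip removes an edge of
  \<open>T\<close>; flips at different places cannot be done independently, and all work has to be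
  organised as a tour of \<open>T\<close>. The obstacle to a tour is a wanted chord whose ends are
  already adjacent. Such an edge closes a 3-cycle together with edges at \<open>T\<close>, and
  knowing on which side of it \<open>T\<close> lies and where the reflex angles inside can sit rules
  out a second obstruction at the same corner. This is why a global statement on 3-cycles carries
  the local moves. Planarity is available only as Euler's formula, so inside and outside are found
  by counting sets of edges and faces, not by topology. The tour must also spare what is finished:
  unions of faces are protected, and turning always runs forward in the rotation, so that
  \<open>T\<close> meets its target before a protected corner. In a fan, the vertex carried along by
  \<open>T\<close> takes no part in the exchanges on the way, so a permutation that changes the
  innermost vertex takes two sorts with a special exchange in between.\<close>

lemma funpow_in: "f ` D \<subseteq> D \<Longrightarrow> d \<in> D \<Longrightarrow> (f ^^ k) d \<in> D"
  by (induction k) auto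

lemma inj_on_funpow_cancel:
  assumes "inj_on f D" "f ` D \<subseteq> D" "x \<in> D" "y \<in> D" "(f ^^ k) x = (f ^^ k) y"
  shows "x = y"
  using assms(5)
proof (induction k)
  case (Suc k)
  then have "f ((f ^^ k) x) = f ((f ^^ k) y)" by simp
  then have "(f ^^ k) x = (f ^^ k) y"
    using assms(1) funpow_in[OF assms(2)] assms(3,4) by (meson inj_onD)
  then show ?case using Suc by simp
qed simp

text \<open>Pigeonhole on the first \<open>n + 1\<close> iterates; injectivity cancels the common
  prefix, so the repetition happens at \<open>d\<close> itself.\<close>

lemma funpow_return_le:
  assumes "inj_on f D" "f ` D \<subseteq> D" "d \<in> D"
    and "finite A" "\<And>k. (f ^^ k) d \<in> A" "card A = n"
  shows "\<exists>m. 0 < m \<and> m \<le> n \<and> (f ^^ m) d = d"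
proof -
  have "\<not> inj_on (\<lambda>k. (f ^^ k) d) {..n}"
  proof
    assume i: "inj_on (\<lambda>k. (f ^^ k) d) {..n}"
    have "card ((\<lambda>k. (f ^^ k) d) ` {..n}) \<le> card A"
      using assms(4,5) by (intro card_mono) auto
    with card_image[OF i] assms(6) show False by simp
  qed
  then obtain i j where ij: "i < j" "j \<le> n" "(f ^^ i) d = (f ^^ j) d"
    unfolding inj_on_def by (metis atMost_iff linorder_neqE_nat)
  have "(f ^^ i) ((f ^^ (j - i)) d) = (f ^^ j) d"
    using ij by (simp flip: funpow_add[THEN fun_cong, unfolded comp_def])
  then have "(f ^^ (j - i)) d = d"
    using inj_on_funpow_cancel[OF assms(1,2) assms(3)] funpow_in[OF assms(2,3)] ij
    by (metis)
  then show ?thesis using ij by (intro exI[of _ "j - i"]) auto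
qed

text \<open>Some return time \<open>m\<close> is at most the orbit size, and the orbit has at most
  \<open>m\<close> elements, so the two agree. With this, a face of size 3 or 4 closes up after
  exactly that many steps.\<close>

lemma orbit_return:
  assumes "inj_on f D" "f ` D \<subseteq> D" "d \<in> D" "finite D"
    and "card {(f ^^ k) d | k. True} = n"
  shows "(f ^^ n) d = d"
proof -
  let ?O = "{(f ^^ k) d | k. True}"
  have sub: "?O \<subseteq> D" using funpow_in[OF assms(2,3)] by auto
  then have fin: "finite ?O" using assms(4) finite_subset by blast
  obtain m where m: "0 < m" "m \<le> n" "(f ^^ m) d = d"
    using funpow_return_le[OF assms(1-3) fin _ assms(5)] by blast
  have "?O \<subseteq> (\<lambda>k. (f ^^ k) d) ` {..<m}"
  proof
    fix x assume "x \<in> ?O"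
    then obtain k where "x = (f ^^ k) d" by blast
    then have "x = (f ^^ (k mod m)) d" using funpow_mod_eq[OF m(3)] by metis
    then show "x \<in> (\<lambda>k. (f ^^ k) d) ` {..<m}" using m(1) by auto
  qed
  then have "card ?O \<le> m" using card_mono[of "(\<lambda>k. (f ^^ k) d) ` {..<m}" ?O]
      card_image_le[of "{..<m}" "\<lambda>k. (f ^^ k) d"] by simp
  with m assms(5) show ?thesis by simp
qed

lemma face_self: "d \<in> face r d"
  unfolding face_def by (rule CollectI, rule exI[of _ 0]) simp

lemma fnext_in_face: "e \<in> face r d \<Longrightarrow> fnext r e \<in> face r d"
  unfolding face_def by (auto intro: exI[of _ "Suc _"])

lemma face_subset: "d \<in> K \<Longrightarrow> fnext r ` K \<subseteq> K \<Longrightarrow> face r d \<subseteq> K"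
  unfolding face_def using funpow_in[of "fnext r" K d] by auto

text \<open>The face walk permutes the finitely many darts, so it can be run backwards by going on
  to a multiple of its period.\<close>

lemma face_eq:
  assumes "inj_on (fnext r) D" "fnext r ` D \<subseteq> D" "finite D" "d \<in> D" "e \<in> face r d"
  shows "face r e = face r d"
proof
  show "face r e \<subseteq> face r d"
    using assms(5) by (intro face_subset image_subsetI fnext_in_face)
  obtain k where k: "e = (fnext r ^^ k) d" using assms(5) unfolding face_def by blast
  obtain m where m: "0 < m" "(fnext r ^^ m) d = d"
    using funpow_return_le[OF assms(1,2,4,3) funpow_in[OF assms(2,4)] refl] by blast
  have "(fnext r ^^ (m * k)) d = d"
    using funpow_mod_eq[OF m(2), of "m * k"] by simp
  moreover have "m * k = (m * k - k) + k" using m(1) by simp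
  ultimately have "(fnext r ^^ (m * k - k)) e = d"
    using k by (metis comp_apply funpow_add)
  then have "d \<in> face r e" unfolding face_def by blast
  then show "face r d \<subseteq> face r e" by (intro face_subset image_subsetI fnext_in_face)
qed

text \<open>In \<open>rquad P x y z w t\<close>, the vertex \<open>t\<close> carries the reflex angle of the face \<open>xyzw\<close>.\<close>

definition tri :: "'a tagged_emb \<Rightarrow> 'a \<Rightarrow> 'a \<Rightarrow> 'a \<Rightarrow> bool" where
  "tri P x y z \<longleftrightarrow> cadj P x y \<and> crot P y x = z \<and> crot P z y = x \<and> crot P x z = y"

definition quad :: "'a tagged_emb \<Rightarrow> 'a \<Rightarrow> 'a \<Rightarrow> 'a \<Rightarrow> 'a \<Rightarrow> bool" where
  "quad P x y z w \<longleftrightarrow>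
     cadj P x y \<and> crot P y x = z \<and> crot P z y = w \<and> crot P w z = x \<and> crot P x w = y"

definition rquad :: "'a tagged_emb \<Rightarrow> 'a \<Rightarrow> 'a \<Rightarrow> 'a \<Rightarrow> 'a \<Rightarrow> 'a \<Rightarrow> bool" where
  "rquad P x y z w t \<longleftrightarrow> quad P x y z w \<and> t \<in> {x, y, z, w} \<and>
     (creflex P y x \<longleftrightarrow> t = y) \<and> (creflex P z y \<longleftrightarrow> t = z) \<and>
     (creflex P w z \<longleftrightarrow> t = w) \<and> (creflex P x w \<longleftrightarrow> t = x)"

definition tdarts :: "'a \<Rightarrow> 'a \<Rightarrow> 'a \<Rightarrow> ('a \<times> 'a) set" where
  "tdarts x y z = {(x, y), (y, z), (z, x)}"

definition qdarts :: "'a \<Rightarrow> 'a \<Rightarrow> 'a \<Rightarrow> 'a \<Rightarrow> ('a \<times> 'a) set" where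
  "qdarts x y z w = {(x, y), (y, z), (z, w), (w, x)}"

lemma quad_rot: "quad P x y z w \<Longrightarrow> cadj P y z \<Longrightarrow> quad P y z w x"
  unfolding quad_def by auto

lemma tri_face: "tri P x y z \<Longrightarrow> face (crot P) (x, y) = tdarts x y z"
proof
  assume t: "tri P x y z"
  show "face (crot P) (x, y) \<subseteq> tdarts x y z"
    using t unfolding tri_def tdarts_def fnext_def by (intro face_subset) (auto simp: fnext_def)
  have "(x, y) \<in> face (crot P) (x, y)" by (rule face_self)
  moreover from fnext_in_face[OF this] have 2: "(y, z) \<in> face (crot P) (x, y)"
    using t by (simp add: tri_def fnext_def)
  moreover from fnext_in_face[OF 2] have "(z, x) \<in> face (crot P) (x, y)"
    using t by (simp add: tri_def fnext_def)
  ultimately show "tdarts x y z \<subseteq> face (crot P) (x, y)" by (simp add: tdarts_def)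
qed

lemma quad_face: "quad P x y z w \<Longrightarrow> face (crot P) (x, y) = qdarts x y z w"
proof
  assume t: "quad P x y z w"
  show "face (crot P) (x, y) \<subseteq> qdarts x y z w"
    using t unfolding quad_def qdarts_def fnext_def by (intro face_subset) (auto simp: fnext_def)
  have "(x, y) \<in> face (crot P) (x, y)" by (rule face_self)
  moreover from fnext_in_face[OF this] have 2: "(y, z) \<in> face (crot P) (x, y)"
    using t by (simp add: quad_def fnext_def)
  moreover from fnext_in_face[OF 2] have 3: "(z, w) \<in> face (crot P) (x, y)"
    using t by (simp add: quad_def fnext_def)
  moreover from fnext_in_face[OF 3] have "(w, x) \<in> face (crot P) (x, y)"
    using t by (simp add: quad_def fnext_def)
  ultimately show "qdarts x y z w \<subseteq> face (crot P) (x, y)" by (simp add: qdarts_def)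
qed

text \<open>On a finite set, a self-map is a single cycle iff it has no proper nonempty invariant
  subset; in this form deletion and insertion of one element are immediate.\<close>
definition cyc_on :: "('a \<Rightarrow> 'a) \<Rightarrow> 'a set \<Rightarrow> bool" where
  "cyc_on f N \<longleftrightarrow> f ` N \<subseteq> N \<and> (\<forall>X. X \<subseteq> N \<longrightarrow> X \<noteq> {} \<longrightarrow> f ` X \<subseteq> X \<longrightarrow> X = N)"

lemma cyc_onD: "cyc_on f N \<Longrightarrow> X \<subseteq> N \<Longrightarrow> X \<noteq> {} \<Longrightarrow> f ` X \<subseteq> X \<Longrightarrow> X = N"
  unfolding cyc_on_def by (elim conjE allE) (erule impE, assumption)+

lemma cyc_on_iff:
  assumes "finite N"
  shows "cyc_on f N \<longleftrightarrow> bij_betw f N N \<and> (\<forall>w w'. w \<in> N \<longrightarrow> w' \<in> N \<longrightarrow> (\<exists>k. (f ^^ k) w = w'))"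
proof
  assume c: "cyc_on f N"
  have "f ` N = N"
  proof (cases "N = {}")
    case False
    have "f ` (f ` N) \<subseteq> f ` N" "f ` N \<subseteq> N" using c unfolding cyc_on_def by auto
    with c False show ?thesis unfolding cyc_on_def by (metis image_is_empty)
  qed simp
  then have b: "bij_betw f N N"
    using assms by (simp add: bij_betw_def eq_card_imp_inj_on)
  have "\<exists>k. (f ^^ k) w = w'" if "w \<in> N" "w' \<in> N" for w w'
  proof -
    let ?X = "{(f ^^ k) w | k. True}"
    have fn: "f ` N \<subseteq> N" using c unfolding cyc_on_def by auto
    have "?X \<subseteq> N" using funpow_in[OF fn that(1)] by auto
    moreover have "?X \<noteq> {}" by auto
    moreover have "f ` ?X \<subseteq> ?X" by (auto intro: exI[of _ "Suc _"])
    ultimately have "?X = N" using c unfolding cyc_on_def by blast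
    then show ?thesis using that(2) by blast
  qed
  with b show "bij_betw f N N \<and> (\<forall>w w'. w \<in> N \<longrightarrow> w' \<in> N \<longrightarrow> (\<exists>k. (f ^^ k) w = w'))"
    by blast
next
  assume c: "bij_betw f N N \<and> (\<forall>w w'. w \<in> N \<longrightarrow> w' \<in> N \<longrightarrow> (\<exists>k. (f ^^ k) w = w'))"
  have "X = N" if X: "X \<subseteq> N" "X \<noteq> {}" "f ` X \<subseteq> X" for X
  proof
    show "N \<subseteq> X"
    proof
      fix w' assume w': "w' \<in> N"
      obtain w where w: "w \<in> X" using X by blast
      then obtain k where "(f ^^ k) w = w'" using c w' X by blast
      then show "w' \<in> X" using funpow_in[OF X(3) w] by metis
    qed
  qed (rule X)
  with c show "cyc_on f N" unfolding cyc_on_def bij_betw_def by auto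
qed

text \<open>A set invariant under the shortened cycle becomes invariant under \<open>f\<close> once
  \<open>v\<close> is put back, if some element is sent to \<open>v\<close>; otherwise it is
  invariant already.\<close>

lemma cyc_on_delete:
  assumes c: "cyc_on f N" and n: "N \<noteq> {v}"
    and g: "\<And>w. w \<in> N \<Longrightarrow> w \<noteq> v \<Longrightarrow> g w = (if f w = v then f v else f w)"
  shows "cyc_on g (N - {v})"
proof (cases "v \<in> N")
  case False
  then have "g w = f w" if "w \<in> N" for w
    using c g that unfolding cyc_on_def by (metis image_subset_iff)
  then show ?thesis using c False unfolding cyc_on_def
    by (metis (no_types, lifting) Diff_empty Diff_insert0 image_cong subsetD)
next
  case v: True
  have fN: "f w \<in> N" if "w \<in> N" for w using c that unfolding cyc_on_def by auto
  have fv: "f v \<noteq> v"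
  proof
    assume "f v = v"
    then have "{v} = N" using c v unfolding cyc_on_def by blast
    then show False using n by simp
  qed
  show ?thesis unfolding cyc_on_def
  proof (intro conjI allI impI)
    show "g ` (N - {v}) \<subseteq> N - {v}" using fN fv v g by auto
    fix X assume X: "X \<subseteq> N - {v}" "X \<noteq> {}" "g ` X \<subseteq> X"
    have g': "g w = (if f w = v then f v else f w)" if "w \<in> X" for w
      using that X(1) by (intro g) auto
    show "X = N - {v}"
    proof (cases "\<exists>w\<in>X. f w = v")
      case True
      then have "f v \<in> X" using X(3) g' by (metis image_subset_iff)
      then have "f ` (insert v X) \<subseteq> insert v X" using X(3) g' by (auto split: if_splits)
      moreover have "insert v X \<subseteq> N" using X v by auto
      ultimately have "insert v X = N" using c unfolding cyc_on_def by blast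
      then show ?thesis using X by auto
    next
      case False
      then have "f ` X \<subseteq> X" using X(3) g' by (metis image_subset_iff)
      then have "X = N" using c X unfolding cyc_on_def by blast
      then show ?thesis using X v by auto
    qed
  qed
qed

text \<open>Removing \<open>y\<close> from a set invariant under \<open>g\<close> leaves one
  invariant under \<open>f\<close>: the only detour is \<open>s\<close>, \<open>y\<close>,
  \<open>f s\<close>.\<close>

lemma cyc_on_insert:
  assumes c: "cyc_on f N" and s: "s \<in> N" and y: "y \<notin> N"
    and g: "\<And>w. w \<in> N \<Longrightarrow> w \<noteq> s \<Longrightarrow> g w = f w" "g s = y" "g y = f s"
  shows "cyc_on g (insert y N)"
proof -
  have fN: "f w \<in> N" if "w \<in> N" for w using c that unfolding cyc_on_def by auto
  show ?thesis unfolding cyc_on_def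
  proof (intro conjI allI impI)
    have "g w \<in> insert y N" if "w \<in> insert y N" for w
      using that fN s g by (cases "w = s"; cases "w = y") auto
    then show "g ` (insert y N) \<subseteq> insert y N" by blast
    fix X assume X: "X \<subseteq> insert y N" "X \<noteq> {}" "g ` X \<subseteq> X"
    have "f w \<in> X - {y}" if w: "w \<in> X - {y}" for w
    proof (cases "w = s")
      case True
      then have "y \<in> X" using w X(3) g(2) by auto
      then have "f s \<in> X" using X(3) g(3) by auto
      then show ?thesis using True fN s y by auto
    next
      case False
      then have "g w = f w" using g w X by auto
      moreover have "w \<in> N" using w X by auto
      moreover have "g w \<in> X" using w X(3) by auto
      ultimately show ?thesis using fN[of w] y by auto
    qed
    then have cl: "f ` (X - {y}) \<subseteq> X - {y}" by auto
    have "X - {y} \<noteq> {}"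
    proof
      assume "X - {y} = {}"
      then have "y \<in> X" using X by auto
      then have "f s \<in> X" using X(3) g(3) by auto
      then show False using \<open>X - {y} = {}\<close> fN[OF s] y by auto
    qed
    moreover have "X - {y} \<subseteq> N" using X(1) by auto
    ultimately have *: "X - {y} = N" using cl by (intro cyc_onD[OF c])
    then have "y \<in> X" using s X(3) g(2) by auto
    with * show "X = insert y N" by auto
  qed
qed

section \<open>Local structure of one embedding: rotations, small faces, reflex angles\<close>

locale frame =
  fixes V :: "'a set" and a b c :: 'a
  assumes ab: "a \<noteq> b" and bc: "b \<noteq> c" and ca: "c \<noteq> a"
begin

definition good :: "'a tagged_emb \<Rightarrow> bool" where
  "good P \<longleftrightarrow> comb_4ppt V (a, b) P \<and> face (crot P) (a, b) = {(a, b), (b, c), (c, a)}"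

definition odarts :: "('a \<times> 'a) set" where
  "odarts = {(a, b), (b, c), (c, a)}"

context
  fixes P :: "'a tagged_emb"
  assumes g: "good P"
begin

lemma emb: "comb_embedding V (a, b) P"
  using g unfolding good_def comb_4ppt_def comb_ppt_def comb_pt_def by blast

lemma finV: "finite V"
  using emb unfolding comb_embedding_def by blast

lemma adj_sym: "cadj P u v \<Longrightarrow> cadj P v u"
  and adj_ne: "cadj P u v \<Longrightarrow> u \<noteq> v"
  and adj_V: "cadj P u v \<Longrightarrow> u \<in> V" "cadj P u v \<Longrightarrow> v \<in> V"
  using emb unfolding comb_embedding_def simple_graph_def by blast+

lemma nbrs_fin: "finite {w. cadj P v w}"
  by (rule finite_subset[OF _ finV]) (auto dest: adj_V)

lemma rot_cyc: "v \<in> V \<Longrightarrow> cyc_on (crot P v) {w. cadj P v w}"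
  unfolding cyc_on_iff[OF nbrs_fin]
  using emb unfolding comb_embedding_def rotation_system_def by auto

lemma rot_adj: "cadj P v w \<Longrightarrow> cadj P v (crot P v w)"
  using rot_cyc[OF adj_V(1)] unfolding cyc_on_def by blast

lemma rot_inj: "cadj P v w \<Longrightarrow> cadj P v w' \<Longrightarrow> crot P v w = crot P v w' \<Longrightarrow> w = w'"
proof -
  assume h: "cadj P v w" "cadj P v w'" "crot P v w = crot P v w'"
  have "inj_on (crot P v) {w. cadj P v w}"
    using rot_cyc[OF adj_V(1)[OF h(1)]] cyc_on_iff[OF nbrs_fin] by (metis bij_betw_def)
  then show "w = w'" using h unfolding inj_on_def by blast
qed

text \<open>Induction along the rotation. Its main use is to recognise vertices of degree 2: two
  rotation equations that swap two neighbours leave no room for a third.\<close>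

lemma rot_closed:
  assumes "cadj P v s" "s \<in> X" "\<And>w. cadj P v w \<Longrightarrow> w \<in> X \<Longrightarrow> crot P v w \<in> X" "cadj P v w"
  shows "w \<in> X"
proof -
  let ?X = "X \<inter> {w. cadj P v w}"
  have "?X = {w. cadj P v w}"
    using assms(1-3) by (intro cyc_onD[OF rot_cyc[OF adj_V(1)[OF assms(1)]]]) (auto intro: rot_adj)
  then show ?thesis using assms(4) by blast
qed

lemma rot_reach: "cadj P v w \<Longrightarrow> cadj P v w' \<Longrightarrow> \<exists>k. (crot P v ^^ k) w = w'"
  using rot_cyc[OF adj_V(1)] cyc_on_iff[OF nbrs_fin] by (metis mem_Collect_eq)

lemma rot_pre: "cadj P v w \<Longrightarrow> \<exists>s. cadj P v s \<and> crot P v s = w"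
proof -
  assume h: "cadj P v w"
  have "crot P v ` {w. cadj P v w} = {w. cadj P v w}"
    using rot_cyc[OF adj_V(1)[OF h]] cyc_on_iff[OF nbrs_fin] by (metis bij_betw_def)
  then show ?thesis using h by (metis (mono_tags, lifting) imageE mem_Collect_eq)
qed

lemma darts_fin: "finite (darts (cadj P))"
  by (rule finite_subset[of _ "V \<times> V"]) (auto simp: darts_def finV dest: adj_V)

lemma fnext_darts: "fnext (crot P) ` darts (cadj P) \<subseteq> darts (cadj P)"
  unfolding darts_def fnext_def by (auto intro!: rot_adj dest: adj_sym)

lemma fnext_inj: "inj_on (fnext (crot P)) (darts (cadj P))"
  unfolding inj_on_def darts_def fnext_def by (auto dest: rot_inj[OF adj_sym adj_sym])

lemma face_eqI: "e \<in> face (crot P) d \<Longrightarrow> d \<in> darts (cadj P) \<Longrightarrow> face (crot P) e = face (crot P) d"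
  using face_eq[OF fnext_inj fnext_darts darts_fin] by blast

lemma face_darts: "d \<in> darts (cadj P) \<Longrightarrow> face (crot P) d \<subseteq> darts (cadj P)"
  using face_subset[OF _ fnext_darts] .

text \<open>The outer face is given only as a set of darts; the walk on it is forced because
  \<open>a\<close>, \<open>b\<close>, \<open>c\<close> are distinct, so each dart has a single
  possible successor in the set.\<close>

lemma tri_outer: "tri P a b c"
proof -
  have f: "face (crot P) (a, b) = {(a, b), (b, c), (c, a)}" using g unfolding good_def by blast
  have "cadj P a b" using emb unfolding comb_embedding_def darts_def by blast
  moreover have "crot P b a = c" "crot P c b = a" "crot P a c = b"
    using fnext_in_face[of "(a,b)" "crot P" "(a,b)"] fnext_in_face[of "(b,c)" "crot P" "(a,b)"]
      fnext_in_face[of "(c,a)" "crot P" "(a,b)"] ab bc ca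
    unfolding f fnext_def by auto
  ultimately show ?thesis unfolding tri_def by blast
qed

lemma outer_face: "face (crot P) (a, b) = odarts"
  using g unfolding good_def odarts_def by blast

lemma odarts_adj: "odarts \<subseteq> darts (cadj P)"
  using face_darts[of "(a,b)"] outer_face emb unfolding comb_embedding_def by simp

lemma tri_adj: "tri P x y z \<Longrightarrow> cadj P x y \<and> cadj P y z \<and> cadj P z x"
  unfolding tri_def using rot_adj adj_sym by metis

lemma quad_adj: "quad P x y z w \<Longrightarrow> cadj P x y \<and> cadj P y z \<and> cadj P z w \<and> cadj P w x"
  unfolding quad_def using rot_adj adj_sym by metis

lemma tri_rot: "tri P x y z \<Longrightarrow> tri P y z x"
  using tri_adj unfolding tri_def by blast

lemma quad_rotate: "quad P x y z w \<Longrightarrow> quad P y z w x"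
  using quad_adj[of x y z w] quad_rot[of P x y z w] by blast

lemma rquad_rotate: "rquad P x y z w t \<Longrightarrow> rquad P y z w x t"
  unfolding rquad_def using quad_rotate[of x y z w] by auto

text \<open>Closure under the face walk and under reversal gives closure under the rotation at every
  vertex, and connectivity spreads it to all darts.\<close>

lemma cover:
  assumes "X \<subseteq> darts (cadj P)" "d \<in> X"
    and n: "\<And>d. d \<in> X \<Longrightarrow> fnext (crot P) d \<in> X" and r: "\<And>u v. (u, v) \<in> X \<Longrightarrow> (v, u) \<in> X"
    and "cadj P s t"
  shows "(s, t) \<in> X"
proof -
  have all: "(w, v) \<in> X" if "(s, v) \<in> X" "cadj P v w" for s v w
  proof -
    have "cadj P v s" using that assms(1) adj_sym unfolding darts_def by blast
    then have "w \<in> {w. (w, v) \<in> X}"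
    proof (rule rot_closed[OF _ _ _ that(2)])
      show "s \<in> {w. (w, v) \<in> X}" using that by simp
      fix w assume "w \<in> {w. (w, v) \<in> X}"
      then have "(v, crot P v w) \<in> X" using n[of "(w, v)"] by (simp add: fnext_def)
      then show "crot P v w \<in> {w. (w, v) \<in> X}" using r by simp
    qed
    then show ?thesis by simp
  qed
  obtain x y where xy: "d = (x, y)" by (cases d)
  have yV: "y \<in> V" using assms(1,2) xy adj_V unfolding darts_def by blast
  have "(cadj P)\<^sup>*\<^sup>* y t" using emb yV adj_V(2)[OF assms(5)]
    unfolding comb_embedding_def connected_graph_def by blast
  then have "\<exists>u. (u, t) \<in> X"
  proof induction
    case base
    then show ?case using assms(2) xy by blast
  next
    case (step v w)
    then show ?case using all r by blast
  qed
  then show ?thesis using all adj_sym[OF assms(5)] by blast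
qed

lemma int_ne: "cadj P x y \<Longrightarrow> (x, y) \<notin> odarts \<Longrightarrow> interior_face (a, b) P (face (crot P) (x, y))"
  unfolding interior_face_def faces_def outer_face
  using face_self by (fastforce simp: darts_def)

lemma card_face_int:
  "cadj P x y \<Longrightarrow> (x, y) \<notin> odarts \<Longrightarrow> card (face (crot P) (x, y)) = 3 \<or> card (face (crot P) (x, y)) = 4"
  using int_ne g unfolding good_def comb_4ppt_def by blast

lemma card3_tri: "cadj P x y \<Longrightarrow> card (face (crot P) (x, y)) = 3 \<Longrightarrow> tri P x y (crot P y x)"
proof -
  assume h: "cadj P x y" "card (face (crot P) (x, y)) = 3"
  then have "(fnext (crot P) ^^ 3) (x, y) = (x, y)"
    using orbit_return[OF fnext_inj fnext_darts _ darts_fin] unfolding face_def darts_def by blast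
  then have "crot P (crot P y x) y = x" "crot P (crot P (crot P y x) y) (crot P y x) = y"
    by (auto simp: numeral_eq_Suc fnext_def)
  then show ?thesis using h unfolding tri_def by metis
qed

lemma card4_quad: "cadj P x y \<Longrightarrow> card (face (crot P) (x, y)) = 4 \<Longrightarrow>
  quad P x y (crot P y x) (crot P (crot P y x) y)"
proof -
  assume h: "cadj P x y" "card (face (crot P) (x, y)) = 4"
  then have "(fnext (crot P) ^^ 4) (x, y) = (x, y)"
    using orbit_return[OF fnext_inj fnext_darts _ darts_fin] unfolding face_def darts_def by blast
  then have "crot P (crot P (crot P y x) y) (crot P y x) = x"
    "crot P (crot P (crot P (crot P y x) y) (crot P y x)) (crot P (crot P y x) y) = y"
    by (auto simp: numeral_eq_Suc fnext_def)
  then show ?thesis using h unfolding quad_def by metis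
qed

lemma tri_distinct: "tri P x y z \<Longrightarrow> x \<noteq> y \<and> y \<noteq> z \<and> z \<noteq> x"
  using tri_adj adj_ne by blast

text \<open>The walk on the outer face closes after three steps, that on the quadrilateral after
  four; a common dart would identify two of \<open>a\<close>, \<open>b\<close>,
  \<open>c\<close>.\<close>

lemma quad_not_outer: "quad P x y z w \<Longrightarrow> qdarts x y z w \<inter> odarts = {}"
proof -
  have *: "(x, y) \<notin> odarts" if "quad P x y z w" for x y z w
  proof
    assume "(x, y) \<in> odarts"
    then have "face (crot P) (x, y) = odarts"
      using face_eqI[of "(x, y)" "(a, b)"] outer_face odarts_adj odarts_def by (metis insertI1 subsetD)
    then have q: "qdarts x y z w = odarts" using quad_face[OF that] by simp
    have r: "crot P b a = c" "crot P c b = a" "crot P a c = b" using tri_outer unfolding tri_def by auto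
    show False using \<open>(x, y) \<in> odarts\<close> that r ab bc ca unfolding odarts_def quad_def by auto
  qed
  assume q: "quad P x y z w"
  from quad_rotate[OF this] have q2: "quad P y z w x" .
  from quad_rotate[OF this] have q3: "quad P z w x y" .
  from quad_rotate[OF this] have q4: "quad P w x y z" .
  show ?thesis using *[OF q] *[OF q2] *[OF q3] *[OF q4] unfolding qdarts_def by simp
qed

text \<open>If \<open>x = z\<close>, the four darts are two edges in both directions, a set closed
  under reversal. They would then be the whole graph and leave no outer face.\<close>

lemma quad_diag: "quad P x y z w \<Longrightarrow> x \<noteq> z"
proof
  assume q: "quad P x y z w" and e: "x = z"
  let ?X = "qdarts x y z w"
  have "(a, b) \<in> ?X"
  proof (rule cover)
    show "?X \<subseteq> darts (cadj P)" using quad_adj[OF q] by (auto simp: qdarts_def darts_def)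
    show "(x, y) \<in> ?X" by (simp add: qdarts_def)
    show "fnext (crot P) d \<in> ?X" if "d \<in> ?X" for d
      using that q by (auto simp: qdarts_def quad_def fnext_def)
    show "(v, u) \<in> ?X" if "(u, v) \<in> ?X" for u v using that e by (auto simp: qdarts_def)
    show "cadj P a b" using tri_outer unfolding tri_def by blast
  qed
  then show False using quad_not_outer[OF q] unfolding odarts_def by blast
qed

lemma quad_distinct: "quad P x y z w \<Longrightarrow> distinct [x, y, z, w]"
  using quad_adj[of x y z w] adj_ne quad_diag[of x y z w] quad_diag[OF quad_rotate, of x y z w] by auto

lemma int_reflex: "cadj P x y \<Longrightarrow> (x, y) \<notin> odarts \<Longrightarrow>
   card {(w, v). (w, v) \<in> face (crot P) (x, y) \<and> \<not> creflex P v w} = 3"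
  using int_ne g unfolding good_def comb_4ppt_def comb_ppt_def comb_pt_def by blast

lemma tri_convex:
  assumes t: "tri P x y z" and n: "(x, y) \<notin> odarts"
  shows "\<not> creflex P y x \<and> \<not> creflex P z y \<and> \<not> creflex P x z"
proof -
  have d: "x \<noteq> y" "y \<noteq> z" "z \<noteq> x" using tri_distinct[OF t] by auto
  let ?S = "{(w, v). (w, v) \<in> tdarts x y z \<and> \<not> creflex P v w}"
  have c: "card ?S = 3" using int_reflex[OF _ n] tri_adj[OF t] tri_face[OF t] by simp
  have "card (tdarts x y z) = 3" using d by (simp add: tdarts_def)
  moreover have "?S \<subseteq> tdarts x y z" by auto
  moreover have "finite (tdarts x y z)" by (simp add: tdarts_def)
  ultimately have *: "?S = tdarts x y z" using c by (intro card_subset_eq) simp_all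
  have "(x, y) \<in> ?S" "(y, z) \<in> ?S" "(z, x) \<in> ?S" by (subst *, simp add: tdarts_def)+
  then show ?thesis by simp
qed

lemma quad_reflex:
  assumes q: "quad P x y z w"
  shows "\<exists>t. rquad P x y z w t"
proof -
  have d: "distinct [x, y, z, w]" using quad_distinct[OF q] .
  have n: "(x, y) \<notin> odarts" using quad_not_outer[OF q] by (auto simp: qdarts_def)
  let ?S = "{(w', v). (w', v) \<in> qdarts x y z w \<and> \<not> creflex P v w'}"
  have c: "card ?S = 3" using int_reflex[OF _ n] quad_adj[OF q] quad_face[OF q] by simp
  have c4: "card (qdarts x y z w) = 4" using d by (simp add: qdarts_def)
  have f: "finite (qdarts x y z w)" by (simp add: qdarts_def)
  have "card (qdarts x y z w - ?S) = 1"
    using card_Diff_subset[of ?S "qdarts x y z w"] c c4 f finite_subset[of ?S "qdarts x y z w"] by auto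
  then obtain e where e: "qdarts x y z w - ?S = {e}" by (meson card_1_singletonE)
  have R: "creflex P v u \<longleftrightarrow> (u, v) = e" if "(u, v) \<in> qdarts x y z w" for u v
    using e that by auto
  have "e \<in> qdarts x y z w" using e by auto
  then have "e = (x, y) \<or> e = (y, z) \<or> e = (z, w) \<or> e = (w, x)" by (auto simp: qdarts_def)
  moreover have "creflex P y x \<longleftrightarrow> (x, y) = e" "creflex P z y \<longleftrightarrow> (y, z) = e"
    "creflex P w z \<longleftrightarrow> (z, w) = e" "creflex P x w \<longleftrightarrow> (w, x) = e"
    by (rule R, simp add: qdarts_def)+
  ultimately have "rquad P x y z w (snd e)" using q d unfolding rquad_def by auto
  then show ?thesis by blast
qed

lemma pointed: "v \<in> V \<Longrightarrow> \<exists>!w. cadj P v w \<and> creflex P v w"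
proof -
  assume v: "v \<in> V"
  then have "card {w. cadj P v w \<and> creflex P v w} = 1"
    using g unfolding good_def comb_4ppt_def comb_ppt_def by blast
  then obtain w where "{w. cadj P v w \<and> creflex P v w} = {w}" by (meson card_1_singletonE)
  then have "(cadj P v x \<and> creflex P v x) \<longleftrightarrow> x = w" for x by (auto simp: set_eq_iff)
  then show ?thesis by auto
qed

lemma reflex_unique:
  "cadj P v w \<Longrightarrow> creflex P v w \<Longrightarrow> cadj P v w' \<Longrightarrow> creflex P v w' \<Longrightarrow> w = w'"
  using pointed[OF adj_V(1)] by blast

lemma outer_reflex: "creflex P a c" "creflex P b a" "creflex P c b"
  using g outer_face unfolding good_def comb_4ppt_def comb_ppt_def comb_pt_def odarts_def by auto

lemma rquad_corner: "rquad P x y z w t \<Longrightarrow> \<exists>s. (s, t) \<in> qdarts x y z w \<and> cadj P t s \<and> creflex P t s"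
  unfolding rquad_def qdarts_def by (auto dest!: quad_adj dest: adj_sym)

text \<open>Each outer vertex spends its only reflex angle on the outer face.\<close>

lemma rquad_outer: "rquad P x y z w t \<Longrightarrow> t \<notin> {a, b, c}"
proof
  assume q: "rquad P x y z w t" and t: "t \<in> {a, b, c}"
  obtain s where s: "(s, t) \<in> qdarts x y z w" "cadj P t s" "creflex P t s"
    using rquad_corner[OF q] by blast
  have o: "cadj P a c" "cadj P b a" "cadj P c b" using tri_adj[OF tri_outer] adj_sym by auto
  have "(s, t) \<in> odarts"
    using t s o outer_reflex reflex_unique[of a s c] reflex_unique[of b s a] reflex_unique[of c s b]
    unfolding odarts_def by auto
  then show False using quad_not_outer s(1) q unfolding rquad_def by blast
qed

lemma rquad_unique:
  assumes "rquad P x y z w t" "rquad P x' y' z' w' t"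
  shows "qdarts x y z w = qdarts x' y' z' w'"
proof -
  obtain s where s: "(s, t) \<in> qdarts x y z w" "cadj P t s" "creflex P t s"
    using rquad_corner[OF assms(1)] by blast
  obtain s' where s': "(s', t) \<in> qdarts x' y' z' w'" "cadj P t s'" "creflex P t s'"
    using rquad_corner[OF assms(2)] by blast
  have "s = s'" using reflex_unique s s' by blast
  have 1: "face (crot P) (x, y) = qdarts x y z w" "face (crot P) (x', y') = qdarts x' y' z' w'"
    using assms quad_face[of P x y z w] quad_face[of P x' y' z' w'] unfolding rquad_def by simp_all
  have 2: "(x, y) \<in> darts (cadj P)" "(x', y') \<in> darts (cadj P)"
    using assms unfolding rquad_def quad_def darts_def by auto
  show ?thesis using face_eqI[OF _ 2(1), of "(s, t)"] face_eqI[OF _ 2(2), of "(s, t)"] 1 s(1) s'(1) \<open>s = s'\<close>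
    by simp
qed

end

end

lemma face_cong:
  assumes "d \<in> X" "\<And>e. e \<in> X \<Longrightarrow> fnext r e \<in> X" "\<And>e. e \<in> X \<Longrightarrow> fnext r' e = fnext r e"
  shows "face r' d = face r d"
proof -
  have "(fnext r' ^^ k) d = (fnext r ^^ k) d \<and> (fnext r ^^ k) d \<in> X" for k
    by (induction k) (use assms in auto)
  then show ?thesis unfolding face_def by simp
qed

context frame
begin

section \<open>The flip as exchange of two chords of a pentagon\<close>

text \<open>Deleting \<open>uv\<close> leaves the pentagon \<open>w u p q v\<close>; the new chord \<open>y0 y2\<close> cuts off \<open>y1\<close>. The pentagon
  may touch itself (\<open>y1 = y3\<close> or \<open>y1 = y4\<close>), which happens at vertices of degree 2.\<close>

lemma flip_exists:
  assumes g: "good P" and T: "tri P u v w" and n: "(u, v) \<notin> odarts" and F: "rquad P v u p q z"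
    and pent: "(y0, y1, y2, y3, y4) \<in>
      {(w, u, p, q, v), (u, p, q, v, w), (p, q, v, w, u), (q, v, w, u, p), (v, w, u, p, q)}"
    and na: "\<not> cadj P y0 y2" and ne: "y0 \<noteq> y2" "y0 \<noteq> y3" "y2 \<noteq> y4" and z: "z \<in> {y0, y2, y3, y4}"
  shows "\<exists>P'. flip V (a, b) P P' \<and> good P' \<and>
    (\<forall>s t. cadj P' s t \<longleftrightarrow> (cadj P s t \<and> {s, t} \<noteq> {u, v}) \<or> {s, t} = {y0, y2}) \<and>
    tri P' y0 y1 y2 \<and> rquad P' y0 y2 y3 y4 z \<and>
    (\<forall>s t. cadj P s t \<and> (s, t) \<notin> tdarts u v w \<union> qdarts v u p q \<longrightarrow>
       crot P' t s = crot P t s \<and> creflex P' t s = creflex P t s)"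
proof -
  define A r D where "A = cadj P" and "r = crot P" and "D = darts A"
  define K where "K = tdarts u v w \<union> qdarts v u p q"
  have Q: "quad P v u p q" using F unfolding rquad_def by blast
  note symP = adj_sym[OF g, folded A_def]
  have tA: "A u v" "A v w" "A w u" using tri_adj[OF g T] unfolding A_def by auto
  have qA: "A v u" "A u p" "A p q" "A q v" using quad_adj[OF g Q] unfolding A_def by auto
  have tr: "r v u = w" "r w v = u" "r u w = v" using T unfolding tri_def r_def by auto
  have qr: "r u v = p" "r p u = q" "r q p = v" "r v q = u" using Q unfolding quad_def r_def by auto
  have td: "u \<noteq> v" "v \<noteq> w" "w \<noteq> u" using tri_distinct[OF g T] by auto
  have qd: "distinct [v, u, p, q]" using quad_distinct[OF g Q] .
  define M rM where "M = del_adj A u v" and "rM = del_rot r u v"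
  have M: "M s t \<longleftrightarrow> A s t \<and> {s, t} \<noteq> {u, v}" for s t unfolding M_def del_adj_def by simp
  have Msym: "M s t \<Longrightarrow> M t s" for s t using symP unfolding M by (simp add: insert_commute)
  have Mw: "M w u" "M u p" "M p q" "M q v" "M v w" using tA qA td qd by (auto simp: M doubleton_eq_iff)
  have rMw: "rM u w = p" "rM p u = q" "rM q p = v" "rM v q = w" "rM w v = u"
    using tr qr td qd unfolding rM_def del_rot_def by auto
  have My: "M y0 y1" "M y1 y2" "M y2 y3" "M y3 y4" "M y4 y0" using pent Mw by auto
  have rMy: "rM y1 y0 = y2" "rM y2 y1 = y3" "rM y3 y2 = y4" "rM y4 y3 = y0" "rM y0 y4 = y1"
    using pent rMw by auto
  define R where "R = {(y0, y1), (y1, y2), (y2, y3), (y3, y4), (y4, y0)}"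
  have R: "R = {(w, u), (u, p), (p, q), (q, v), (v, w)}" using pent unfolding R_def by auto
  have KR: "K = R \<union> {(u, v), (v, u)}" unfolding K_def R tdarts_def qdarts_def by auto
  have neM: "s \<noteq> t" if "M s t" for s t using that adj_ne[OF g] unfolding M A_def by blast
  have yne: "y0 \<noteq> y1" "y1 \<noteq> y2" "y2 \<noteq> y3" "y3 \<noteq> y4" "y4 \<noteq> y0" using My neM by blast+
  have na': "\<not> A y2 y0" "\<not> A y0 y2" using na symP unfolding A_def by blast+
  have inV: "s \<in> V" "t \<in> V" if "M s t" for s t using that adj_V[OF g] unfolding M A_def by blast+
  \<comment> \<open>The chord enters the rotation at \<open>y0\<close> between \<open>y4\<close> and
    \<open>y1\<close>, and at \<open>y2\<close> between \<open>y1\<close> and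
    \<open>y3\<close>.\<close>
  define r' where "r' = (\<lambda>s t. if s = y0 \<and> t = y4 then y2 else if s = y0 \<and> t = y2 then y1
      else if s = y2 \<and> t = y1 then y0 else if s = y2 \<and> t = y0 then y3 else rM s t)"
  define A' where "A' = (\<lambda>s t. M s t \<or> {s, t} = {y0, y2})"
  define T' F' where "T' = tdarts y0 y1 y2" and "F' = qdarts y0 y2 y3 y4"
  \<comment> \<open>The reflex angle of the old quadrilateral stays at \<open>z\<close>, now inside
    the new one; this is why \<open>z\<close> has to be one of its vertices.\<close>
  define c' where "c' = (\<lambda>t s. if (s, t) \<in> T' then False else if (s, t) \<in> F' then t = z else creflex P t s)"
  define P' where "P' = \<lparr>cadj = A', crot = r', creflex = c'\<rparr>"
  have P'[simp]: "cadj P' = A'" "crot P' = r'" "creflex P' = c'" unfolding P'_def by simp_all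
  have T'F': "T' \<inter> F' = {}" using yne ne unfolding T'_def F'_def tdarts_def qdarts_def by auto
  have K': "T' \<union> F' = R \<union> {(y0, y2), (y2, y0)}"
    unfolding T'_def F'_def R_def tdarts_def qdarts_def by auto
  have RM: "M s t" if "(s, t) \<in> R" for s t using that My unfolding R_def by auto
  have D': "darts A' = (D - K) \<union> (T' \<union> F')"
  proof -
    have "(s, t) \<in> darts A' \<longleftrightarrow> (s, t) \<in> (D - K) \<union> (T' \<union> F')" for s t
      unfolding K' KR D_def darts_def A'_def using RM[of s t] by (auto simp: M doubleton_eq_iff)
    then show ?thesis by auto
  qed
  have disj: "d \<notin> T'" "d \<notin> F'" if "d \<in> D - K" for d
    using that K' KR na' unfolding D_def darts_def by auto
  have triP': "tri P' y0 y1 y2" using My rMy yne ne unfolding tri_def P' A'_def r'_def by auto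
  have triP'2: "tri P' y2 y0 y1" using My rMy yne ne unfolding tri_def P' A'_def r'_def by auto
  have quadP': "quad P' y0 y2 y3 y4" using My rMy yne ne unfolding quad_def P' A'_def r'_def by auto
  have faceT': "face r' (y0, y1) = T'" "face r' (y2, y0) = T'"
    using tri_face[OF triP'] tri_face[OF triP'2] unfolding T'_def by (auto simp: tdarts_def)
  have faceF': "face r' (y0, y2) = F'" using quad_face[OF quadP'] unfolding F'_def by simp
  have faceT: "face r (u, v) = tdarts u v w" using tri_face[OF T] unfolding r_def .
  have faceF: "face r (v, u) = qdarts v u p q" using quad_face[OF Q] unfolding r_def .
  have Dn: "fnext r e \<in> D" if "e \<in> D" for e
    using fnext_darts[OF g] that unfolding r_def D_def A_def by auto
  have Dinj: "inj_on (fnext r) D" using fnext_inj[OF g] unfolding r_def D_def A_def .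
  have KD: "K \<subseteq> D" using tA qA unfolding K_def D_def darts_def tdarts_def qdarts_def by auto
  \<comment> \<open>\<open>K\<close> consists of whole faces, so it is closed backwards as well and
    its complement is closed under the face walk.\<close>
  have Kn: "K \<subseteq> fnext r ` K"
    unfolding K_def tdarts_def qdarts_def fnext_def using tr qr by (simp add: image_Un)
  have DKn: "fnext r e \<in> D - K" if "e \<in> D - K" for e
  proof -
    have "fnext r e \<notin> K"
    proof
      assume "fnext r e \<in> K"
      then obtain e' where e': "e' \<in> K" "fnext r e = fnext r e'" using Kn by blast
      then have "e = e'" using Dinj that KD by (meson DiffD1 inj_onD subsetD)
      then show False using e' that by blast
    qed
    then show ?thesis using Dn that by blast
  qed
  \<comment> \<open>Deletion changes the successor only after the darts \<open>(w, u)\<close> and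
    \<open>(q, v)\<close>, insertion only after \<open>(y4, y0)\<close>, \<open>(y1, y2)\<close> and
    the chord itself; none of these lies in \<open>D - K\<close>.\<close>
  have rr: "r' t s = r t s" if "(s, t) \<in> D - K" for s t
  proof -
    have st: "A s t" "(s, t) \<notin> R" "(s, t) \<noteq> (u, v)" "(s, t) \<noteq> (v, u)"
      using that unfolding KR D_def darts_def by auto
    have "\<not> (t = y0 \<and> s = y4)" "\<not> (t = y2 \<and> s = y1)" using st(2) unfolding R_def by blast+
    moreover have "\<not> (t = y0 \<and> s = y2)" "\<not> (t = y2 \<and> s = y0)" using st(1) na' by blast+
    ultimately have "r' t s = rM t s" unfolding r'_def by (simp only: if_False)
    moreover have "r u s \<noteq> v" if "t = u"
    proof
      assume "r u s = v"
      then have "s = w" using rot_inj[OF g, of u s w] st(1) symP tA tr that unfolding A_def r_def by auto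
      then show False using st(2) that R by auto
    qed
    moreover have "r v s \<noteq> u" if "t = v"
    proof
      assume "r v s = u"
      then have "s = q" using rot_inj[OF g, of v s q] st(1) symP qA qr that unfolding A_def r_def by auto
      then show False using st(2) that R by auto
    qed
    ultimately show ?thesis unfolding rM_def del_rot_def by auto
  qed
  have fn: "fnext r' e = fnext r e" if "e \<in> D - K" for e
    using rr[of "fst e" "snd e"] that by (simp add: fnext_def)
  have faceO: "face r' d = face r d" if "d \<in> D - K" for d
    using that by (intro face_cong[of d "D - K"] DKn fn)
  have faceDK: "face r d \<subseteq> D - K" if "d \<in> D - K" for d
    using that DKn by (intro face_subset) auto
  have TK: "tdarts u v w \<subseteq> K" "qdarts v u p q \<subseteq> K" unfolding K_def by auto
  have Ttri: "face r d = tdarts u v w" if "d \<in> tdarts u v w" for d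
    using face_eqI[OF g, of d "(u, v)"] that faceT tA unfolding r_def A_def darts_def by simp
  have Fquad: "face r d = qdarts v u p q" if "d \<in> qdarts v u p q" for d
    using face_eqI[OF g, of d "(v, u)"] that faceF qA unfolding r_def A_def darts_def by simp
  have Tt': "face r' d = T'" if "d \<in> T'" for d
  proof -
    have "tri P' y1 y2 y0" using My rMy yne ne unfolding tri_def P' A'_def r'_def by auto
    from tri_face[OF this] have 1: "face r' (y1, y2) = T'" unfolding T'_def tdarts_def by auto
    have "d = (y0, y1) \<or> d = (y1, y2) \<or> d = (y2, y0)"
      using that unfolding T'_def tdarts_def by blast
    then show ?thesis using faceT' 1 by (elim disjE) simp_all
  qed
  have Ft': "face r' d = F'" if "d \<in> F'" for d
  proof -
    have 1: "quad P' y2 y3 y4 y0" using quadP' My unfolding quad_def P' A'_def by auto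
    have 2: "quad P' y3 y4 y0 y2" using quadP' My unfolding quad_def P' A'_def by auto
    have 3: "quad P' y4 y0 y2 y3" using quadP' My unfolding quad_def P' A'_def by auto
    have 4: "face r' (y2, y3) = F'" "face r' (y3, y4) = F'" "face r' (y4, y0) = F'"
      using quad_face[OF 1] quad_face[OF 2] quad_face[OF 3] unfolding F'_def qdarts_def by auto
    have "d = (y0, y2) \<or> d = (y2, y3) \<or> d = (y3, y4) \<or> d = (y4, y0)"
      using that unfolding F'_def qdarts_def by blast
    then show ?thesis using faceF' 4 by (elim disjE) simp_all
  qed
  have facesP: "faces A r = insert (tdarts u v w) (insert (qdarts v u p q) (face r ` (D - K)))"
  proof -
    have "face r ` K = {tdarts u v w, qdarts v u p q}"    proof -
      have "face r ` tdarts u v w = {tdarts u v w}"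
        using Ttri by (auto simp: image_def) (auto simp: tdarts_def)
      moreover have "face r ` qdarts v u p q = {qdarts v u p q}"
        using Fquad by (auto simp: image_def) (auto simp: qdarts_def)
      ultimately show ?thesis unfolding K_def image_Un by auto
    qed
    moreover have "D = K \<union> (D - K)" using KD by blast
    then have "face r ` D = face r ` K \<union> face r ` (D - K)" by (metis image_Un)
    ultimately show ?thesis unfolding faces_def D_def[symmetric] by simp
  qed
  have facesP': "faces A' r' = insert T' (insert F' (face r ` (D - K)))"
  proof -
    have "(y0, y1) \<in> T'" "(y0, y2) \<in> F'" unfolding T'_def F'_def tdarts_def qdarts_def by simp_all
    then have "face r' ` T' = {T'}" "face r' ` F' = {F'}" using Tt' Ft' by (auto simp: image_def)
    moreover have "face r' ` (D - K) = face r ` (D - K)" using faceO by (intro image_cong) auto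
    ultimately show ?thesis unfolding faces_def D' image_Un by auto
  qed
  have fin: "finite (face r ` (D - K))" using darts_fin[OF g] unfolding D_def A_def by auto
  have nin: "X \<notin> face r ` (D - K)" if "d \<in> X" "d \<notin> D - K" for X d
    using that faceDK by blast
  \<comment> \<open>One edge and two faces are exchanged for one edge and two faces, so Euler's
    formula carries over.\<close>
  have c1: "card (faces A r) = card (face r ` (D - K)) + 2"
  proof -
    have "tdarts u v w \<noteq> qdarts v u p q" using td qd unfolding tdarts_def qdarts_def by auto
    moreover have "tdarts u v w \<notin> face r ` (D - K)"
      by (rule nin[of "(u, v)"]) (auto simp: tdarts_def KR)
    moreover have "qdarts v u p q \<notin> face r ` (D - K)"
      by (rule nin[of "(v, u)"]) (auto simp: qdarts_def KR)
    ultimately show ?thesis unfolding facesP using fin by simp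
  qed
  have c2: "card (faces A' r') = card (face r ` (D - K)) + 2"
  proof -
    have "T' \<noteq> F'" using T'F' unfolding T'_def tdarts_def by auto
    moreover have "T' \<notin> face r ` (D - K)"
      by (rule nin[of "(y2, y0)"]) (use na' in \<open>auto simp: T'_def tdarts_def D_def darts_def\<close>)
    moreover have "F' \<notin> face r ` (D - K)"
      by (rule nin[of "(y0, y2)"]) (use na' in \<open>auto simp: F'_def qdarts_def D_def darts_def\<close>)
    ultimately show ?thesis unfolding facesP' using fin by simp
  qed
  have c3: "card (uedges A) = card (uedges M) + 1" "card (uedges A') = card (uedges M) + 1"
  proof -
    have 1: "uedges A = insert {u, v} (uedges M)"
      using tA(1) unfolding uedges_def M by blast
    have 2: "uedges A' = insert {y0, y2} (uedges M)"
      unfolding uedges_def A'_def by blast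
    have n1: "{u, v} \<notin> uedges M" unfolding uedges_def M by blast
    have n2: "{y0, y2} \<notin> uedges M"
      unfolding uedges_def M using na' by (auto simp: doubleton_eq_iff)
    have "uedges M \<subseteq> Pow V" unfolding uedges_def using inV by blast
    then have "finite (uedges M)" using finV[OF g] by (meson finite_Pow_iff finite_subset)
    then show "card (uedges A) = card (uedges M) + 1" "card (uedges A') = card (uedges M) + 1"
      unfolding 1 2 using n1 n2 by simp_all
  qed
  have simple: "simple_graph V A'"
    unfolding simple_graph_def A'_def
    using inV neM Msym My ne(1) by (auto simp: doubleton_eq_iff)
  have conn: "connected_graph V A'"
  proof -
    have A'M: "A' s t" if "M s t" for s t using that unfolding A'_def by blast
    \<comment> \<open>The ends of the deleted edge remain joined through \<open>w\<close>.\<close>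
    have uv: "A'\<^sup>*\<^sup>* u v" using A'M[OF Msym[OF Mw(1)]] A'M[OF Msym[OF Mw(5)]] by (meson converse_rtranclp_into_rtranclp rtranclp.rtrancl_refl)
    have vu: "A'\<^sup>*\<^sup>* v u" using A'M[OF Mw(1)] A'M[OF Mw(5)] by (meson converse_rtranclp_into_rtranclp rtranclp.rtrancl_refl)
    have "A'\<^sup>*\<^sup>* s t" if "A s t" for s t
    proof (cases "{s, t} = {u, v}")
      case True
      then show ?thesis using uv vu by (auto simp: doubleton_eq_iff)
    next
      case False
      then show ?thesis using that A'M M by blast
    qed
    then have AA: "A'\<^sup>*\<^sup>* s t" if "A s t" for s t using that .
    have "A'\<^sup>*\<^sup>* s t" if "A\<^sup>*\<^sup>* s t" for s t
      using that by induction (auto intro: rtranclp_trans AA)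
    then show ?thesis using emb[OF g] unfolding comb_embedding_def connected_graph_def A_def by blast
  qed
  have cycM: "cyc_on (rM t) {s. M t s}" if t: "t \<in> V" for t
  proof -
    have c: "cyc_on (r t) {s. A t s}" using rot_cyc[OF g t] unfolding r_def A_def .
    consider "t = u" | "t = v" | "t \<noteq> u" "t \<noteq> v" by blast
    then show ?thesis
    proof cases
      case 1
      have "{s. M t s} = {s. A t s} - {v}" using 1 td by (auto simp: M doubleton_eq_iff)
      moreover have "cyc_on (rM t) ({s. A t s} - {v})"
      proof (rule cyc_on_delete[OF c])
        have "w \<in> {s. A t s}" using 1 symP tA by blast
        then show "{s. A t s} \<noteq> {v}" using td(2) by (metis singletonD)
      qed (simp add: 1 rM_def del_rot_def)
      ultimately show ?thesis by simp
    next
      case 2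
      have "{s. M t s} = {s. A t s} - {u}" using 2 td by (auto simp: M doubleton_eq_iff)
      moreover have "cyc_on (rM t) ({s. A t s} - {u})"
      proof (rule cyc_on_delete[OF c])
        have "w \<in> {s. A t s}" using 2 symP tA by blast
        then show "{s. A t s} \<noteq> {u}" using td(3) by (metis singletonD)
      qed (use td in \<open>simp add: 2 rM_def del_rot_def\<close>)
      ultimately show ?thesis by simp
    next
      case 3
      then have "M t = A t" by (auto simp: M doubleton_eq_iff fun_eq_iff)
      moreover have "rM t = r t" using 3 by (simp add: rM_def del_rot_def fun_eq_iff)
      ultimately show ?thesis using c by simp
    qed
  qed
  have cyc': "cyc_on (r' t) {s. A' t s}" if t: "t \<in> V" for t
  proof -
    consider "t = y0" | "t = y2" | "t \<noteq> y0" "t \<noteq> y2" by blast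
    then show ?thesis
    proof cases
      case 1
      have "{s. A' t s} = insert y2 {s. M t s}" using 1 ne unfolding A'_def by (auto simp: doubleton_eq_iff)
      moreover have "cyc_on (r' t) (insert y2 {s. M t s})"
      proof (rule cyc_on_insert[OF cycM[OF t], of y4])
        show "y4 \<in> {s. M t s}" unfolding 1 using My(5) Msym by blast
        show "y2 \<notin> {s. M t s}" unfolding 1 M using na' by blast
        show "r' t w = rM t w" if "w \<in> {s. M t s}" "w \<noteq> y4" for w
        proof -
          have "w \<noteq> y2" using that(1) na' unfolding 1 M by blast
          then show ?thesis using that(2) ne(1) unfolding 1 r'_def by simp
        qed
        show "r' t y4 = y2" unfolding 1 r'_def by simp
        show "r' t y2 = rM t y4" unfolding 1 rMy(5) r'_def using ne(3) by simp
      qed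
      ultimately show ?thesis by simp
    next
      case 2
      have "{s. A' t s} = insert y0 {s. M t s}" using 2 ne unfolding A'_def by (auto simp: doubleton_eq_iff)
      moreover have "cyc_on (r' t) (insert y0 {s. M t s})"
      proof (rule cyc_on_insert[OF cycM[OF t], of y1])
        show "y1 \<in> {s. M t s}" unfolding 2 using My(2) Msym by blast
        show "y0 \<notin> {s. M t s}" unfolding 2 M using na' by blast
        show "r' t w = rM t w" if "w \<in> {s. M t s}" "w \<noteq> y1" for w
        proof -
          have "w \<noteq> y0" using that(1) na' unfolding 2 M by blast
          then show ?thesis using that(2) ne(1) unfolding 2 r'_def by simp
        qed
        show "r' t y1 = y0" unfolding 2 r'_def using ne(1) by simp
        show "r' t y0 = rM t y1" unfolding 2 rMy(2) r'_def using ne(1) yne(1) by simp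
      qed
      ultimately show ?thesis by simp
    next
      case 3
      then have "{s. A' t s} = {s. M t s}" unfolding A'_def by (auto simp: doubleton_eq_iff)
      moreover have "r' t = rM t" using 3 by (simp add: r'_def fun_eq_iff)
      ultimately show ?thesis using cycM[OF t] by simp
    qed
  qed
  have finN: "finite {s. A' t s}" for t
    by (rule finite_subset[OF _ finV[OF g]]) (use simple in \<open>auto simp: simple_graph_def\<close>)
  have rs: "rotation_system V A' r'"
    unfolding rotation_system_def using cyc' cyc_on_iff[OF finN] by auto
  have planar: "planar_rotation V A' r'"
    using emb[OF g] c1 c2 c3 unfolding comb_embedding_def planar_rotation_def A_def r_def by simp
  have ab_face: "(a, b) \<in> D - K"
  proof -
    have "(a, b) \<in> D" using odarts_adj[OF g] unfolding odarts_def D_def A_def by auto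
    moreover have "(a, b) \<notin> qdarts v u p q" using quad_not_outer[OF g Q] unfolding odarts_def by auto
    moreover have "(a, b) \<notin> tdarts u v w"
    proof
      assume "(a, b) \<in> tdarts u v w"
      then have "tdarts u v w = odarts" using Ttri outer_face[OF g] unfolding r_def by blast
      then show False using n by (auto simp: tdarts_def)
    qed
    ultimately show ?thesis unfolding K_def by blast
  qed
  have outer': "face r' (a, b) = odarts"
    using faceO[OF ab_face] outer_face[OF g] unfolding r_def by simp
  have odK: "odarts \<subseteq> D - K" using faceDK[OF ab_face] outer_face[OF g] unfolding r_def by simp
  have emb': "comb_embedding V (a, b) P'"
    unfolding comb_embedding_def P' using finV[OF g] simple conn rs planar ab_face D' by auto
  have cc: "c' t s = creflex P t s" if "(s, t) \<in> D - K" for s t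
    using disj[OF that] unfolding c'_def by simp
  have dF: "distinct [y0, y2, y3, y4]" using yne ne by auto
  have cF: "c' t s \<longleftrightarrow> t = z" if "(s, t) \<in> F'" for s t
    using that T'F' unfolding c'_def by auto
  have rq': "rquad P' y0 y2 y3 y4 z"
    unfolding rquad_def P' using quadP' z cF unfolding F'_def qdarts_def by auto
  have ifaces: "card {(w, v). (w, v) \<in> f \<and> \<not> c' v w} = 3 \<and> (card f = 3 \<or> card f = 4)"
    if f: "interior_face (a, b) P' f" for f
  proof -
    have "f \<in> faces A' r'" "f \<noteq> odarts" using f outer' unfolding interior_face_def by auto
    then consider "f = T'" | "f = F'" | "f \<in> face r ` (D - K)" "f \<noteq> odarts" unfolding facesP' by blast
    then show ?thesis
    proof cases
      case 1
      have "{(w, v). (w, v) \<in> T' \<and> \<not> c' v w} = T'" unfolding c'_def by auto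
      moreover have "card T' = 3" using yne ne unfolding T'_def tdarts_def by auto
      ultimately show ?thesis using 1 by simp
    next
      case 2
      obtain s where s: "(s, z) \<in> F'" using z unfolding F'_def qdarts_def by auto
      have us: "(w, z) \<in> F' \<Longrightarrow> w = s" for w
        using s dF unfolding F'_def qdarts_def by auto
      have "((w, v) \<in> F' \<and> \<not> c' v w) \<longleftrightarrow> (w, v) \<in> F' - {(s, z)}" for w v
        using cF[of w v] us[of w] by blast
      then have "{(w, v). (w, v) \<in> F' \<and> \<not> c' v w} = F' - {(s, z)}"
        by (simp add: set_eq_iff)
      moreover have "card F' = 4" using dF unfolding F'_def qdarts_def by auto
      ultimately show ?thesis using 2 s by simp
    next
      case 3
      then obtain d where d: "d \<in> D - K" "f = face r d" by blast
      have *: "{(w, v). (w, v) \<in> f \<and> \<not> c' v w} = {(w, v). (w, v) \<in> f \<and> \<not> creflex P v w}"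
        using cc faceDK[OF d(1)] d(2) by auto
      have "interior_face (a, b) P f"
        using 3 d outer_face[OF g] unfolding interior_face_def faces_def D_def A_def r_def by auto
      then show ?thesis unfolding *
        using g unfolding good_def comb_4ppt_def comb_ppt_def comb_pt_def by blast
    qed
  qed
  \<comment> \<open>Only \<open>z\<close> has its reflex angle among the changed corners, and it
    gets exactly one back.\<close>
  have point: "card {w. A' t w \<and> c' t w} = 1" if t: "t \<in> V" for t
  proof -
    obtain x where x: "A t x" "creflex P t x" using pointed[OF g t] unfolding A_def by blast
    have xu: "y = x" if "A t y" "creflex P t y" for y
      using reflex_unique[OF g] that x unfolding A_def by blast
    have dK: "A' t y \<longleftrightarrow> (y, t) \<in> D - K \<or> (y, t) \<in> T' \<or> (y, t) \<in> F'" for y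
    proof -
      have "A' t y \<longleftrightarrow> (y, t) \<in> darts A'" using simple unfolding darts_def simple_graph_def by blast
      then show ?thesis unfolding D' by blast
    qed
    obtain s where s: "(s, z) \<in> qdarts v u p q" "A z s" "creflex P z s"
      using rquad_corner[OF g F] unfolding A_def by blast
    show ?thesis
    proof (cases "t = z")
      case True
      then have "x = s" using xu s by blast
      then have nD: "\<not> ((y, t) \<in> D - K \<and> creflex P t y)" for y
        using xu[of y] symP s(1) True TK unfolding D_def darts_def by auto
      obtain s' where s': "(s', z) \<in> F'" using z unfolding F'_def qdarts_def by auto
      have us: "(w, z) \<in> F' \<Longrightarrow> w = s'" for w
        using s' dF unfolding F'_def qdarts_def by auto
      have "(A' t w \<and> c' t w) \<longleftrightarrow> w = s'" for w
      proof
        assume w: "A' t w \<and> c' t w"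
        have "(w, t) \<notin> D - K" using nD[of w] cc[of w t] w by blast
        moreover have "(w, t) \<notin> T'" using w unfolding c'_def by auto
        ultimately show "w = s'" using w us[of w] True unfolding dK by blast
      next
        assume "w = s'"
        then show "A' t w \<and> c' t w" using s' cF[OF s'] True unfolding dK by blast
      qed
      then have "{w. A' t w \<and> c' t w} = {s'}" by (simp add: set_eq_iff)
      then show ?thesis by simp
    next
      case False
      have "(x, t) \<notin> K"
      proof
        assume "(x, t) \<in> K"
        then consider "(x, t) \<in> tdarts u v w" | "(x, t) \<in> qdarts v u p q" unfolding K_def by blast
        then show False
        proof cases
          case 1
          then show ?thesis using tri_convex[OF g T n] x(2) unfolding tdarts_def by auto
        next
          case 2
          then show ?thesis using F x(2) False unfolding rquad_def qdarts_def by auto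
        qed
      qed
      then have xD: "(x, t) \<in> D - K" using x symP unfolding D_def darts_def by auto
      have "y = x" if "A' t y" "c' t y" for y
      proof -
        have "(y, t) \<notin> T'" using that(2) unfolding c'_def by auto
        moreover have "(y, t) \<notin> F'" using that(2) cF[of y t] False by blast
        ultimately have yD: "(y, t) \<in> D - K" using that(1) unfolding dK by blast
        then have "A t y" using symP unfolding D_def darts_def by blast
        then show ?thesis using xu[of y] that(2) cc[OF yD] by blast
      qed
      moreover have "A' t x" "c' t x" using xD cc[OF xD] x(2) unfolding dK by blast+
      ultimately have "{w. A' t w \<and> c' t w} = {x}" by blast
      then show ?thesis by simp
    qed
  qed
  have good': "good P'"
    unfolding good_def comb_4ppt_def comb_ppt_def comb_pt_def
  proof (intro conjI allI impI ballI emb')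
    fix f assume f: "interior_face (a, b) P' f"
    show "card {(w, v). (w, v) \<in> f \<and> \<not> creflex P' v w} = 3" using ifaces[OF f] by simp
    show "card f = 3 \<or> card f = 4" using ifaces[OF f] by simp
  next
    fix s t assume "(s, t) \<in> face (crot P') (a, b)"
    then have st: "(s, t) \<in> odarts" using outer' by simp
    then have "(s, t) \<in> D - K" using odK by blast
    then show "creflex P' t s" using cc[of s t] st outer_reflex[OF g] unfolding odarts_def by auto
  next
    fix t assume "t \<in> V"
    from point[OF this] show "card {w. cadj P' t w \<and> creflex P' t w} \<le> 1"
      "card {w. cadj P' t w \<and> creflex P' t w} = 1" by simp_all
  next
    show "face (crot P') (a, b) = {(a, b), (b, c), (c, a)}" using outer' unfolding odarts_def by simp
  qed
  have "flip V (a, b) P P'"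
    unfolding flip_def
  proof (intro conjI, goal_cases)
    case 1
    show ?case using g unfolding good_def by blast
  next
    case 2
    show ?case using good' unfolding good_def by blast
  next
    case 3
    show ?case
    proof (rule exI[of _ u], rule exI[of _ v], rule exI[of _ y0], rule exI[of _ y2], intro conjI)
    show "cadj P u v" "\<not> cadj P y0 y2" "cadj P' y0 y2" using tA(1) na unfolding A_def by (auto simp: A'_def)
    show "card (face (crot P) (u, v)) = 3" using faceT td unfolding r_def[symmetric] tdarts_def by simp
    show "(a, b) \<notin> face (crot P) (u, v)" "(a, b) \<notin> face (crot P) (v, u)"
      using ab_face unfolding r_def[symmetric] faceT faceF K_def by auto
    show "del_adj (cadj P) u v = del_adj (cadj P') y0 y2"
      unfolding A_def[symmetric] M_def[symmetric] P' using na'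
      by (auto simp: fun_eq_iff del_adj_def A'_def M doubleton_eq_iff)
    show "\<forall>s t. del_adj (cadj P) u v s t \<longrightarrow> del_rot (crot P) u v s t = del_rot (crot P') y0 y2 s t"
      unfolding A_def[symmetric] M_def[symmetric] r_def[symmetric] rM_def[symmetric] P'
    proof (intro allI impI)
      fix s t assume st: "M s t"
      have cm: "M s (rM s t)"
      proof -
        have "cyc_on (rM s) {x. M s x}" using cycM inV[OF st] by blast
        then show ?thesis using st unfolding cyc_on_def by blast
      qed
      have "rM y0 t \<noteq> y2" if "s = y0" using cm that na' by (auto simp: M)
      moreover have "rM y2 t \<noteq> y0" if "s = y2" using cm that na' by (auto simp: M)
      moreover have "\<not> (s = y0 \<and> t = y2)" "\<not> (s = y2 \<and> t = y0)" using st na' by (auto simp: M)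
      ultimately show "rM s t = del_rot r' y0 y2 s t"
        using rMy ne yne unfolding del_rot_def r'_def by auto
    qed
    show "region (crot P) u v = region (crot P') y0 y2"
    proof -
      have "region r u v = R"
        unfolding region_def faceT faceF K_def[symmetric] KR R using td qd by auto
      moreover have "region r' y0 y2 = R"
        unfolding region_def faceT' faceF' using K' yne ne na' RM by (auto simp: M Un_commute)
      ultimately show ?thesis unfolding r_def by simp
    qed
    have "card T' = 3" using yne ne unfolding T'_def tdarts_def by auto
    moreover have "card F' = 4" using dF unfolding F'_def qdarts_def by auto
    moreover have "card (face (crot P) (v, u)) = 4"
      using faceF qd unfolding r_def[symmetric] qdarts_def by auto
    ultimately show "card (face (crot P') (y0, y2)) = 3 \<and>
         card (face (crot P') (y2, y0)) = card (face (crot P) (v, u)) \<or>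
        card (face (crot P') (y2, y0)) = 3 \<and>
         card (face (crot P') (y0, y2)) = card (face (crot P) (v, u))"
      unfolding P' faceT' faceF' by simp
    show "\<forall>s t. cadj P s t \<and> (t, s) \<notin> face (crot P) (u, v) \<union> face (crot P) (v, u) \<longrightarrow>
        creflex P' s t = creflex P s t"
    proof (intro allI impI)
      fix s t assume st: "cadj P s t \<and> (t, s) \<notin> face (crot P) (u, v) \<union> face (crot P) (v, u)"
      then have "(t, s) \<in> D - K"
        using symP unfolding r_def[symmetric] faceT faceF K_def D_def darts_def A_def by auto
      then show "creflex P' s t = creflex P s t" using cc by simp
    qed
    qed
  qed
  moreover have "\<forall>s t. cadj P' s t \<longleftrightarrow> (cadj P s t \<and> {s, t} \<noteq> {u, v}) \<or> {s, t} = {y0, y2}"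
    by (simp add: A'_def M A_def)
  moreover have "\<forall>s t. cadj P s t \<and> (s, t) \<notin> tdarts u v w \<union> qdarts v u p q \<longrightarrow>
       crot P' t s = crot P t s \<and> creflex P' t s = creflex P t s"
    using rr cc unfolding K_def[symmetric] D_def darts_def A_def r_def by simp
  ultimately show ?thesis using good' triP' rq' by blast
qed

end

section \<open>Even edge sets bound\<close>

lemma even_card_sym_diff:
  assumes "finite A" "finite B"
  shows "even (card (sym_diff A B)) \<longleftrightarrow> (even (card A) \<longleftrightarrow> even (card B))"
proof -
  have "card (sym_diff A B) = card (A - B) + card (B - A)"
    using assms by (intro card_Un_disjoint) auto
  moreover have "card A = card (A - B) + card (A \<inter> B)"
    using card_Int_Diff[OF assms(1), of B] by simp
  moreover have "card B = card (B - A) + card (A \<inter> B)"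
    using card_Int_Diff[OF assms(2), of A] by (simp add: Int_commute)
  ultimately show ?thesis by presburger
qed

lemma sym_diff_cancel: "sym_diff A (sym_diff A B) = B"
  by blast

definition odd_at :: "'a set set \<Rightarrow> 'a \<Rightarrow> bool" where
  "odd_at B x \<longleftrightarrow> odd (card {w. {x, w} \<in> B})"

lemma fin_star: "finite B \<Longrightarrow> finite {w. {x, w} \<in> B}"
proof -
  assume "finite B"
  moreover have "inj (\<lambda>w. {x, w})" by (auto simp: inj_def doubleton_eq_iff)
  ultimately have "finite ((\<lambda>w. {x, w}) -` B)" by (rule finite_vimageI)
  then show ?thesis by (simp add: vimage_def)
qed

lemma odd_at_sym_diff: "finite A \<Longrightarrow> finite B \<Longrightarrow> odd_at (sym_diff A B) x \<longleftrightarrow> (odd_at A x \<noteq> odd_at B x)"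
proof -
  assume f: "finite A" "finite B"
  have "{w. {x, w} \<in> sym_diff A B} = sym_diff {w. {x, w} \<in> A} {w. {x, w} \<in> B}" by auto
  then show ?thesis unfolding odd_at_def using even_card_sym_diff[OF fin_star[OF f(1)] fin_star[OF f(2)]] by simp
qed

lemma odd_at_edge: "u \<noteq> v \<Longrightarrow> odd_at {{u, v}} x \<longleftrightarrow> x = u \<or> x = v"
proof -
  assume ne: "u \<noteq> v"
  have "{w. {x, w} \<in> {{u, v}}} = (if x = u then {v} else if x = v then {u} else {})"
    using ne by (auto simp: doubleton_eq_iff)
  then show ?thesis unfolding odd_at_def by simp
qed

text \<open>Every set of vertices avoiding \<open>p\<close> is the set of odd vertices, up to \<open>p\<close>, of some union of
  paths to \<open>p\<close>; adding such unions to even sets gives an injection into all edge sets.\<close>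

lemma card_even_edge_sets:
  assumes W: "finite W" "p \<in> W" and A: "\<And>s t. A s t \<Longrightarrow> s \<in> W \<and> t \<in> W \<and> s \<noteq> t"
    and conn: "\<And>x. x \<in> W \<Longrightarrow> A\<^sup>*\<^sup>* x p"
  shows "2 ^ (card W - 1) * card {B. B \<subseteq> uedges A \<and> (\<forall>x\<in>W. \<not> odd_at B x)} \<le> 2 ^ card (uedges A)"
proof -
  have "uedges A \<subseteq> Pow W" unfolding uedges_def using A by blast
  then have fE: "finite (uedges A)" using W(1) by (meson finite_Pow_iff finite_subset)
  \<comment> \<open>Paths are added up modulo 2, so repeated edges cancel and only the parities at
    the two ends matter.\<close>
  have path: "\<exists>B. B \<subseteq> uedges A \<and> (\<forall>x. odd_at B x \<longleftrightarrow> (x = v) \<noteq> (x = p))" if "A\<^sup>*\<^sup>* v p" for v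
    using that
  proof (induction rule: converse_rtranclp_induct)
    case base
    show ?case by (intro exI[of _ "{}"]) (simp add: odd_at_def)
  next
    case (step y z)
    then obtain B where B: "B \<subseteq> uedges A" "\<And>x. odd_at B x \<longleftrightarrow> (x = z) \<noteq> (x = p)" by blast
    have yz: "{y, z} \<in> uedges A" "y \<noteq> z" using step(1) A unfolding uedges_def by blast+
    show ?case
    proof (intro exI[of _ "sym_diff {{y, z}} B"] conjI allI)
      show "sym_diff {{y, z}} B \<subseteq> uedges A" using B yz by auto
      fix x
      have "finite B" by (rule finite_subset[OF B(1) fE])
      then show "odd_at (sym_diff {{y, z}} B) x \<longleftrightarrow> (x = y) \<noteq> (x = p)"
        using odd_at_sym_diff[of "{{y, z}}" B x] odd_at_edge[OF yz(2), of x] B(2)[of x] yz(2) by auto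
    qed
  qed
  have "\<exists>B. B \<subseteq> uedges A \<and> (\<forall>x. x \<noteq> p \<longrightarrow> (odd_at B x \<longleftrightarrow> x \<in> Y))"
    if "Y \<subseteq> W - {p}" for Y
  proof -
    have "finite Y" using that W(1) finite_subset by blast
    then show ?thesis using that
    proof (induction Y)
      case empty
      show ?case by (intro exI[of _ "{}"]) (simp add: odd_at_def)
    next
      case (insert v Y)
      then obtain B where B: "B \<subseteq> uedges A" "\<And>x. x \<noteq> p \<Longrightarrow> odd_at B x \<longleftrightarrow> x \<in> Y" by blast
      have "v \<in> W" using insert by blast
      then obtain B' where B': "B' \<subseteq> uedges A" "\<And>x. odd_at B' x \<longleftrightarrow> (x = v) \<noteq> (x = p)"
        using path[OF conn[OF \<open>v \<in> W\<close>]] by blast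
      have fB: "finite B" "finite B'" by (rule finite_subset[OF B(1) fE], rule finite_subset[OF B'(1) fE])
      show ?case
      proof (intro exI[of _ "sym_diff B B'"] conjI allI impI)
        show "sym_diff B B' \<subseteq> uedges A" using B B' by auto
        fix x assume "x \<noteq> p"
        then show "odd_at (sym_diff B B') x \<longleftrightarrow> x \<in> insert v Y"
          using odd_at_sym_diff[OF fB, of x] B(2)[of x] B'(2)[of x] insert(2) by auto
      qed
    qed
  qed
  then obtain G where G: "\<And>Y. Y \<subseteq> W - {p} \<Longrightarrow> G Y \<subseteq> uedges A"
      "\<And>Y x. Y \<subseteq> W - {p} \<Longrightarrow> x \<noteq> p \<Longrightarrow> odd_at (G Y) x \<longleftrightarrow> x \<in> Y" by metis
  let ?E = "{B. B \<subseteq> uedges A \<and> (\<forall>x\<in>W. \<not> odd_at B x)}"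
  let ?f = "\<lambda>(Y, B). sym_diff (G Y) B"
  \<comment> \<open>The parities off \<open>p\<close> recover \<open>Y\<close>, hence
    \<open>G Y\<close>, and cancelling this recovers \<open>B\<close>.\<close>
  have inj: "inj_on ?f (Pow (W - {p}) \<times> ?E)"
  proof (rule inj_onI, clarify)
    fix Y B Y' B'
    assume h: "Y \<subseteq> W - {p}" "B \<subseteq> uedges A" "\<forall>x\<in>W. \<not> odd_at B x"
      "Y' \<subseteq> W - {p}" "B' \<subseteq> uedges A" "\<forall>x\<in>W. \<not> odd_at B' x" "sym_diff (G Y) B = sym_diff (G Y') B'"
    have fin: "finite (G Y)" "finite (G Y')" "finite B" "finite B'"
      by (rule finite_subset[OF _ fE], use G(1)[OF h(1)] G(1)[OF h(4)] h(2,5) in blast)+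
    have "x \<in> Y \<longleftrightarrow> x \<in> Y'" if "x \<in> W - {p}" for x
    proof -
      have "odd_at (sym_diff (G Y) B) x \<longleftrightarrow> x \<in> Y"
        using odd_at_sym_diff[OF fin(1,3)] G(2)[OF h(1), of x] h(3) that by blast
      moreover have "odd_at (sym_diff (G Y') B') x \<longleftrightarrow> x \<in> Y'"
        using odd_at_sym_diff[OF fin(2,4)] G(2)[OF h(4), of x] h(6) that by blast
      ultimately show ?thesis using h(7) by simp
    qed
    then have Y: "Y = Y'" using h(1,4) by blast
    have "B = B'" using h(7) Y sym_diff_cancel by metis
    with Y show "Y = Y' \<and> B = B'" by simp
  qed
  have sub: "?f ` (Pow (W - {p}) \<times> ?E) \<subseteq> Pow (uedges A)"
  proof (rule image_subsetI)
    fix x assume "x \<in> Pow (W - {p}) \<times> ?E"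
    then obtain Y B where x: "x = (Y, B)" "Y \<subseteq> W - {p}" "B \<subseteq> uedges A" by blast
    then show "?f x \<in> Pow (uedges A)" using G(1)[OF x(2)] by auto
  qed
  have "card (Pow (W - {p}) \<times> ?E) \<le> card (Pow (uedges A))"
    by (rule card_inj_on_le[OF inj sub]) (simp add: fE)
  then show ?thesis using W fE by (simp add: card_cartesian_product card_Pow)
qed

lemma card_darts:
  assumes "finite (darts A)" and A: "\<And>s t. A s t \<Longrightarrow> s \<noteq> t \<and> A t s"
  shows "card (darts A) = 2 * card (uedges A)"
proof -
  let ?g = "\<lambda>e. {(s, t) | s t. A s t \<and> {s, t} = e}"
  have c2: "card (?g e) = 2" if "e \<in> uedges A" for e
  proof -
    from that have "\<exists>u v. e = {u, v} \<and> A u v" unfolding uedges_def by simp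
    then obtain u v where e: "e = {u, v}" "A u v" by (elim exE conjE)
    have "?g e = {(u, v), (v, u)}" using e A by (auto simp: doubleton_eq_iff)
    then show ?thesis using A[OF e(2)] by simp
  qed
  have D: "darts A = \<Union>(?g ` uedges A)" unfolding darts_def uedges_def by auto
  have fE: "finite (uedges A)"
  proof -
    have "uedges A = (\<lambda>(s, t). {s, t}) ` darts A" unfolding darts_def uedges_def by auto
    then show ?thesis using assms(1) by simp
  qed
  have "card (\<Union>(?g ` uedges A)) = (\<Sum>e\<in>uedges A. card (?g e))"
  proof (rule card_UN_disjoint[OF fE])
    show "\<forall>e\<in>uedges A. finite (?g e)" using c2 by (metis (no_types, lifting) card.infinite zero_neq_numeral)
    show "\<forall>e\<in>uedges A. \<forall>e'\<in>uedges A. e \<noteq> e' \<longrightarrow> ?g e \<inter> ?g e' = {}" by auto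
  qed
  also have "\<dots> = 2 * card (uedges A)" using c2 by simp
  finally show ?thesis using D by simp
qed

section \<open>Classification of the faces and the Euler count\<close>

context frame
begin

context
  fixes P :: "'a tagged_emb"
  assumes g: "good P"
begin

definition isface :: "('a \<times> 'a) set \<Rightarrow> bool" where
  "isface f \<longleftrightarrow> f \<in> faces (cadj P) (crot P)"

lemma isfaceE: "isface f \<Longrightarrow> d \<in> f \<Longrightarrow> d \<in> darts (cadj P) \<and> face (crot P) d = f"
proof -
  assume h: "isface f" "d \<in> f"
  then obtain e where e: "e \<in> darts (cadj P)" "f = face (crot P) e"
    unfolding isface_def faces_def by blast
  then show ?thesis using face_darts[OF g e(1)] face_eqI[OF g, of d e] h(2) by auto
qed

lemma isface_eq: "isface f \<Longrightarrow> isface f' \<Longrightarrow> d \<in> f \<Longrightarrow> d \<in> f' \<Longrightarrow> f = f'"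
  using isfaceE[of f d] isfaceE[of f' d] by metis

lemma tri_isface: "tri P x y z \<Longrightarrow> isface (tdarts x y z)"
  unfolding isface_def faces_def using tri_face[of P x y z]
  by (auto simp: darts_def tri_def intro!: image_eqI[of _ _ "(x, y)"])

lemma quad_isface: "quad P x y z w \<Longrightarrow> isface (qdarts x y z w)"
  unfolding isface_def faces_def using quad_face[of P x y z w]
  by (auto simp: darts_def quad_def intro!: image_eqI[of _ _ "(x, y)"])

lemma odarts_isface: "isface odarts"
proof -
  have "(a, b) \<in> darts (cadj P)" using odarts_adj[OF g] unfolding odarts_def by simp
  then show ?thesis unfolding isface_def faces_def outer_face[OF g, symmetric] by (rule imageI)
qed

lemma faces_fin: "finite (faces (cadj P) (crot P))"
  unfolding faces_def using darts_fin[OF g] by simp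

lemma face_kind: "isface f \<Longrightarrow> f = odarts \<or>
    (\<exists>x y z. tri P x y z \<and> f = tdarts x y z \<and> f \<inter> odarts = {}) \<or> (\<exists>x y z w. quad P x y z w \<and> f = qdarts x y z w)"
proof -
  assume f: "isface f"
  then obtain x y where xy: "cadj P x y" "f = face (crot P) (x, y)"
    unfolding isface_def faces_def darts_def by auto
  show ?thesis
  proof (cases "f = odarts")
    case False
    then have "f \<inter> odarts = {}" using isface_eq[OF f odarts_isface] by blast
    moreover have "(x, y) \<in> f" using xy face_self by simp
    ultimately have n: "(x, y) \<notin> odarts" by blast
    show ?thesis
      using card_face_int[OF g xy(1) n]
    proof
      assume "card (face (crot P) (x, y)) = 3"
      note t = card3_tri[OF g xy(1) this]
      from t tri_face[OF t] xy(2) \<open>f \<inter> odarts = {}\<close> show ?thesis by blast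
    next
      assume "card (face (crot P) (x, y)) = 4"
      note t = card4_quad[OF g xy(1) this]
      from t quad_face[OF t] xy(2) show ?thesis by blast
    qed
  qed simp
qed

lemma card_tdarts: "tri P x y z \<Longrightarrow> card (tdarts x y z) = 3"
  using tri_distinct[OF g, of x y z] unfolding tdarts_def by auto

lemma card_qdarts: "quad P x y z w \<Longrightarrow> card (qdarts x y z w) = 4"
  using quad_distinct[OF g, of x y z w] unfolding qdarts_def by auto

lemma card_odarts: "card odarts = 3"
  using ab bc ca unfolding odarts_def by auto

lemma darts_Union: "darts (cadj P) = \<Union>(faces (cadj P) (crot P))"
proof
  show "darts (cadj P) \<subseteq> \<Union>(faces (cadj P) (crot P))" unfolding faces_def using face_self by blast
  show "\<Union>(faces (cadj P) (crot P)) \<subseteq> darts (cadj P)" unfolding faces_def using face_darts[OF g] by blast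
qed

lemma card_Union_faces: "S \<subseteq> faces (cadj P) (crot P) \<Longrightarrow> card (\<Union>S) = (\<Sum>f\<in>S. card f)"
proof (rule card_Union_disjoint)
  assume S: "S \<subseteq> faces (cadj P) (crot P)"
  show "pairwise disjnt S"
    unfolding pairwise_def disjnt_def using isface_eq S unfolding isface_def by blast
  fix f assume "f \<in> S"
  then have "f \<subseteq> darts (cadj P)" using S isfaceE unfolding isface_def by blast
  then show "finite f" using darts_fin[OF g] finite_subset by blast
qed

text \<open>The face that holds the reflex angle at \<open>v\<close>; the choice is unique because
  the embedding is pointed.\<close>

definition rface :: "'a \<Rightarrow> ('a \<times> 'a) set" where
  "rface v = face (crot P) ((SOME w. cadj P v w \<and> creflex P v w), v)"

lemma rface_rquad: "rquad P x y z w t \<Longrightarrow> rface t = qdarts x y z w"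
proof -
  assume q: "rquad P x y z w t"
  obtain s where s: "(s, t) \<in> qdarts x y z w" "cadj P t s" "creflex P t s"
    using rquad_corner[OF g q] by blast
  have "(SOME w. cadj P t w \<and> creflex P t w) = s"
    using s reflex_unique[OF g] by (intro some_equality) blast+
  then show ?thesis unfolding rface_def
    using isfaceE[OF quad_isface s(1)] q unfolding rquad_def by blast
qed

lemma rface_ex: "v \<in> V \<Longrightarrow> v \<notin> {a, b, c} \<Longrightarrow>
    \<exists>x y z w. rquad P x y z w v \<and> rface v = qdarts x y z w \<and> (\<exists>s. (s, v) \<in> qdarts x y z w)"
proof -
  assume v: "v \<in> V" "v \<notin> {a, b, c}"
  obtain s where s: "cadj P v s" "creflex P v s" using pointed[OF g v(1)] by blast
  have sv: "(s, v) \<in> darts (cadj P)" using adj_sym[OF g s(1)] unfolding darts_def by blast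
  let ?f = "face (crot P) (s, v)"
  have f: "isface ?f" using sv unfolding isface_def faces_def by blast
  have sf: "(s, v) \<in> ?f" by (rule face_self)
  from face_kind[OF f] show ?thesis
  proof (elim disjE exE conjE)
    assume "?f = odarts"
    then show ?thesis using sf v unfolding odarts_def by auto
  next
    fix x y z assume t: "tri P x y z" "?f = tdarts x y z" "?f \<inter> odarts = {}"
    then have "(x, y) \<notin> odarts" unfolding tdarts_def by blast
    from tri_convex[OF g t(1) this] show ?thesis using sf s t(2) unfolding tdarts_def by auto
  next
    fix x y z w assume q: "quad P x y z w" "?f = qdarts x y z w"
    obtain t where t: "rquad P x y z w t" using quad_reflex[OF g q(1)] by blast
    have "t = v" using sf s t q(2) unfolding rquad_def qdarts_def by auto
    then show ?thesis using t rface_rquad[OF t] sf q(2) by metis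
  qed
qed

lemma euler: "card V + card (faces (cadj P) (crot P)) = card (uedges (cadj P)) + 2"
  using emb[OF g] unfolding comb_embedding_def planar_rotation_def by blast

lemma abcV: "{a, b, c} \<subseteq> V"
  using adj_V[OF g] tri_adj[OF g tri_outer[OF g]] by blast

text \<open>\<open>rface\<close> is a bijection from the vertices other than \<open>a\<close>,
  \<open>b\<close>, \<open>c\<close> to the interior quadrilaterals, so
  \<open>card Q = card V - 3\<close>. Twice the number of edges is the number of darts,
  \<open>3 + 4 * card Q + 3 * card Ts\<close>; inserted into Euler's formula, this leaves only
  \<open>card Ts = 1\<close>.\<close>

lemma tri_unique:
  assumes "tri P x y z" "(x, y) \<notin> odarts" "tri P x' y' z'" "(x', y') \<notin> odarts"
  shows "tdarts x y z = tdarts x' y' z'"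
proof -
  let ?F = "faces (cadj P) (crot P)"
  define I where "I = ?F - {odarts}"
  define Q where "Q = {f \<in> I. card f = 4}"
  define Ts where "Ts = {f \<in> I. card f = 3}"
  have fI: "finite I" using faces_fin unfolding I_def by simp
  have fQ: "finite Q" "finite Ts" using fI unfolding Q_def Ts_def by auto
  have IQT: "I = Q \<union> Ts"
  proof -
    have "card f = 4 \<or> card f = 3" if "f \<in> I" for f
    proof -
      have "isface f" "f \<noteq> odarts" using that unfolding I_def isface_def by auto
      then show ?thesis using face_kind[of f] card_tdarts card_qdarts by auto
    qed
    then show ?thesis unfolding Q_def Ts_def by blast
  qed
  have QT: "Q \<inter> Ts = {}" unfolding Q_def Ts_def by auto
  have cI: "card I = card Q + card Ts" unfolding IQT using fQ QT by (rule card_Un_disjoint)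
  have o: "odarts \<in> ?F" using odarts_isface unfolding isface_def .
  have cF: "card ?F = card I + 1" unfolding I_def using card_Suc_Diff1[OF faces_fin o] by (simp only: Suc_eq_plus1)
  have qd: "\<exists>x y z w. quad P x y z w \<and> f = qdarts x y z w" if "f \<in> Q" for f
  proof -
    have "isface f" "card f = 4" using that unfolding Q_def I_def isface_def by auto
    then show ?thesis using face_kind[of f] card_tdarts card_odarts by auto
  qed
  have "bij_betw rface (V - {a, b, c}) Q"
    unfolding bij_betw_def
  proof (intro conjI inj_onI equalityI subsetI)
    fix v v' assume v: "v \<in> V - {a, b, c}" "v' \<in> V - {a, b, c}" "rface v = rface v'"
    obtain x y z w where q: "rquad P x y z w v" "rface v = qdarts x y z w"
      using rface_ex[of v] v(1) by blast
    obtain x' y' z' w' where q': "rquad P x' y' z' w' v'" "rface v' = qdarts x' y' z' w'"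
      using rface_ex[of v'] v(2) by blast
    obtain s where s: "(s, v') \<in> qdarts x' y' z' w'" "creflex P v' s" using rquad_corner[OF g q'(1)] by blast
    then have "(s, v') \<in> qdarts x y z w" using q(2) q'(2) v(3) by simp
    then show "v = v'" using s(2) q(1) unfolding rquad_def qdarts_def by auto
  next
    fix f assume "f \<in> rface ` (V - {a, b, c})"
    then obtain v where v: "v \<in> V - {a, b, c}" "f = rface v" by blast
    then obtain x y z w where q: "rquad P x y z w v" "f = qdarts x y z w"
      using rface_ex[of v] by blast
    have qq: "quad P x y z w" using q(1) unfolding rquad_def by blast
    have "f \<noteq> odarts" using card_qdarts[OF qq] card_odarts q(2) by auto
    then show "f \<in> Q" using quad_isface[OF qq] card_qdarts[OF qq] q(2) unfolding Q_def I_def isface_def by blast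
  next
    fix f assume "f \<in> Q"
    then obtain x y z w where q: "quad P x y z w" "f = qdarts x y z w" using qd by blast
    obtain t where t: "rquad P x y z w t" using quad_reflex[OF g q(1)] by blast
    have "t \<in> V" using t adj_V[OF g] quad_adj[OF g q(1)] unfolding rquad_def by blast
    then show "f \<in> rface ` (V - {a, b, c})"
      using rquad_outer[OF g t] rface_rquad[OF t] q(2) by blast
  qed
  then have cQ: "card Q = card V - 3"
    using bij_betw_same_card[of rface "V - {a, b, c}" Q] card_Diff_subset[OF _ abcV] ab bc ca by auto
  have cV: "card V \<ge> 3"
    using card_mono[OF finV[OF g] abcV] ab bc ca by auto
  have cD: "card (darts (cadj P)) = 2 * card (uedges (cadj P))"
    by (rule card_darts[OF darts_fin[OF g]]) (use adj_ne[OF g] adj_sym[OF g] in blast)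
  have "card (darts (cadj P)) = (\<Sum>f\<in>?F. card f)" unfolding darts_Union by (rule card_Union_faces) simp
  also have "\<dots> = card odarts + (\<Sum>f\<in>I. card f)"
    unfolding I_def using o faces_fin by (rule sum.remove[rotated])
  also have "(\<Sum>f\<in>I. card f) = (\<Sum>f\<in>Q. card f) + (\<Sum>f\<in>Ts. card f)"
    unfolding IQT using fQ QT by (rule sum.union_disjoint)
  also have "(\<Sum>f\<in>Q. card f) = 4 * card Q" unfolding Q_def by simp
  also have "(\<Sum>f\<in>Ts. card f) = 3 * card Ts" unfolding Ts_def by simp
  finally have "2 * card (uedges (cadj P)) = 3 + (4 * card Q + 3 * card Ts)" using cD card_odarts by simp
  then have "card Ts = 1" using euler cF cI cQ cV by linarith
  then obtain f0 where f0: "Ts = {f0}" by (meson card_1_singletonE)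
  have "tdarts x y z \<in> Ts" if "tri P x y z" "(x, y) \<notin> odarts" for x y z
  proof -
    have "tdarts x y z \<noteq> odarts" using that(2) unfolding tdarts_def by auto
    then show ?thesis using tri_isface[OF that(1)] card_tdarts[OF that(1)]
      unfolding Ts_def I_def isface_def by blast
  qed
  then show ?thesis using assms f0 by auto
qed

section \<open>The boundary of a set of faces over GF(2)\<close>

definition bdry :: "('a \<times> 'a) set set \<Rightarrow> 'a set set" where
  "bdry S = {{s, t} | s t. cadj P s t \<and> (face (crot P) (s, t) \<in> S) \<noteq> (face (crot P) (t, s) \<in> S)}"

lemma bdry_iff: "cadj P s t \<Longrightarrow> {s, t} \<in> bdry S \<longleftrightarrow> (face (crot P) (s, t) \<in> S) \<noteq> (face (crot P) (t, s) \<in> S)"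
  unfolding bdry_def by (auto simp: doubleton_eq_iff)

lemma bdry_sub: "bdry S \<subseteq> uedges (cadj P)"
  unfolding bdry_def uedges_def by blast

lemma face_fnext: "cadj P s t \<Longrightarrow> face (crot P) (t, crot P t s) = face (crot P) (s, t)"
  using face_eqI[OF g, of "(t, crot P t s)" "(s, t)"] fnext_in_face[OF face_self, of "crot P" "(s, t)"]
  by (simp add: fnext_def darts_def)

text \<open>The rotation at \<open>v\<close> maps the darts that enter \<open>v\<close> on faces of
  \<open>S\<close> bijectively to those that leave \<open>v\<close> on faces of \<open>S\<close>.
  The boundary edges at \<open>v\<close> are the symmetric difference of these two equally large
  sets.\<close>

lemma bdry_even: "v \<in> V \<Longrightarrow> \<not> odd_at (bdry S) v"
proof -
  assume v: "v \<in> V"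
  let ?N = "{w. cadj P v w}"
  define X where "X = {w \<in> ?N. face (crot P) (w, v) \<in> S}"
  define X' where "X' = {w \<in> ?N. face (crot P) (v, w) \<in> S}"
  have fin: "finite X" "finite X'" using nbrs_fin[OF g] unfolding X_def X'_def by auto
  have "X' = crot P v ` X"
  proof (intro equalityI subsetI)
    fix w assume w: "w \<in> X'"
    then obtain s where s: "cadj P v s" "crot P v s = w" using rot_pre[OF g] unfolding X'_def by blast
    have "face (crot P) (s, v) \<in> S"
      using w s(2) face_fnext[OF adj_sym[OF g s(1)]] unfolding X'_def by simp
    then have "s \<in> X" using s(1) unfolding X_def by simp
    then show "w \<in> crot P v ` X" using s(2) by blast
  next
    fix w assume "w \<in> crot P v ` X"
    then obtain s where s: "s \<in> X" "w = crot P v s" by blast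
    then show "w \<in> X'"
      using face_fnext[of s v] adj_sym[OF g, of v s] rot_adj[OF g, of v s] unfolding X_def X'_def by auto
  qed
  moreover have "inj_on (crot P v) X" unfolding inj_on_def X_def using rot_inj[OF g] by blast
  ultimately have cX: "card X' = card X" by (simp add: card_image)
  have "{w. {v, w} \<in> bdry S} = sym_diff X X'"
  proof -
    have "{v, w} \<in> bdry S \<longleftrightarrow> w \<in> sym_diff X X'" for w
    proof (cases "cadj P v w")
      case True
      then show ?thesis unfolding bdry_iff[OF True] X_def X'_def by auto
    next
      case False
      then have "{v, w} \<notin> bdry S" unfolding bdry_def using adj_sym[OF g] by (auto simp: doubleton_eq_iff)
      then show ?thesis using False unfolding X_def X'_def by auto
    qed
    then show ?thesis by auto
  qed
  then show ?thesis unfolding odd_at_def using even_card_sym_diff[OF fin] cX by simp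
qed

text \<open>The darts on whose faces \<open>S\<close> and \<open>S'\<close> disagree are closed
  under the face walk and under reversal, so a single one would spread the disagreement to the outer
  face, which belongs to neither set.\<close>

lemma bdry_inj:
  assumes "S \<subseteq> faces (cadj P) (crot P) - {odarts}" "S' \<subseteq> faces (cadj P) (crot P) - {odarts}"
    and e: "bdry S = bdry S'"
  shows "S = S'"
proof -
  let ?r = "crot P"
  define X where "X = {d \<in> darts (cadj P). (face ?r d \<in> S) \<noteq> (face ?r d \<in> S')}"
  have "X = {}"
  proof (rule ccontr)
    assume "X \<noteq> {}"
    then obtain d where d: "d \<in> X" by blast
    have "(a, b) \<in> X"
    proof (rule cover[OF g _ d])
      show "X \<subseteq> darts (cadj P)" unfolding X_def by blast
      show "cadj P a b" using tri_outer[OF g] unfolding tri_def by blast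
      show "fnext ?r d' \<in> X" if "d' \<in> X" for d'
      proof -
        obtain s t where st: "d' = (s, t)" by (cases d')
        have A: "cadj P s t" using that st unfolding X_def darts_def by blast
        then have "fnext ?r d' \<in> darts (cadj P)"
          using rot_adj[OF g adj_sym[OF g A]] st by (simp add: fnext_def darts_def)
        then show ?thesis using that face_fnext[OF A] unfolding X_def st by (simp add: fnext_def)
      qed
      show "(v, u) \<in> X" if "(u, v) \<in> X" for u v
      proof -
        have A: "cadj P u v" using that unfolding X_def darts_def by blast
        have "{u, v} \<in> bdry S \<longleftrightarrow> {u, v} \<in> bdry S'" using e by simp
        then show ?thesis using that adj_sym[OF g A] unfolding bdry_iff[OF A] X_def darts_def by blast
      qed
    qed
    then show False using assms outer_face[OF g] unfolding X_def by auto
  qed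
  have "f \<in> S \<longleftrightarrow> f \<in> S'" if "f \<in> faces (cadj P) ?r" for f
    using that \<open>X = {}\<close> unfolding X_def faces_def by blast
  then show ?thesis using assms by blast
qed

text \<open>By Euler's formula there are no more even edge sets than sets of faces not containing the outer one.\<close>

lemma jordan:
  assumes B: "B \<subseteq> uedges (cadj P)" "\<And>v. v \<in> V \<Longrightarrow> \<not> odd_at B v"
  shows "\<exists>S. S \<subseteq> faces (cadj P) (crot P) - {odarts} \<and> bdry S = B"
proof -
  let ?F = "faces (cadj P) (crot P) - {odarts}"
  let ?E = "{B. B \<subseteq> uedges (cadj P) \<and> (\<forall>x\<in>V. \<not> odd_at B x)}"
  have aV: "a \<in> V" using abcV by blast
  have "2 ^ (card V - 1) * card ?E \<le> 2 ^ card (uedges (cadj P))"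
  proof (rule card_even_edge_sets[OF finV[OF g] aV])
    show "s \<in> V \<and> t \<in> V \<and> s \<noteq> t" if "cadj P s t" for s t
      using adj_V[OF g that] adj_ne[OF g that] by simp
    show "(cadj P)\<^sup>*\<^sup>* x a" if "x \<in> V" for x
      using that aV emb[OF g] unfolding comb_embedding_def connected_graph_def by blast
  qed
  moreover have o: "odarts \<in> faces (cadj P) (crot P)" using odarts_isface unfolding isface_def .
  have cF: "card (faces (cadj P) (crot P)) = card ?F + 1" using card_Suc_Diff1[OF faces_fin o] by (simp only: Suc_eq_plus1)
  have V1: "card V \<ge> 1" using aV finV[OF g] by (metis One_nat_def Suc_leI card_gt_0_iff empty_iff)
  \<comment> \<open>The number of edges is the size of a spanning tree plus the number of interior
    faces, which makes the upper bound on even sets meet the lower bound from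
    \<open>bdry_inj\<close>.\<close>
  have "card (uedges (cadj P)) = (card V - 1) + card ?F" using euler cF V1 by linarith
  ultimately have "2 ^ (card V - 1) * card ?E \<le> 2 ^ (card V - 1) * 2 ^ card ?F"
    by (simp add: power_add)
  then have le: "card ?E \<le> 2 ^ card ?F" by simp
  have inj: "inj_on bdry (Pow ?F)" unfolding inj_on_def using bdry_inj by blast
  have sub: "bdry ` Pow ?F \<subseteq> ?E" using bdry_sub bdry_even by blast
  have "uedges (cadj P) \<subseteq> Pow V" unfolding uedges_def using adj_V[OF g] by blast
  then have "finite (uedges (cadj P))" using finV[OF g] by (meson finite_Pow_iff finite_subset)
  then have fE: "finite ?E" by simp
  have "card (bdry ` Pow ?F) = 2 ^ card ?F" using card_image[OF inj] faces_fin by (simp add: card_Pow)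
  then have "bdry ` Pow ?F = ?E" using le sub fE card_mono[OF fE sub] by (intro card_subset_eq) auto
  moreover have "B \<in> ?E" using B by blast
  ultimately have "B \<in> bdry ` Pow ?F" by simp
  then show ?thesis by blast
qed

end

context
  fixes P :: "'a tagged_emb"
  assumes g: "good P"
begin

section \<open>Three-cycles separate the interior triangle from the outer face\<close>

text \<open>The combinatorial stand-in for the interior of a closed curve: being a union of faces,
  it can be left only across the three edges of the cycle. Excluding the outer darts fixes which of
  the two sides is meant.\<close>

definition inside3 :: "'a \<Rightarrow> 'a \<Rightarrow> 'a \<Rightarrow> ('a \<times> 'a) set \<Rightarrow> bool" where
  "inside3 p q r I \<longleftrightarrow> I \<subseteq> darts (cadj P) \<and>
    (\<forall>s t. cadj P s t \<longrightarrow> ((t, crot P t s) \<in> I \<longleftrightarrow> (s, t) \<in> I)) \<and>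
    (\<forall>s t. cadj P s t \<longrightarrow> {s, t} \<notin> {{p, q}, {q, r}, {r, p}} \<longrightarrow> ((s, t) \<in> I \<longleftrightarrow> (t, s) \<in> I)) \<and>
    (\<forall>s t. cadj P s t \<longrightarrow> {s, t} \<in> {{p, q}, {q, r}, {r, p}} \<longrightarrow> ((s, t) \<in> I \<longleftrightarrow> (t, s) \<notin> I)) \<and>
    odarts \<inter> I = {}"

lemma inside3D:
  assumes "inside3 p q r I"
  shows "\<And>s t. (s, t) \<in> I \<Longrightarrow> cadj P s t"
    and "\<And>s t. cadj P s t \<Longrightarrow> (t, crot P t s) \<in> I \<longleftrightarrow> (s, t) \<in> I"
    and "\<And>s t. cadj P s t \<Longrightarrow> {s, t} \<notin> {{p, q}, {q, r}, {r, p}} \<Longrightarrow> (s, t) \<in> I \<longleftrightarrow> (t, s) \<in> I"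
    and "\<And>s t. cadj P s t \<Longrightarrow> {s, t} \<in> {{p, q}, {q, r}, {r, p}} \<Longrightarrow> (s, t) \<in> I \<longleftrightarrow> (t, s) \<notin> I"
    and "\<And>d. d \<in> odarts \<Longrightarrow> d \<notin> I"
proof -
  note h = assms[unfolded inside3_def]
  show "cadj P s t" if "(s, t) \<in> I" for s t using subsetD[OF h[THEN conjunct1] that] by (simp add: darts_def)
  show "(t, crot P t s) \<in> I \<longleftrightarrow> (s, t) \<in> I" if "cadj P s t" for s t
    using h[THEN conjunct2, THEN conjunct1] that by blast
  show "(s, t) \<in> I \<longleftrightarrow> (t, s) \<in> I" if "cadj P s t" "{s, t} \<notin> {{p, q}, {q, r}, {r, p}}" for s t
    using h[THEN conjunct2, THEN conjunct2, THEN conjunct1, rule_format, OF that] .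
  show "(s, t) \<in> I \<longleftrightarrow> (t, s) \<notin> I" if "cadj P s t" "{s, t} \<in> {{p, q}, {q, r}, {r, p}}" for s t
    using h[THEN conjunct2, THEN conjunct2, THEN conjunct2, THEN conjunct1, rule_format, OF that] .
  show "d \<notin> I" if "d \<in> odarts" for d
    using h[THEN conjunct2, THEN conjunct2, THEN conjunct2, THEN conjunct2] that by blast
qed

text \<open>Turning around a vertex off the cycle never crosses an edge of the cycle.\<close>

lemma inside3_vertex:
  assumes I: "inside3 p q r I" and v: "v \<notin> {p, q, r}" and s: "cadj P v s" "(s, v) \<in> I" and t: "cadj P v t"
  shows "(t, v) \<in> I"
proof -
  have "t \<in> {t. (t, v) \<in> I}"
  proof (rule rot_closed[OF g s(1) _ _ t])
    show "s \<in> {t. (t, v) \<in> I}" using s by simp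
    fix w assume w: "cadj P v w" "w \<in> {t. (t, v) \<in> I}"
    have wv: "cadj P w v" using adj_sym[OF g w(1)] .
    have 1: "(v, crot P v w) \<in> I" using inside3D(2)[OF I wv] w by simp
    have "{v, crot P v w} \<notin> {{p, q}, {q, r}, {r, p}}" using v by (auto simp: doubleton_eq_iff)
    from inside3D(3)[OF I rot_adj[OF g w(1)] this] 1
    show "crot P v w \<in> {t. (t, v) \<in> I}" by simp
  qed
  then show ?thesis by simp
qed

lemma inside3_vertex_out:
  assumes I: "inside3 p q r I" and v: "v \<notin> {p, q, r}" and s: "cadj P v s" "(v, s) \<in> I" and t: "cadj P v t"
  shows "(t, v) \<in> I" "(v, t) \<in> I"
proof -
  have *: "{v, t} \<notin> {{p, q}, {q, r}, {r, p}}" for t using v by (auto simp: doubleton_eq_iff)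
  have "(s, v) \<in> I" using inside3D(3)[OF I s(1) *] s(2) by simp
  then show "(t, v) \<in> I" by (rule inside3_vertex[OF I v s(1) _ t])
  then show "(v, t) \<in> I" using inside3D(3)[OF I t *] by simp
qed

lemma inside3_quad: "inside3 p q r I \<Longrightarrow> quad P x y z w \<Longrightarrow> (x, y) \<in> I \<longleftrightarrow> qdarts x y z w \<subseteq> I"
  using inside3D(2)[of p q r I x y] inside3D(2)[of p q r I y z] inside3D(2)[of p q r I z w] quad_adj[OF g, of x y z w]
  unfolding quad_def qdarts_def by auto

text \<open>The reflex vertices follow from a count: with \<open>m\<close> vertices strictly inside, the graph outside
  the 3-cycle is connected, so its even edge sets, which include the boundaries of all face sets that
  do not separate the faces inside, are few enough to force at most \<open>m\<close> quadrilaterals inside. All of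
  them are used up by the reflex angles of the \<open>m\<close> inner vertices.\<close>

lemma tricycle:
  assumes c3: "cadj P p q" "cadj P q r" "cadj P r p"
  shows "\<exists>I. inside3 p q r I \<and>
    (\<forall>x y z. tri P x y z \<longrightarrow> (x, y) \<notin> odarts \<longrightarrow> tdarts x y z \<subseteq> I) \<and>
    (\<forall>x y z w t. rquad P x y z w t \<longrightarrow> (x, y) \<in> I \<longrightarrow> t \<notin> {p, q, r})"
proof -
  let ?A = "cadj P" and ?r = "crot P"
  let ?F = "faces ?A ?r"
  define C where "C = {{p, q}, {q, r}, {r, p}}"
  have ne: "p \<noteq> q" "q \<noteq> r" "r \<noteq> p" using c3 adj_ne[OF g] by blast+
  have CE: "C \<subseteq> uedges ?A" using c3 unfolding C_def uedges_def by blast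
  have "\<not> odd_at C v" for v
  proof -
    have "{w. {v, w} \<in> C} = (if v = p then {q, r} else if v = q then {p, r} else if v = r then {p, q} else {})"
      using ne unfolding C_def by (auto simp: doubleton_eq_iff)
    then show ?thesis using ne unfolding odd_at_def by simp
  qed
  \<comment> \<open>A 3-cycle is an even edge set, so it bounds; leaving out the outer face makes
    \<open>S\<close> the inside.\<close>
  then obtain S where S: "S \<subseteq> ?F - {odarts}" "bdry P S = C" using jordan[OF g CE] by blast
  define I where "I = {d \<in> darts ?A. face ?r d \<in> S}"
  have Iiff: "(s, t) \<in> I \<longleftrightarrow> face ?r (s, t) \<in> S" if "?A s t" for s t
    using that unfolding I_def darts_def by blast
  have IA: "?A s t" if "(s, t) \<in> I" for s t using that unfolding I_def darts_def by blast
  have bdI: "{s, t} \<in> C \<longleftrightarrow> ((s, t) \<in> I) \<noteq> ((t, s) \<in> I)" if "?A s t" for s t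
    using bdry_iff[OF g that, of S] Iiff[OF that] Iiff[OF adj_sym[OF g that]] S(2) by simp
  have I3: "inside3 p q r I"
    unfolding inside3_def C_def[symmetric]
  proof (intro conjI allI impI)
    show "I \<subseteq> darts ?A" unfolding I_def by blast
    show "odarts \<inter> I = {}"
      using S(1) isfaceE[OF g odarts_isface[OF g]] unfolding I_def by blast
    fix s t assume st: "?A s t"
    show "(t, ?r t s) \<in> I \<longleftrightarrow> (s, t) \<in> I"
      using Iiff[OF st] Iiff[OF rot_adj[OF g adj_sym[OF g st]]] face_fnext[OF g st] by simp
    show "(s, t) \<in> I \<longleftrightarrow> (t, s) \<in> I" if "{s, t} \<notin> C" using bdI[OF st] that by blast
    show "(s, t) \<in> I \<longleftrightarrow> (t, s) \<notin> I" if "{s, t} \<in> C" using bdI[OF st] that by blast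
  qed
  have IU: "I = \<Union>S"
  proof
    show "I \<subseteq> \<Union>S" unfolding I_def using face_self by blast
    show "\<Union>S \<subseteq> I"
    proof
      fix d assume "d \<in> \<Union>S"
      then obtain f where f: "d \<in> f" "f \<in> S" by blast
      have "isface P f" using subsetD[OF S(1) f(2)] unfolding isface_def[OF g] by (rule DiffD1)
      from isfaceE[OF g this f(1)] show "d \<in> I" using f(2) unfolding I_def by simp
    qed
  qed
  have fS: "finite S" using S(1) faces_fin[OF g] finite_subset by blast
  have cI: "card I = (\<Sum>f\<in>S. card f)" unfolding IU by (rule card_Union_faces[OF g]) (use S in blast)
  have fI: "finite I" using darts_fin[OF g] unfolding I_def by simp
  define Ai where "Ai = (\<lambda>s t. (s, t) \<in> I \<and> (t, s) \<in> I)"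
  have fAi: "finite (darts Ai)" by (rule finite_subset[OF _ fI]) (auto simp: darts_def Ai_def)
  have cAi: "card (darts Ai) = 2 * card (uedges Ai)"
    by (rule card_darts[OF fAi]) (use IA adj_ne[OF g] in \<open>auto simp: Ai_def\<close>)
  \<comment> \<open>The inner darts on the cycle itself, one for each of its three edges.\<close>
  define Ic where "Ic = {d \<in> I. (snd d, fst d) \<notin> I}"
  have Iun: "I = darts Ai \<union> Ic" "darts Ai \<inter> Ic = {}" unfolding darts_def Ai_def Ic_def by auto
  have cIc: "card Ic = 3"
  proof -
    have x: "((p, q) \<in> I) \<noteq> ((q, p) \<in> I)" "((q, r) \<in> I) \<noteq> ((r, q) \<in> I)" "((r, p) \<in> I) \<noteq> ((p, r) \<in> I)"
      using bdI[OF c3(1)] bdI[OF c3(2)] bdI[OF c3(3)] unfolding C_def by auto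
    have "(s, t) \<in> Ic \<longleftrightarrow> (s, t) \<in> {if (p, q) \<in> I then (p, q) else (q, p),
        if (q, r) \<in> I then (q, r) else (r, q), if (r, p) \<in> I then (r, p) else (p, r)}" for s t
    proof
      assume st: "(s, t) \<in> Ic"
      then have "{s, t} \<in> C" using bdI[of s t] IA[of s t] unfolding Ic_def by auto
      then show "(s, t) \<in> {if (p, q) \<in> I then (p, q) else (q, p),
        if (q, r) \<in> I then (q, r) else (r, q), if (r, p) \<in> I then (r, p) else (p, r)}"
        using st x unfolding C_def Ic_def by (auto simp: doubleton_eq_iff)
    next
      assume "(s, t) \<in> {if (p, q) \<in> I then (p, q) else (q, p),
        if (q, r) \<in> I then (q, r) else (r, q), if (r, p) \<in> I then (r, p) else (p, r)}"
      then show "(s, t) \<in> Ic" using x unfolding Ic_def by (auto split: if_splits)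
    qed
    then have "Ic = {if (p, q) \<in> I then (p, q) else (q, p),
        if (q, r) \<in> I then (q, r) else (r, q), if (r, p) \<in> I then (r, p) else (p, r)}" by auto
    then show ?thesis using ne by simp
  qed
  have fIc: "finite Ic" using fI unfolding Ic_def by simp
  have cI2: "card I = 2 * card (uedges Ai) + 3"
    using card_Un_disjoint[OF fAi fIc Iun(2)] Iun(1) cAi cIc by simp
  have kind: "card f = 4 \<or> (\<exists>x y z. tri P x y z \<and> (x, y) \<notin> odarts \<and> f = tdarts x y z)" if "f \<in> S" for f
  proof -
    have "isface P f" "f \<noteq> odarts" using subsetD[OF S(1) that] unfolding isface_def[OF g] by simp_all
    from face_kind[OF g this(1)] show ?thesis
    proof (elim disjE exE conjE)
      assume "f = odarts"
      with \<open>f \<noteq> odarts\<close> show ?thesis by simp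
    next
      fix x y z assume t: "tri P x y z" "f = tdarts x y z" "f \<inter> odarts = {}"
      then have "(x, y) \<notin> odarts" by (auto simp: tdarts_def)
      with t show ?thesis by blast
    next
      fix x y z w assume "quad P x y z w" "f = qdarts x y z w"
      then show ?thesis using card_qdarts[OF g] by simp
    qed
  qed
  \<comment> \<open>Parity: a multiple of 4 cannot be \<open>2 * card (uedges Ai) + 3\<close>. So
    some face inside is not a quadrilateral, and it must be the unique interior triangle.\<close>
  have "\<exists>f\<in>S. card f \<noteq> 4"
  proof (rule ccontr)
    assume "\<not> (\<exists>f\<in>S. card f \<noteq> 4)"
    then have "card I = 4 * card S" using cI by simp
    then show False using cI2 by presburger
  qed
  then obtain f0 where f0: "f0 \<in> S" "card f0 \<noteq> 4" by blast
  obtain x0 y0 z0 where T0': "tri P x0 y0 z0" "(x0, y0) \<notin> odarts" "f0 = tdarts x0 y0 z0"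
    using kind[OF f0(1)] f0(2) by (elim disjE exE conjE) simp_all
  have T0: "tri P x0 y0 z0" "(x0, y0) \<notin> odarts" "tdarts x0 y0 z0 \<in> S"
    using T0' f0(1) by simp_all
  have T: "tdarts x y z \<in> S" if "tri P x y z" "(x, y) \<notin> odarts" for x y z
    using tri_unique[OF g that T0(1,2)] T0(3) by simp
  have TI: "tdarts x y z \<subseteq> I" if "tri P x y z" "(x, y) \<notin> odarts" for x y z
    using T[OF that] unfolding IU by blast
  let ?T = "tdarts x0 y0 z0"
  have c4: "card f = 4" if "f \<in> S - {?T}" for f
  proof -
    have fS: "f \<in> S" and fT: "f \<noteq> ?T" using that by auto
    from kind[OF fS] show ?thesis
    proof (elim disjE exE conjE)
      fix x y z assume "tri P x y z" "(x, y) \<notin> odarts" "f = tdarts x y z"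
      then show ?thesis using tri_unique[OF g _ _ T0(1,2), of x y z] fT by simp
    qed
  qed
  have cS: "card I = 4 * (card S - 1) + 3"
  proof -
    have "(\<Sum>f\<in>S. card f) = card ?T + (\<Sum>f\<in>S - {?T}. card f)" using fS T0(3) by (rule sum.remove)
    also have "(\<Sum>f\<in>S - {?T}. card f) = 4 * card (S - {?T})" using c4 by simp
    also have "card (S - {?T}) = card S - 1" using T0(3) by simp
    finally show ?thesis using cI card_tdarts[OF g T0(1)] by simp
  qed
  have S1: "card S \<ge> 1" using fS T0(3) by (metis One_nat_def Suc_leI card_gt_0_iff empty_iff)
  define IV where "IV = {v \<in> V. v \<notin> {p, q, r} \<and> (\<exists>s. (s, v) \<in> I)}"
  have IVall: "(s, v) \<in> I \<and> (v, s) \<in> I" if v: "v \<in> IV" and s: "?A v s" for v s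
  proof -
    obtain s0 where s0: "(s0, v) \<in> I" "v \<notin> {p, q, r}" using v unfolding IV_def by blast
    have "(s, v) \<in> I" by (rule inside3_vertex[OF I3 s0(2) adj_sym[OF g IA[OF s0(1)]] s0(1) s])
    then show ?thesis using inside3_vertex_out[OF I3 s0(2) s] inside3D(3)[OF I3 s] s0(2)
      by (auto simp: doubleton_eq_iff)
  qed
  have IVV: "IV \<subseteq> V" unfolding IV_def by blast
  have pV: "p \<in> V" "q \<in> V" "r \<in> V" using adj_V[OF g] c3 by blast+
  define W where "W = V - IV"
  have pW: "p \<in> W" using pV unfolding W_def IV_def by blast
  have fW: "finite W" using finV[OF g] unfolding W_def by simp
  \<comment> \<open>The graph with the strict inside erased: edges with at most one side in
    \<open>I\<close>, on the vertex set \<open>W\<close>.\<close>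
  define Ao where "Ao = (\<lambda>s t. ?A s t \<and> \<not> Ai s t)"
  have AoW: "s \<in> W \<and> t \<in> W \<and> s \<noteq> t" if "Ao s t" for s t
    using that IVall[of s t] IVall[of t s] adj_sym[OF g] adj_V[OF g, of s t] adj_ne[OF g, of s t]
    unfolding Ao_def Ai_def W_def by blast
  \<comment> \<open>A path to \<open>p\<close> from outside stays among the remaining edges until it
    meets the cycle, and from there \<open>p\<close> is at most one edge away.\<close>
  have conn: "Ao\<^sup>*\<^sup>* x p" if x: "x \<in> W" for x
  proof -
    have xp: "?A\<^sup>*\<^sup>* x p"
      using x pV(1) emb[OF g] unfolding W_def comb_embedding_def connected_graph_def by blast
    have cp: "Ao q p" "Ao r p"
      using bdI[OF adj_sym[OF g c3(1)]] bdI[OF c3(3)] adj_sym[OF g c3(1)] c3(3)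
      unfolding Ao_def Ai_def C_def by (auto simp: insert_commute)
    from xp x show ?thesis
    proof (induction rule: converse_rtranclp_induct)
      case base
      then show ?case by simp
    next
      case (step y z)
      show ?case
      proof (cases "y \<in> {p, q, r}")
        case True
        then show ?thesis using cp by auto
      next
        case False
        have "y \<in> V" using step(4) unfolding W_def by blast
        then have "(z, y) \<notin> I" using step(4) False unfolding W_def IV_def by blast
        then have "Ao y z" using step(1) unfolding Ao_def Ai_def by blast
        then show ?thesis using step(3) AoW by (meson converse_rtranclp_into_rtranclp)
      qed
    qed
  qed
  let ?E = "{B. B \<subseteq> uedges Ao \<and> (\<forall>x\<in>W. \<not> odd_at B x)}"
  have up: "2 ^ (card W - 1) * card ?E \<le> 2 ^ card (uedges Ao)"
    by (rule card_even_edge_sets[OF fW pW AoW conn])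
  define Rst where "Rst = ?F - {odarts} - S"
  have fR: "finite Rst" using faces_fin[OF g] unfolding Rst_def by simp
  \<comment> \<open>Face sets that contain \<open>S\<close> entirely or not at all: \<open>S\<close>
    is treated as a single face, and the boundaries avoid the erased edges.\<close>
  define Fam where "Fam = Pow Rst \<union> (\<lambda>X. X \<union> S) ` Pow Rst"
  have cFam: "card Fam = 2 * 2 ^ card Rst"
  proof -
    have inj: "inj_on (\<lambda>X. X \<union> S) (Pow Rst)" unfolding inj_on_def Rst_def by blast
    have "Pow Rst \<inter> (\<lambda>X. X \<union> S) ` Pow Rst = {}" using T0(3) unfolding Rst_def by blast
    then have "card Fam = card (Pow Rst) + card ((\<lambda>X. X \<union> S) ` Pow Rst)"
      unfolding Fam_def using fR by (intro card_Un_disjoint) auto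
    then show ?thesis using card_image[OF inj] fR by (simp add: card_Pow)
  qed
  have FamF: "S' \<subseteq> ?F - {odarts}" if "S' \<in> Fam" for S'
    using that S(1) unfolding Fam_def Rst_def by auto
  have "bdry P S' \<in> ?E" if S': "S' \<in> Fam" for S'
  proof -
    have "bdry P S' \<subseteq> uedges Ao"
    proof
      fix e assume "e \<in> bdry P S'"
      then obtain s t where e: "e = {s, t}" "?A s t" "(face ?r (s, t) \<in> S') \<noteq> (face ?r (t, s) \<in> S')"
        unfolding bdry_def[OF g] by blast
      have "\<not> Ai s t"
      proof
        assume "Ai s t"
        then have "face ?r (s, t) \<in> S" "face ?r (t, s) \<in> S"
          using Iiff[OF e(2)] Iiff[OF adj_sym[OF g e(2)]] unfolding Ai_def by auto
        then show False using e(3) S' unfolding Fam_def Rst_def by blast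
      qed
      then show "e \<in> uedges Ao" using e unfolding uedges_def Ao_def by blast
    qed
    then show ?thesis using bdry_even[OF g] unfolding W_def by blast
  qed
  then have subE: "bdry P ` Fam \<subseteq> ?E" by blast
  have injE: "inj_on (bdry P) Fam" unfolding inj_on_def using bdry_inj[OF g] FamF by blast
  have "uedges Ao \<subseteq> uedges ?A" unfolding uedges_def Ao_def by blast
  have "uedges ?A \<subseteq> Pow V" unfolding uedges_def using adj_V[OF g] by blast
  then have fUE: "finite (uedges ?A)" using finV[OF g] by (meson finite_Pow_iff finite_subset)
  then have fE: "finite ?E" using \<open>uedges Ao \<subseteq> uedges ?A\<close> by (simp add: finite_subset)
  have "card Fam \<le> card ?E" by (rule card_inj_on_le[OF injE subE fE])
  then have "2 ^ (card W - 1) * (2 * 2 ^ card Rst) \<le> 2 ^ (card W - 1) * card ?E"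
    unfolding cFam by simp
  also note up
  \<comment> \<open>The exponents count a spanning tree of the remaining graph, one unit for
    \<open>S\<close> and one for each face of \<open>Rst\<close>.\<close>
  finally have "2 ^ (card W - 1 + (1 + card Rst)) \<le> (2 :: nat) ^ card (uedges Ao)"
    by (simp add: power_add)
  then have ineq: "card W - 1 + (1 + card Rst) \<le> card (uedges Ao)"
    by (rule power_le_imp_le_exp[rotated]) simp
  have cUE: "card (uedges ?A) = card (uedges Ao) + card (uedges Ai)"
  proof -
    have "uedges ?A = uedges Ao \<union> uedges Ai"
      unfolding uedges_def Ao_def Ai_def using IA by blast
    moreover have "uedges Ao \<inter> uedges Ai = {}"
      unfolding uedges_def Ao_def Ai_def by (auto simp: doubleton_eq_iff)
    ultimately show ?thesis using fUE by (metis card_Un_disjoint finite_Un)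
  qed
  have cR: "card Rst + card S + 1 = card ?F"
  proof -
    have o: "odarts \<in> ?F" using odarts_isface[OF g] unfolding isface_def[OF g] .
    have "card (?F - {odarts}) + 1 = card ?F" using card_Suc_Diff1[OF faces_fin[OF g] o] by simp
    moreover have "card Rst = card (?F - {odarts}) - card S"
      unfolding Rst_def by (rule card_Diff_subset[OF fS S(1)])
    moreover have "card S \<le> card (?F - {odarts})"
      using S(1) faces_fin[OF g] by (intro card_mono) auto
    ultimately show ?thesis by linarith
  qed
  have cW: "card W + card IV = card V"
  proof -
    have "card W = card V - card IV" unfolding W_def
      by (rule card_Diff_subset) (use IVV finV[OF g] finite_subset in auto)
    moreover have "card IV \<le> card V" using IVV finV[OF g] by (intro card_mono)
    ultimately show ?thesis by linarith
  qed
  have W1: "card W \<ge> 1" using pW fW by (metis One_nat_def Suc_leI card_gt_0_iff empty_iff)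
  \<comment> \<open>Counting darts gives \<open>2 * (card S - 1)\<close> edges strictly inside; with
    Euler's formula, at most \<open>card IV\<close> quadrilaterals fit inside.\<close>
  have m: "card S - 1 \<le> card IV"
    using ineq cUE cR cW W1 euler[OF g] cI2 cS S1 by linarith
  have "t \<notin> {p, q, r}" if q: "rquad P x y z w t" "(x, y) \<in> I" for x y z w t
  proof
    assume t: "t \<in> {p, q, r}"
    have rf: "rface P t = qdarts x y z w" by (rule rface_rquad[OF g q(1)])
    have qq: "quad P x y z w" using q(1) unfolding rquad_def by blast
    have fS': "face ?r (x, y) \<in> S" using Iiff[OF IA[OF q(2)]] q(2) by blast
    have "t \<notin> IV" using t unfolding IV_def by blast
    have "finite IV" using IVV finV[OF g] finite_subset by blast
    have rS: "rface P v \<in> S - {?T} \<and> (\<exists>x y z w. rquad P x y z w v \<and> rface P v = qdarts x y z w)"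
      if v: "v \<in> insert t IV" for v
    proof (cases "v = t")
      case True
      have "qdarts x y z w \<noteq> ?T" using card_qdarts[OF g qq] card_tdarts[OF g T0(1)] by auto
      moreover have "qdarts x y z w \<in> S" using fS' quad_face[OF qq] by simp
      ultimately have "rface P v \<in> S - {?T}" using rf True by simp
      then show ?thesis using rf True q(1) by blast
    next
      case False
      then have vI: "v \<in> IV" using v by blast
      then have vV: "v \<in> V" using IVV by blast
      have "v \<notin> {a, b, c}"
      proof
        assume "v \<in> {a, b, c}"
        then obtain s where "(s, v) \<in> odarts" unfolding odarts_def by blast
        moreover from this have "?A s v" using odarts_adj[OF g] unfolding darts_def by blast
        ultimately show False using IVall[OF vI adj_sym[OF g]] inside3D(5)[OF I3] by blast
      qed
      from rface_ex[OF g vV this] obtain x y z w s where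
        R: "rquad P x y z w v" "rface P v = qdarts x y z w" "(s, v) \<in> qdarts x y z w" by blast
      have RQ: "quad P x y z w" using R(1) unfolding rquad_def by blast
      have sd: "(s, v) \<in> darts ?A" "face ?r (s, v) = qdarts x y z w"
        using isfaceE[OF g quad_isface[OF g RQ] R(3)] by auto
      then have "(s, v) \<in> I" using IVall[OF vI adj_sym[OF g]] unfolding darts_def by blast
      then have "qdarts x y z w \<in> S" using sd unfolding I_def by simp
      moreover have "qdarts x y z w \<noteq> ?T" using card_qdarts[OF g RQ] card_tdarts[OF g T0(1)] by auto
      ultimately have "rface P v \<in> S - {?T}" using R(2) by simp
      then show ?thesis using R by blast
    qed
    \<comment> \<open>The reflex angles of \<open>t\<close> and of the inner vertices would occupy
      \<open>card IV + 1\<close> different quadrilaterals inside, one too many.\<close>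
    have "inj_on (rface P) (insert t IV)"
    proof (rule inj_onI)
      fix v v' assume v: "v \<in> insert t IV" "v' \<in> insert t IV" "rface P v = rface P v'"
      obtain x y z w where R: "rquad P x y z w v" "rface P v = qdarts x y z w" using rS[OF v(1)] by blast
      obtain x' y' z' w' where R': "rquad P x' y' z' w' v'" "rface P v' = qdarts x' y' z' w'"
        using rS[OF v(2)] by blast
      obtain s where s: "(s, v') \<in> qdarts x' y' z' w'" "creflex P v' s" using rquad_corner[OF g R'(1)] by blast
      then have "(s, v') \<in> qdarts x y z w" using R(2) R'(2) v(3) by simp
      then show "v = v'" using s(2) R(1) unfolding rquad_def qdarts_def by auto
    qed
    moreover have "rface P ` insert t IV \<subseteq> S - {?T}" using rS by blast
    ultimately have "card (insert t IV) \<le> card (S - {?T})"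
      using fS by (intro card_inj_on_le) auto
    then show False using m T0(3) \<open>t \<notin> IV\<close> \<open>finite IV\<close> fS by simp
  qed
  then show ?thesis using I3 TI by blast
qed

end

end

text \<open>A pair \<open>(s, t)\<close> stands for the corner at \<open>t\<close> after
  \<open>s\<close>, which belongs to the face of that dart; so keeping all darts of a face keeps the
  face with its tags.\<close>

definition keep :: "('a \<times> 'a) set \<Rightarrow> 'a tagged_emb \<Rightarrow> 'a tagged_emb \<Rightarrow> bool" where
  "keep X P P' \<longleftrightarrow> (\<forall>s t. (s, t) \<in> X \<longrightarrow>
     cadj P' s t \<and> crot P' t s = crot P t s \<and> creflex P' t s = creflex P t s)"

lemma keepD:
  assumes "keep X P P'" "(s, t) \<in> X"
  shows "cadj P' s t" "crot P' t s = crot P t s" "creflex P' t s = creflex P t s"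
  using assms unfolding keep_def by blast+

lemma keep_trans: "keep X P P' \<Longrightarrow> keep X P' P'' \<Longrightarrow> keep X P P''"
  unfolding keep_def by simp

lemma keep_mono: "keep X P P' \<Longrightarrow> Y \<subseteq> X \<Longrightarrow> keep Y P P'"
  unfolding keep_def by blast

lemma keep_refl: "X \<subseteq> darts (cadj P) \<Longrightarrow> keep X P P"
  unfolding keep_def darts_def by blast

lemma keep_quad: "keep X P P' \<Longrightarrow> qdarts x y z w \<subseteq> X \<Longrightarrow> quad P x y z w \<Longrightarrow> quad P' x y z w"
  unfolding keep_def qdarts_def quad_def by simp

lemma keep_rquad: "keep X P P' \<Longrightarrow> qdarts x y z w \<subseteq> X \<Longrightarrow> rquad P x y z w t \<Longrightarrow> rquad P' x y z w t"
  using keep_quad[of X P P' x y z w] unfolding rquad_def keep_def qdarts_def by auto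

lemma simple_path:
  assumes "A\<^sup>*\<^sup>* x y"
  shows "\<exists>ws. distinct (x # ws) \<and> successively A (x # ws) \<and> last (x # ws) = y"
  using assms
proof (induction rule: converse_rtranclp_induct)
  case base
  show ?case by (rule exI[of _ "[]"]) simp
next
  case (step x z)
  then obtain ws where ws: "distinct (z # ws)" "successively A (z # ws)" "last (z # ws) = y" by blast
  show ?case
  proof (cases "x \<in> set (z # ws)")
    case True
    then obtain us vs where uv: "z # ws = us @ x # vs" by (meson split_list)
    have "distinct (x # vs)" using ws(1) unfolding uv by simp
    moreover have "successively A (x # vs)" using ws(2) unfolding uv successively_append_iff by blast
    moreover have "last (x # vs) = y" using ws(3) unfolding uv by simp
    ultimately show ?thesis by blast
  next
    case False
    then show ?thesis using ws step(1) by (intro exI[of _ "z # ws"]) simp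
  qed
qed

context frame
begin

section \<open>Rotating the triangle around a vertex\<close>

definition reach :: "nat \<Rightarrow> 'a tagged_emb \<Rightarrow> 'a tagged_emb \<Rightarrow> bool" where
  "reach k P P' \<longleftrightarrow> (\<exists>j\<le>k. (flip V (a, b) ^^ j) P P')"

lemma reach_refl: "reach 0 P P"
  unfolding reach_def by simp

lemma reach_trans: "reach i P P' \<Longrightarrow> reach j P' P'' \<Longrightarrow> reach (i + j) P P''"
proof -
  assume "reach i P P'" "reach j P' P''"
  then obtain i' j' where "i' \<le> i" "(flip V (a, b) ^^ i') P P'" "j' \<le> j" "(flip V (a, b) ^^ j') P' P''"
    unfolding reach_def by blast
  then have "i' + j' \<le> i + j" "(flip V (a, b) ^^ (i' + j')) P P''"
    unfolding relpowp_add by auto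
  then show ?thesis unfolding reach_def by blast
qed

lemma reach_mono: "reach i P P' \<Longrightarrow> i \<le> j \<Longrightarrow> reach j P P'"
  unfolding reach_def using le_trans by blast

lemma reach_flip: "flip V (a, b) P P' \<Longrightarrow> reach 1 P P'"
  unfolding reach_def by (intro exI[of _ 1]) (auto simp: OO_def)

definition itri :: "'a tagged_emb \<Rightarrow> 'a \<Rightarrow> 'a \<Rightarrow> 'a \<Rightarrow> bool" where
  "itri P x y z \<longleftrightarrow> tri P x y z \<and> tdarts x y z \<inter> odarts = {}"

lemma tdarts_rot: "tdarts y z x = tdarts x y z"
  unfolding tdarts_def by auto

lemma itri_rot: "good P \<Longrightarrow> itri P x y z \<Longrightarrow> itri P y z x"
  unfolding itri_def tdarts_rot[of y z x] using tri_rot by blast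

lemma itri_unique: "good P \<Longrightarrow> itri P x y z \<Longrightarrow> itri P x' y' z' \<Longrightarrow> tdarts x y z = tdarts x' y' z'"
  by (rule tri_unique) (auto simp: itri_def tdarts_def)

lemma itri_adj: "good P \<Longrightarrow> itri P x y z \<Longrightarrow> cadj P x y \<and> cadj P y z \<and> cadj P z x"
  unfolding itri_def using tri_adj by blast

lemma itri_distinct: "good P \<Longrightarrow> itri P x y z \<Longrightarrow> x \<noteq> y \<and> y \<noteq> z \<and> z \<noteq> x"
  unfolding itri_def using tri_distinct by blast

text \<open>With quadrilaterals only, the number of darts would be 3 modulo 4, but every edge has
  two darts.\<close>

lemma itri_ex: assumes g: "good P" shows "\<exists>x y z. itri P x y z"
proof -
  show ?thesis
  proof (rule ccontr)
    assume n: "\<nexists>x y z. itri P x y z"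
    let ?F = "faces (cadj P) (crot P)"
    have k: "card f = 4" if "f \<in> ?F - {odarts}" for f
    proof -
      have "isface P f" "f \<noteq> odarts" using that unfolding isface_def[OF g] by simp_all
      from face_kind[OF g this(1)] this(2) show ?thesis
        using n card_qdarts[OF g] unfolding itri_def by auto
    qed
    have o: "odarts \<in> ?F" using odarts_isface[OF g] unfolding isface_def[OF g] .
    have "card (darts (cadj P)) = (\<Sum>f\<in>?F. card f)"
      unfolding darts_Union[OF g] by (rule card_Union_faces[OF g]) simp
    also have "\<dots> = card odarts + (\<Sum>f\<in>?F - {odarts}. card f)"
      using o faces_fin[OF g] by (rule sum.remove[rotated])
    also have "(\<Sum>f\<in>?F - {odarts}. card f) = 4 * card (?F - {odarts})" using k by simp
    finally have "card (darts (cadj P)) = 3 + 4 * card (?F - {odarts})" using card_odarts[OF g] by simp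
    moreover have "card (darts (cadj P)) = 2 * card (uedges (cadj P))"
      by (rule card_darts[OF darts_fin[OF g]]) (use adj_ne[OF g] adj_sym[OF g] in blast)
    ultimately show False by presburger
  qed
qed

lemma face_disjoint:
  assumes g: "good P" and f: "isface P f" and T: "itri P u v w" and F: "quad P v u p q"
    and d: "d \<in> f" "d \<notin> tdarts u v w" "d \<notin> qdarts v u p q"
  shows "f \<subseteq> darts (cadj P) - (tdarts u v w \<union> qdarts v u p q)"
proof -
  have "isface P (tdarts u v w)" using T tri_isface[OF g] unfolding itri_def by blast
  then have "f \<inter> tdarts u v w = {}" using isface_eq[OF g f] d by blast
  moreover have "f \<inter> qdarts v u p q = {}" using isface_eq[OF g f quad_isface[OF g F]] d by blast
  ultimately show ?thesis using isfaceE[OF g f] by blast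
qed

text \<open>The form of \<open>flip_exists\<close> used from here on. The new triangle is interior
  because its chord was not an edge before, whereas all outer darts were.\<close>

lemma chord_flip:
  assumes g: "good P" and T: "itri P u v w" and F: "rquad P v u p q z"
    and pent: "(y0, y1, y2, y3, y4) \<in>
      {(w, u, p, q, v), (u, p, q, v, w), (p, q, v, w, u), (q, v, w, u, p), (v, w, u, p, q)}"
    and na: "\<not> cadj P y0 y2" and ne: "y0 \<noteq> y2" "y0 \<noteq> y3" "y2 \<noteq> y4" and z: "z \<in> {y0, y2, y3, y4}"
  shows "\<exists>P'. reach 1 P P' \<and> good P' \<and>
    (\<forall>s t. cadj P' s t \<longleftrightarrow> (cadj P s t \<and> {s, t} \<noteq> {u, v}) \<or> {s, t} = {y0, y2}) \<and>
    itri P' y0 y1 y2 \<and> rquad P' y0 y2 y3 y4 z \<and>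
    keep (darts (cadj P) - (tdarts u v w \<union> qdarts v u p q)) P P'"
proof -
  have T': "tri P u v w" "(u, v) \<notin> odarts" using T unfolding itri_def tdarts_def by auto
  obtain P' where P': "flip V (a, b) P P'" "good P'"
    "\<And>s t. cadj P' s t \<longleftrightarrow> (cadj P s t \<and> {s, t} \<noteq> {u, v}) \<or> {s, t} = {y0, y2}"
    "tri P' y0 y1 y2" "rquad P' y0 y2 y3 y4 z"
    "\<And>s t. cadj P s t \<Longrightarrow> (s, t) \<notin> tdarts u v w \<union> qdarts v u p q \<Longrightarrow>
       crot P' t s = crot P t s \<and> creflex P' t s = creflex P t s"
    using flip_exists[OF g T' F pent na ne z] by blast
  have "tdarts y0 y1 y2 \<noteq> odarts"
    using odarts_adj[OF g] na adj_sym[OF g] unfolding darts_def tdarts_def by blast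
  then have "tdarts y0 y1 y2 \<inter> odarts = {}"
    using isface_eq[OF P'(2) tri_isface[OF P'(2) P'(4)] odarts_isface[OF P'(2)]] by blast
  then have i: "itri P' y0 y1 y2" using P'(4) unfolding itri_def by blast
  have "keep (darts (cadj P) - (tdarts u v w \<union> qdarts v u p q)) P P'"
    unfolding keep_def
  proof (intro allI impI)
    fix s t assume st: "(s, t) \<in> darts (cadj P) - (tdarts u v w \<union> qdarts v u p q)"
    then have A: "cadj P s t" "(s, t) \<notin> tdarts u v w \<union> qdarts v u p q" unfolding darts_def by auto
    have "{s, t} \<noteq> {u, v}" using A(2) unfolding tdarts_def qdarts_def by (auto simp: doubleton_eq_iff)
    then show "cadj P' s t \<and> crot P' t s = crot P t s \<and> creflex P' t s = creflex P t s"
      using P'(3,6)[of s t] A by blast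
  qed
  then show ?thesis using reach_flip[OF P'(1)] P'(2,3,5) i by blast
qed

text \<open>Of the chords \<open>uw'\<close> and \<open>vy\<close> that take \<open>T\<close> past
  \<open>vw\<close>, the first fails here. The 3-cycle \<open>v u w'\<close> has \<open>T\<close>
  inside, hence also the quadrilateral across \<open>vw\<close>, so by \<open>tricycle\<close> its
  reflex vertex is not on the cycle. Strictly inside the cycle, \<open>v\<close> has the single
  neighbour \<open>w\<close>, which excludes an edge \<open>vy\<close>.\<close>

lemma blocked:
  assumes g: "good P" and T: "itri P u v w" and F: "rquad P w v w' y z"
    and ne: "y \<noteq> u" "u \<noteq> w'" and adj: "cadj P u w'"
  shows "z \<noteq> w'" "z \<noteq> v" "\<not> cadj P v y"
proof -
  have Q: "quad P w v w' y" using F unfolding rquad_def by blast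
  have tA: "cadj P u v" "cadj P v w" "cadj P w u" using itri_adj[OF g T] by auto
  have qA: "cadj P w v" "cadj P v w'" "cadj P w' y" "cadj P y w" using quad_adj[OF g Q] by auto
  have td: "u \<noteq> v" "v \<noteq> w" "w \<noteq> u" using itri_distinct[OF g T] by auto
  have qd: "distinct [w, v, w', y]" using quad_distinct[OF g Q] .
  have tr: "crot P v u = w" "crot P v w = w'" using T Q unfolding itri_def tri_def quad_def by auto
  obtain I where I: "inside3 P v u w' I"
    "\<And>x y z. tri P x y z \<Longrightarrow> (x, y) \<notin> odarts \<Longrightarrow> tdarts x y z \<subseteq> I"
    "\<And>x y z w t. rquad P x y z w t \<Longrightarrow> (x, y) \<in> I \<Longrightarrow> t \<notin> {v, u, w'}"
    using tricycle[OF g adj_sym[OF g tA(1)] adj adj_sym[OF g qA(2)]] by blast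
  have TI: "tdarts u v w \<subseteq> I" using T I(2)[of u v w] unfolding itri_def tdarts_def by blast
  have "{v, w} \<notin> {{v, u}, {u, w'}, {w', v}}" using td qd ne by (auto simp: doubleton_eq_iff)
  from inside3D(3)[OF g I(1) tA(2) this] have wv: "(w, v) \<in> I" using TI unfolding tdarts_def by blast
  show "z \<noteq> w'" "z \<noteq> v" using I(3)[OF F wv] by auto
  have QI: "qdarts w v w' y \<subseteq> I" using inside3_quad[OF g I(1) Q] wv by blast
  have vw': "(w', v) \<notin> I"
    using inside3D(4)[OF g I(1) qA(2)] QI unfolding qdarts_def by (auto simp: insert_commute)
  show "\<not> cadj P v y"
  proof
    assume vy: "cadj P v y"
    have yn: "y \<notin> {v, u, w'}" using qd ne by auto
    have yw': "(w', y) \<in> I" using QI unfolding qdarts_def by blast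
    have "(v, y) \<in> I"
      by (rule inside3_vertex[OF g I(1) yn adj_sym[OF g qA(3)] yw' adj_sym[OF g vy]])
    moreover have "{v, y} \<notin> {{v, u}, {u, w'}, {w', v}}" using yn by (auto simp: doubleton_eq_iff)
    ultimately have yv: "(y, v) \<in> I" using inside3D(3)[OF g I(1) vy] by blast
    \<comment> \<open>Turning at \<open>v\<close> from \<open>w'\<close> on, all corners are outside
      until \<open>u\<close> is reached; after \<open>u\<close> comes \<open>w\<close>, and then
      \<open>w'\<close> again.\<close>
    have "y \<in> {s. (s, v) \<notin> I} \<union> {u, w}"
    proof (rule rot_closed[OF g qA(2) _ _ vy])
      show "w' \<in> {s. (s, v) \<notin> I} \<union> {u, w}" using vw' by simp
      fix s assume s: "cadj P v s" "s \<in> {s. (s, v) \<notin> I} \<union> {u, w}"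
      let ?s = "crot P v s"
      show "?s \<in> {s. (s, v) \<notin> I} \<union> {u, w}"
      proof (cases "s = u \<or> s = w")
        case True
        then show ?thesis using tr vw' by auto
      next
        case False
        then have "(s, v) \<notin> I" using s(2) by blast
        then have n: "(v, ?s) \<notin> I" using inside3D(2)[OF g I(1) adj_sym[OF g s(1)]] by blast
        show ?thesis
        proof (cases "?s \<in> {u, w'}")
          case True
          then show ?thesis using vw' by auto
        next
          case F: False
          have "{v, ?s} \<notin> {{v, u}, {u, w'}, {w', v}}"
            using F adj_ne[OF g rot_adj[OF g s(1)]] td qd by (auto simp: doubleton_eq_iff)
          from inside3D(3)[OF g I(1) rot_adj[OF g s(1)] this] n show ?thesis by simp
        qed
      qed
    qed
    then show False using yv yn qd by auto
  qed
qed

text \<open>Otherwise the cycle \<open>v y w'\<close> would have \<open>T\<close> inside, and with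
  it the quadrilateral across \<open>vw\<close>, whose reflex vertex \<open>v\<close> lies on the
  cycle.\<close>

lemma reflex_blocked:
  assumes g: "good P" and T: "itri P u v w" and F: "rquad P w v w' y v"
  shows "\<not> cadj P v y"
proof
  assume vy: "cadj P v y"
  have Q: "quad P w v w' y" using F unfolding rquad_def by blast
  have tA: "cadj P u v" "cadj P v w" "cadj P w u" using itri_adj[OF g T] by auto
  have qA: "cadj P w v" "cadj P v w'" "cadj P w' y" "cadj P y w" using quad_adj[OF g Q] by auto
  have qd: "distinct [w, v, w', y]" using quad_distinct[OF g Q] .
  obtain I where I: "inside3 P v y w' I"
    "\<And>x y z. tri P x y z \<Longrightarrow> (x, y) \<notin> odarts \<Longrightarrow> tdarts x y z \<subseteq> I"
    "\<And>x z w t y'. rquad P x y' z w t \<Longrightarrow> (x, y') \<in> I \<Longrightarrow> t \<notin> {v, y, w'}"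
    using tricycle[OF g vy adj_sym[OF g qA(3)] adj_sym[OF g qA(2)]] by blast
  have TI: "tdarts u v w \<subseteq> I" using T I(2)[of u v w] unfolding itri_def tdarts_def by blast
  have "{v, w} \<notin> {{v, y}, {y, w'}, {w', v}}" using qd by (auto simp: doubleton_eq_iff)
  from inside3D(3)[OF g I(1) tA(2) this] have wv: "(w, v) \<in> I" using TI unfolding tdarts_def by blast
  show False using I(3)[OF F wv] by auto
qed

text \<open>\<open>T\<close> passes the edge \<open>vw\<close>: either \<open>uw'\<close> or \<open>vy\<close> replaces \<open>vw\<close>. If \<open>y = u\<close>, then \<open>w\<close> has degree 2
  inside the triangle \<open>u v w'\<close>, and \<open>uw\<close> is turned to \<open>ww'\<close> instead.\<close>

lemma right_step:
  assumes g: "good P" and T: "itri P u v w" and Q: "quad P w v w' y" and ne: "u \<noteq> w'"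
  shows "\<exists>P' u'. reach 1 P P' \<and> good P' \<and> itri P' u' v w' \<and>
    keep (darts (cadj P) - (tdarts u v w \<union> qdarts w v w' y)) P P' \<and>
    (\<forall>s t. cadj P s t \<and> s \<notin> {u, v, w} \<longrightarrow> cadj P' s t)"
proof -
  obtain z where F: "rquad P w v w' y z" using quad_reflex[OF g Q] by blast
  have tA: "cadj P u v" "cadj P v w" "cadj P w u" using itri_adj[OF g T] by auto
  have td: "u \<noteq> v" "v \<noteq> w" "w \<noteq> u" using itri_distinct[OF g T] by auto
  have qd: "distinct [w, v, w', y]" using quad_distinct[OF g Q] .
  have zq: "z \<in> {w, v, w', y}" using F unfolding rquad_def by blast
  show ?thesis
  proof (cases "y = u")
    case True
    have F': "rquad P u w v w' z"
      using rquad_rotate[OF g rquad_rotate[OF g rquad_rotate[OF g F]]] True by simp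
    have T': "itri P w u v" using itri_rot[OF g itri_rot[OF g T]] .
    have cr: "crot P w v = u" "crot P w u = v"
      using T F' unfolding itri_def tri_def rquad_def quad_def by auto
    \<comment> \<open>Here \<open>w\<close> has no neighbours besides \<open>u\<close> and
      \<open>v\<close>.\<close>
    have "\<not> cadj P w w'"
    proof
      assume "cadj P w w'"
      have "w' \<in> {u, v}"
        by (rule rot_closed[OF g tA(3) _ _ \<open>cadj P w w'\<close>]) (use cr in auto)
      then show False using ne qd by auto
    qed
    then obtain P' where P': "reach 1 P P'" "good P'"
      "\<And>s t. cadj P' s t \<longleftrightarrow> (cadj P s t \<and> {s, t} \<noteq> {w, u}) \<or> {s, t} = {w, w'}"
      "itri P' w v w'" "keep (darts (cadj P) - (tdarts w u v \<union> qdarts u w v w')) P P'"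
      using chord_flip[OF g T' F', of w v w' u v] qd td zq True by auto
    have "tdarts w u v \<union> qdarts u w v w' = tdarts u v w \<union> qdarts w v w' y"
      unfolding tdarts_def qdarts_def True by auto
    then show ?thesis using P' by (auto simp: doubleton_eq_iff)
  next
    case False
    have T': "itri P v w u" using itri_rot[OF g T] .
    have eq: "tdarts v w u \<union> qdarts w v w' y = tdarts u v w \<union> qdarts w v w' y"
      unfolding tdarts_def by auto
    show ?thesis
    proof (cases "z \<noteq> v \<and> \<not> cadj P u w'")
      case True
      then obtain P' where P': "reach 1 P P'" "good P'"
        "\<And>s t. cadj P' s t \<longleftrightarrow> (cadj P s t \<and> {s, t} \<noteq> {v, w}) \<or> {s, t} = {u, w'}"
        "itri P' u v w'" "keep (darts (cadj P) - (tdarts v w u \<union> qdarts w v w' y)) P P'"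
        using chord_flip[OF g T' F, of u v w' y w] qd td zq False ne by auto
      then show ?thesis unfolding eq by (auto simp: doubleton_eq_iff)
    next
      case bl: False
      have "z \<noteq> w' \<and> \<not> cadj P v y"
      proof (cases "cadj P u w'")
        case True
        then show ?thesis using blocked[OF g T F False ne] by blast
      next
        case uw: False
        then have "z = v" using bl by blast
        then show ?thesis using reflex_blocked[OF g T] F qd by auto
      qed
      then obtain P' where P': "reach 1 P P'" "good P'"
        "\<And>s t. cadj P' s t \<longleftrightarrow> (cadj P s t \<and> {s, t} \<noteq> {v, w}) \<or> {s, t} = {v, y}"
        "itri P' v w' y" "keep (darts (cadj P) - (tdarts v w u \<union> qdarts w v w' y)) P P'"
        using chord_flip[OF g T' F, of v w' y w u] qd td zq False ne by auto
      have "itri P' y v w'" using itri_rot[OF P'(2) itri_rot[OF P'(2) P'(4)]] .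
      then show ?thesis using P' unfolding eq by (auto simp: doubleton_eq_iff)
    qed
  qed
qed

text \<open>A union of faces; such sets hold the corners that later flips must not touch.\<close>

definition fclosed :: "'a tagged_emb \<Rightarrow> ('a \<times> 'a) set \<Rightarrow> bool" where
  "fclosed P X \<longleftrightarrow> X \<subseteq> darts (cadj P) \<and> (\<forall>s t. (s, t) \<in> X \<longrightarrow> (t, crot P t s) \<in> X)"

lemma fclosed_keep: "fclosed P X \<Longrightarrow> keep X P P' \<Longrightarrow> fclosed P' X"
  unfolding fclosed_def keep_def darts_def by auto

lemma fclosed_tri: "tri P x y z \<Longrightarrow> fclosed P X \<Longrightarrow> d \<in> tdarts x y z \<Longrightarrow> d \<in> X \<Longrightarrow> tdarts x y z \<subseteq> X"
proof -
  assume h: "tri P x y z" "fclosed P X" "d \<in> tdarts x y z" "d \<in> X"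
  have n: "(t, crot P t s) \<in> X" if "(s, t) \<in> X" for s t using h(2) that unfolding fclosed_def by blast
  have "(x, y) \<in> X \<Longrightarrow> (y, z) \<in> X" "(y, z) \<in> X \<Longrightarrow> (z, x) \<in> X" "(z, x) \<in> X \<Longrightarrow> (x, y) \<in> X"
    using n[of x y] n[of y z] n[of z x] h(1) unfolding tri_def by simp_all
  then show ?thesis using h(3,4) unfolding tdarts_def by blast
qed

lemma fclosed_quad: "quad P x y z w \<Longrightarrow> fclosed P X \<Longrightarrow> d \<in> qdarts x y z w \<Longrightarrow> d \<in> X \<Longrightarrow> qdarts x y z w \<subseteq> X"
proof -
  assume h: "quad P x y z w" "fclosed P X" "d \<in> qdarts x y z w" "d \<in> X"
  have n: "(t, crot P t s) \<in> X" if "(s, t) \<in> X" for s t using h(2) that unfolding fclosed_def by blast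
  have "(x, y) \<in> X \<Longrightarrow> (y, z) \<in> X" "(y, z) \<in> X \<Longrightarrow> (z, w) \<in> X"
    "(z, w) \<in> X \<Longrightarrow> (w, x) \<in> X" "(w, x) \<in> X \<Longrightarrow> (x, y) \<in> X"
    using n[of x y] n[of y z] n[of z w] n[of w x] h(1) unfolding quad_def by simp_all
  then show ?thesis using h(3,4) unfolding qdarts_def by blast
qed

text \<open>The face across \<open>vw\<close> is interior, and \<open>T\<close>, the only interior
  triangle, cannot lie on both sides of that edge.\<close>

lemma corner_quad:
  assumes g: "good P" and T: "itri P u v w" and n: "(w, v) \<notin> odarts"
  shows "\<exists>y. quad P w v (crot P v w) y"
proof -
  have A: "cadj P w v" using itri_adj[OF g T] adj_sym[OF g] by blast
  have d: "u \<noteq> v" "v \<noteq> w" "w \<noteq> u" using itri_distinct[OF g T] by auto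
  from card_face_int[OF g A n] show ?thesis
  proof
    assume "card (face (crot P) (w, v)) = 3"
    from card3_tri[OF g A this] have t: "tri P w v (crot P v w)" .
    have "(w, v) \<in> tdarts u v w"
      using tri_unique[OF g t n, of u v w] T unfolding itri_def tdarts_def by auto
    then show ?thesis using d unfolding tdarts_def by auto
  next
    assume "card (face (crot P) (w, v)) = 4"
    from card4_quad[OF g A this] show ?thesis by blast
  qed
qed

text \<open>\<open>X\<close> is the protected part and \<open>W\<close> the target. By the sixth
  premise, a protected corner at \<open>v\<close> that does not start in \<open>W\<close> is
  preceded in the rotation by another protected one; as the corner of \<open>T\<close> is
  unprotected, \<open>T\<close> meets \<open>W\<close> before it meets \<open>X\<close>. Taking
  \<open>k\<close> as the first hit ensures that the turn does not come round to
  \<open>u\<close>.\<close>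

lemma rot_to_k:
  assumes "good P" "itri P u v w" "fclosed P X" "(u, v) \<notin> X" "odarts \<subseteq> X"
    and "\<And>s. (s, v) \<in> X \<Longrightarrow> s \<notin> W \<Longrightarrow> \<exists>s'. (s', v) \<in> X \<and> crot P v s' = s"
    and "v \<notin> W" "(crot P v ^^ k) w \<in> W" "\<And>i. i < k \<Longrightarrow> (crot P v ^^ i) w \<notin> W"
  shows "\<exists>P' u' w'. reach k P P' \<and> good P' \<and> itri P' u' v w' \<and> (u' \<in> W \<or> w' \<in> W) \<and> keep X P P' \<and>
    (\<forall>s t. cadj P s t \<and> s \<in> W \<and> t \<in> W \<longrightarrow> cadj P' s t)"
  using assms
proof (induction k arbitrary: P u w)
  case 0
  have "keep X P P" using 0(3) unfolding fclosed_def by (intro keep_refl) blast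
  then show ?case using 0 reach_refl by (intro exI[of _ P] exI[of _ u] exI[of _ w]) simp
next
  case (Suc k)
  note g = Suc.prems(1) and T = Suc.prems(2) and cl = Suc.prems(3) and uX = Suc.prems(4)
    and oX = Suc.prems(5) and H = Suc.prems(6) and vW = Suc.prems(7) and kW = Suc.prems(8) and lk = Suc.prems(9)
  have kX: "keep X P P" using cl unfolding fclosed_def by (intro keep_refl) blast
  show ?case
  proof (cases "u \<in> W")
    case True
    then show ?thesis using g T kX reach_mono[OF reach_refl[of P]]
      by (intro exI[of _ P] exI[of _ u] exI[of _ w]) simp
  next
    case uW: False
    let ?r = "crot P v"
    have wW: "w \<notin> W" using lk[of 0] by simp
    have A: "cadj P u v" "cadj P v w" "cadj P w u" using itri_adj[OF g T] by auto
    have d: "u \<noteq> v" "v \<noteq> w" "w \<noteq> u" using itri_distinct[OF g T] by auto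
    have ru: "?r u = w" using T unfolding itri_def tri_def by blast
    have sA: "cadj P v ((?r ^^ i) w)" for i
      by (induction i) (use A rot_adj[OF g] in auto)
    \<comment> \<open>A repetition would let the neighbour hit at \<open>Suc k\<close> occur
      earlier, against the choice of the first hit.\<close>
    have nper: "(?r ^^ m) w \<noteq> w" if "0 < m" "m \<le> Suc k" for m
    proof
      assume e: "(?r ^^ m) w = w"
      have "(?r ^^ Suc k) w = (?r ^^ (Suc k mod m)) w" using funpow_mod_eq[OF e, of "Suc k"] by metis
      moreover have "Suc k mod m < Suc k" using that mod_less_divisor[OF that(1), of "Suc k"] by linarith
      ultimately show False using kW lk by metis
    qed
    have nu: "(?r ^^ i) w \<noteq> u" if "i \<le> Suc k" for i
    proof
      assume e: "(?r ^^ i) w = u"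
      then have "i \<noteq> Suc k" using kW uW by metis
      moreover have "(?r ^^ Suc i) w = w" using e ru by simp
      ultimately show False using nper[of "Suc i"] that by simp
    qed
    have wX: "(w, v) \<notin> X"
    proof
      assume "(w, v) \<in> X"
      then obtain s' where s': "(s', v) \<in> X" "?r s' = w" using H wW by blast
      then have "cadj P v s'" using cl adj_sym[OF g] unfolding fclosed_def darts_def by blast
      then have "s' = u" using rot_inj[OF g _ adj_sym[OF g A(1)]] s'(2) ru by simp
      then show False using s'(1) uX by simp
    qed
    let ?w = "?r w"
    obtain y where Q: "quad P w v ?w y" using corner_quad[OF g T] wX oX by blast
    have ne: "u \<noteq> ?w" using nu[of 1] by simp
    have qd: "distinct [w, v, ?w, y]" using quad_distinct[OF g Q] .
    obtain P1 u' where P1: "reach 1 P P1" "good P1" "itri P1 u' v ?w"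
      "keep (darts (cadj P) - (tdarts u v w \<union> qdarts w v ?w y)) P P1"
      "\<And>s t. cadj P s t \<Longrightarrow> s \<notin> {u, v, w} \<Longrightarrow> cadj P1 s t"
      using right_step[OF g T Q ne] by blast
    have tT: "tri P u v w" using T unfolding itri_def by blast
    have XT: "tdarts u v w \<inter> X = {}"
      using fclosed_tri[OF tT cl] uX unfolding tdarts_def by blast
    have XQ: "qdarts w v ?w y \<inter> X = {}"
      using fclosed_quad[OF Q cl] wX unfolding qdarts_def by blast
    have k1: "keep X P P1"
      using keep_mono[OF P1(4), of X] XT XQ cl unfolding fclosed_def by blast
    have cl1: "fclosed P1 X" using fclosed_keep[OF cl k1] .
    \<comment> \<open>Faces in \<open>X\<close> are unchanged, so a triangle in \<open>X\<close>
      would have been an interior triangle of \<open>P\<close> already, and thus \<open>T\<close>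
      itself.\<close>
    have u'X: "(u', v) \<notin> X"
    proof
      assume "(u', v) \<in> X"
      have "tri P1 u' v ?w" using P1(3) unfolding itri_def by blast
      from fclosed_tri[OF this cl1 _ \<open>(u', v) \<in> X\<close>] have sub: "tdarts u' v ?w \<subseteq> X"
        unfolding tdarts_def by blast
      have "tri P u' v ?w"
        unfolding tri_def
      proof (intro conjI)
        have m: "(u', v) \<in> X" "(v, ?w) \<in> X" "(?w, u') \<in> X" using sub unfolding tdarts_def by auto
        show "cadj P u' v" using m(1) cl unfolding fclosed_def darts_def by blast
        show "crot P v u' = ?w" "crot P ?w v = u'" "crot P u' ?w = v"
          using keepD(2)[OF k1 m(1)] keepD(2)[OF k1 m(2)] keepD(2)[OF k1 m(3)] P1(3)
          unfolding itri_def tri_def by simp_all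
      qed
      then have "itri P u' v ?w" using P1(3) unfolding itri_def by blast
      from itri_unique[OF g this T] sub XT show False unfolding tdarts_def by blast
    qed
    have cK: "s = u \<or> s = w" if "(s, v) \<in> tdarts u v w \<union> qdarts w v ?w y" for s
      using that d qd unfolding tdarts_def qdarts_def by auto
    \<comment> \<open>Ahead of \<open>T\<close> the rotation at \<open>v\<close> is still the old
      one: only the corners starting at \<open>u\<close> and \<open>w\<close> were affected.\<close>
    have it: "(crot P1 v ^^ i) ?w = (?r ^^ Suc i) w" if "i \<le> k" for i
      using that
    proof (induction i)
      case (Suc i)
      let ?s = "(?r ^^ Suc i) w"
      have "?s \<noteq> u" using nu[of "Suc i"] Suc by simp
      moreover have "?s \<noteq> w" using nper[of "Suc i"] Suc by simp
      ultimately have "(?s, v) \<in> darts (cadj P) - (tdarts u v w \<union> qdarts w v ?w y)"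
        using cK[of ?s] adj_sym[OF g sA[of "Suc i"]] unfolding darts_def by blast
      from keepD(2)[OF P1(4) this] have "crot P1 v ?s = ?r ?s" .
      then show ?case using Suc by simp
    qed simp
    have "\<exists>P' u'' w'. reach k P1 P' \<and> good P' \<and> itri P' u'' v w' \<and> (u'' \<in> W \<or> w' \<in> W) \<and> keep X P1 P' \<and>
      (\<forall>s t. cadj P1 s t \<and> s \<in> W \<and> t \<in> W \<longrightarrow> cadj P' s t)"
    proof (rule Suc.IH[OF P1(2,3) cl1 u'X oX _ vW])
      show "\<exists>s'. (s', v) \<in> X \<and> crot P1 v s' = s" if "(s, v) \<in> X" "s \<notin> W" for s
        using H[OF that] keepD(2)[OF k1] by metis
      show "(crot P1 v ^^ k) ?w \<in> W" using it[of k] kW by simp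
      show "(crot P1 v ^^ i) ?w \<notin> W" if "i < k" for i using it[of i] lk[of "Suc i"] that by simp
    qed
    then obtain P' u'' w' where P': "reach k P1 P'" "good P'" "itri P' u'' v w'" "u'' \<in> W \<or> w' \<in> W"
      "keep X P1 P'" "\<And>s t. cadj P1 s t \<Longrightarrow> s \<in> W \<Longrightarrow> t \<in> W \<Longrightarrow> cadj P' s t" by blast
    have "reach (Suc k) P P'" using reach_trans[OF P1(1) P'(1)] by simp
    moreover have "cadj P' s t" if "cadj P s t" "s \<in> W" "t \<in> W" for s t
      using P'(6)[of s t] P1(5)[of s t] that uW vW wW by blast
    ultimately show ?thesis using P' keep_trans[OF k1 P'(5)] by blast
  qed
qed

text \<open>The first hit comes within one turn, whose length is at most
  \<open>card V\<close>.\<close>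

lemma rot_to:
  assumes g: "good P" and T: "itri P u v w" and X: "fclosed P X" "(u, v) \<notin> X" "odarts \<subseteq> X"
    and H: "\<And>s. (s, v) \<in> X \<Longrightarrow> s \<notin> W \<Longrightarrow> \<exists>s'. (s', v) \<in> X \<and> crot P v s' = s"
    and v: "v \<notin> W" and t: "t \<in> W" "cadj P v t"
  shows "\<exists>P' u' w'. reach (card V) P P' \<and> good P' \<and> itri P' u' v w' \<and> (u' \<in> W \<or> w' \<in> W) \<and> keep X P P' \<and>
    (\<forall>s t. cadj P s t \<and> s \<in> W \<and> t \<in> W \<longrightarrow> cadj P' s t)"
proof -
  let ?r = "crot P v"
  let ?N = "{s. cadj P v s}"
  have w: "cadj P v w" using itri_adj[OF g T] by blast
  obtain k0 where k0: "(?r ^^ k0) w \<in> W" using rot_reach[OF g w t(2)] t(1) by metis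
  define k where "k = (LEAST k. (?r ^^ k) w \<in> W)"
  have k: "(?r ^^ k) w \<in> W" unfolding k_def by (rule LeastI[of _ k0]) (rule k0)
  have lk: "(?r ^^ i) w \<notin> W" if "i < k" for i using not_less_Least that unfolding k_def by blast
  let ?O = "{(?r ^^ k) w | k. True}"
  define n where "n = card ?O"
  have sub: "?r ` ?N \<subseteq> ?N" using rot_adj[OF g] by auto
  have inj: "inj_on ?r ?N" unfolding inj_on_def using rot_inj[OF g] by blast
  have wN: "w \<in> ?N" using w by simp
  have ret: "(?r ^^ n) w = w"
    unfolding n_def by (rule orbit_return[OF inj sub wN nbrs_fin[OF g] refl])
  have OV: "?O \<subseteq> V" using funpow_in[OF sub wN] adj_V[OF g] by blast
  then have nV: "n \<le> card V" unfolding n_def using finV[OF g] by (intro card_mono)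
  have "finite ?O" using OV finV[OF g] finite_subset by blast
  then have n0: "0 < n" unfolding n_def by (auto simp: card_gt_0_iff)
  have "(?r ^^ (k mod n)) w \<in> W" using funpow_mod_eq[OF ret, of k] k by simp
  then have "k \<le> k mod n" using lk not_less by blast
  then have "k \<le> card V" using mod_less_divisor[OF n0, of k] nV by linarith
  then show ?thesis
    using rot_to_k[OF g T X H v k lk] reach_mono[of k P _ "card V"] by blast
qed

section \<open>Walking along a path to the outer face\<close>

lemma odarts_fclosed: "good P \<Longrightarrow> fclosed P odarts"
  using odarts_adj[of P] tri_outer[of P] unfolding fclosed_def odarts_def tri_def by auto

text \<open>\<open>T\<close> turns around \<open>v\<close> until it touches the path
  \<open>ws\<close>, and then around the vertex of \<open>ws\<close> it has reached. Edges within
  the target set survive the turn, so the remaining part of the path stays usable. Each leg shortens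
  the path and costs at most \<open>card V\<close> flips.\<close>

lemma travel_path:
  assumes "good P" "itri P u v w" "successively (cadj P) ws" "distinct ws" "ws \<noteq> []" "last ws \<in> {a, b, c}"
    "v \<notin> set ws" "v \<notin> {a, b, c}" "cadj P v (hd ws)" "length ws \<le> n"
  shows "\<exists>P' x y z. reach (card V * n) P P' \<and> good P' \<and> itri P' x y z \<and> x \<in> {a, b, c}"
  using assms
proof (induction n arbitrary: P u v w ws)
  case 0
  then show ?case by simp
next
  case (Suc n)
  note g = Suc.prems(1) and T = Suc.prems(2)
  have nX: "(s, v) \<notin> odarts" for s using Suc.prems(8) unfolding odarts_def by auto
  have "hd ws \<in> set ws" using Suc.prems(5) by simp
  then obtain P1 u1 w1 where P1: "reach (card V) P P1" "good P1" "itri P1 u1 v w1"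
    "u1 \<in> set ws \<or> w1 \<in> set ws" "\<And>s t. cadj P s t \<Longrightarrow> s \<in> set ws \<Longrightarrow> t \<in> set ws \<Longrightarrow> cadj P1 s t"
    using rot_to[OF g T odarts_fclosed[OF g] nX order_refl _ Suc.prems(7) _ Suc.prems(9)] nX by blast
  obtain x y z where x: "itri P1 x y z" "y \<in> set ws"
  proof (cases "u1 \<in> set ws")
    case True
    then show ?thesis using that[of w1 u1 v] itri_rot[OF P1(2) itri_rot[OF P1(2) P1(3)]] by blast
  next
    case False
    then show ?thesis using that[of v w1 u1] itri_rot[OF P1(2) P1(3)] P1(4) by blast
  qed
  have R: "reach (card V * Suc n) P P1" using reach_mono[OF P1(1)] by simp
  show ?case
  proof (cases "y \<in> {a, b, c}")
    case True
    then show ?thesis using R P1(2) itri_rot[OF P1(2) x(1)] by blast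
  next
    case False
    obtain us vs where uv: "ws = us @ y # vs" using x(2) by (meson split_list)
    have vs: "vs \<noteq> []" using False Suc.prems(6) unfolding uv by auto
    have "successively (cadj P) (y # vs)" using Suc.prems(3) unfolding uv successively_append_iff by blast
    then have "successively (cadj P1) (y # vs)"
      by (rule successively_mono) (use P1(5) uv in auto)
    then have s: "successively (cadj P1) vs" "cadj P1 y (hd vs)" using vs by (cases vs; simp)+
    have "\<exists>P' x y z. reach (card V * n) P1 P' \<and> good P' \<and> itri P' x y z \<and> x \<in> {a, b, c}"
      by (rule Suc.IH[OF P1(2) x(1) s(1) _ vs _ _ False s(2)])
        (use Suc.prems uv vs in auto)
    then obtain P' x' y' z' where P': "reach (card V * n) P1 P'" "good P'" "itri P' x' y' z'" "x' \<in> {a, b, c}"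
      by blast
    have "reach (card V * Suc n) P P'" using reach_trans[OF P1(1) P'(1)] by simp
    then show ?thesis using P' by blast
  qed
qed

lemma travel:
  assumes g: "good P"
  shows "\<exists>P' x y z. reach (card V * card V) P P' \<and> good P' \<and> itri P' x y z \<and> x \<in> {a, b, c}"
proof -
  obtain u v w where T: "itri P u v w" using itri_ex[OF g] by blast
  show ?thesis
  proof (cases "v \<in> {a, b, c}")
    case True
    then show ?thesis using g itri_rot[OF g T] reach_mono[OF reach_refl[of P], of "card V * card V"] by blast
  next
    case False
    have "v \<in> V" using itri_adj[OF g T] adj_V[OF g] by blast
    then have "(cadj P)\<^sup>*\<^sup>* v a"
      using abcV[OF g] emb[OF g] unfolding comb_embedding_def connected_graph_def by blast
    from simple_path[OF this] obtain ws where
      ws: "distinct (v # ws)" "successively (cadj P) (v # ws)" "last (v # ws) = a" by blast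
    have ne: "ws \<noteq> []" using ws(3) False by auto
    have s: "successively (cadj P) ws" "cadj P v (hd ws)" using ws(2) ne by (cases ws; simp)+
    have sV: "set ws \<subseteq> V"
    proof
      fix x assume "x \<in> set ws"
      then obtain us vs where uv: "ws = us @ x # vs" by (meson split_list)
      have "successively (cadj P) ((v # us) @ x # vs)" using ws(2) uv by simp
      then have "cadj P (last (v # us)) x" unfolding successively_append_iff by simp
      then show "x \<in> V" using adj_V[OF g] by blast
    qed
    have "length ws = card (set ws)" using ws(1) by (simp add: distinct_card)
    then have "length ws \<le> card V" using card_mono[OF finV[OF g] sV] by simp
    then show ?thesis using travel_path[OF g T s(1) _ ne _ _ False s(2)] ws ne by auto
  qed
qed

end

abbreviation chain :: "'a tagged_emb \<Rightarrow> 'a \<Rightarrow> 'a \<Rightarrow> 'a list \<Rightarrow> bool" where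
  "chain P p q \<equiv> successively (\<lambda>x y. rquad P x p y q y)"

lemma successively_adj:
  "successively R cs \<Longrightarrow> cs = us @ x # y # vs \<Longrightarrow> R x y"
  by (auto simp: successively_append_iff)

lemma butlast_split: "x \<in> set (butlast cs) \<Longrightarrow> \<exists>us y vs. cs = us @ x # y # vs"
proof -
  assume x: "x \<in> set (butlast cs)"
  then obtain us vs where "butlast cs = us @ x # vs" by (meson split_list)
  moreover have "cs = butlast cs @ [last cs]" using x by (cases cs) auto
  ultimately have cs: "cs = us @ x # (vs @ [last cs])" by simp
  obtain y vs' where "vs @ [last cs] = y # vs'" by (cases vs) auto
  then have "cs = us @ x # y # vs'" using cs by (simp only:)
  then show ?thesis by blast
qed

lemma not_hd_split: "y \<in> set cs \<Longrightarrow> y \<noteq> hd cs \<Longrightarrow> \<exists>us x vs. cs = us @ x # y # vs"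
proof -
  assume y: "y \<in> set cs" "y \<noteq> hd cs"
  then obtain us vs where cs: "cs = us @ y # vs" by (meson split_list)
  then have "us \<noteq> []" using y(2) by auto
  then have "cs = butlast us @ last us # y # vs" using cs by simp
  then show ?thesis by blast
qed

context frame
begin

section \<open>Peeling off layers\<close>

text \<open>The list \<open>cs\<close> starts with \<open>c\<close>; its consecutive entries \<open>x, y\<close> span faces \<open>x b y a\<close> with \<open>y\<close> reflex.
  \<open>ldarts cs\<close> are the darts of the outer face and of these faces.\<close>

definition ldarts :: "'a list \<Rightarrow> ('a \<times> 'a) set" where
  "ldarts cs = {(a, b)} \<union> {(b, x) | x. x \<in> set cs} \<union> {(x, a) | x. x \<in> set cs} \<union>
     {(x, b) | x. x \<in> set (butlast cs)} \<union> {(a, x) | x. x \<in> set (butlast cs)}"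

definition layered :: "'a tagged_emb \<Rightarrow> 'a list \<Rightarrow> bool" where
  "layered P cs \<longleftrightarrow> good P \<and> cs \<noteq> [] \<and> hd cs = c \<and> distinct (a # b # cs) \<and> chain P b a cs"

lemma ldarts_cases:
  assumes h: "hd cs = c" and d: "d \<in> ldarts cs"
  shows "d \<in> odarts \<or> (\<exists>us x y vs. cs = us @ x # y # vs \<and> d \<in> qdarts x b y a)"
proof -
  have c1: "(b, x) \<in> odarts \<and> (x, a) \<in> odarts \<or>
      (\<exists>us z y vs. cs = us @ z # y # vs \<and> (b, x) \<in> qdarts z b y a \<and> (x, a) \<in> qdarts z b y a)"
    if x: "x \<in> set cs" for x
  proof (cases "x = c")
    case True
    then show ?thesis unfolding odarts_def by simp
  next
    case False
    then obtain us y vs where s: "cs = us @ y # x # vs" using x not_hd_split[of x cs] h by blast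
    have "(b, x) \<in> qdarts y b x a" "(x, a) \<in> qdarts y b x a" unfolding qdarts_def by auto
    then show ?thesis using s by blast
  qed
  have c2: "\<exists>us z y vs. cs = us @ z # y # vs \<and> (x, b) \<in> qdarts z b y a \<and> (a, x) \<in> qdarts z b y a"
    if x: "x \<in> set (butlast cs)" for x
  proof -
    obtain us y vs where s: "cs = us @ x # y # vs" using butlast_split[OF x] by blast
    have "(x, b) \<in> qdarts x b y a" "(a, x) \<in> qdarts x b y a" unfolding qdarts_def by auto
    then show ?thesis using s by blast
  qed
  have c3: "(a, b) \<in> odarts" unfolding odarts_def by simp
  from d consider "d = (a, b)" | x where "d = (b, x)" "x \<in> set cs" | x where "d = (x, a)" "x \<in> set cs"
    | x where "d = (x, b)" "x \<in> set (butlast cs)" | x where "d = (a, x)" "x \<in> set (butlast cs)"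
    unfolding ldarts_def by blast
  then show ?thesis
  proof cases
    case 1
    then show ?thesis using c3 by simp
  next
    case (2 x)
    show ?thesis using c1[OF 2(2)] unfolding 2(1) by blast
  next
    case (3 x)
    show ?thesis using c1[OF 3(2)] unfolding 3(1) by blast
  next
    case (4 x)
    show ?thesis using c2[OF 4(2)] unfolding 4(1) by blast
  next
    case (5 x)
    show ?thesis using c2[OF 5(2)] unfolding 5(1) by blast
  qed
qed

lemma last_notin_butlast: "distinct cs \<Longrightarrow> cs \<noteq> [] \<Longrightarrow> last cs \<notin> set (butlast cs)"
  using not_distinct_conv_prefix[of cs] by (metis append_butlast_last_id distinct_append disjoint_insert(1) list.set(2) )

context
  fixes P cs
  assumes layered: "layered P cs"
begin

lemma layD: "good P" "cs \<noteq> []" "hd cs = c" "distinct cs" "a \<notin> set cs" "b \<notin> set cs" "chain P b a cs"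
  using layered unfolding layered_def by auto

lemma layered_rquad: "cs = us @ x # y # vs \<Longrightarrow> rquad P x b y a y"
  using successively_adj[OF layD(7)] .

lemma layered_pair:
  assumes "cs = us @ x # y # vs"
  shows "crot P b x = y" "crot P y b = a" "crot P a y = x" "crot P x a = b"
  using layered_rquad[OF assms] unfolding rquad_def quad_def by auto

lemma c_in: "c \<in> set cs" using layD(2,3) by (metis hd_in_set)

lemma outer_rot: "crot P b a = c" "crot P c b = a" "crot P a c = b"
  using tri_outer[OF layD(1)] unfolding tri_def by auto

lemma layer_adj: "x \<in> set cs \<Longrightarrow> cadj P b x \<and> cadj P x a \<and> crot P x b = a \<and> creflex P x b"
proof (cases "x = c")
  case True
  then show ?thesis using tri_adj[OF layD(1) tri_outer[OF layD(1)]] outer_rot outer_reflex[OF layD(1)] by simp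
next
  case False
  assume "x \<in> set cs"
  then obtain us y vs where s: "cs = us @ y # x # vs" using not_hd_split[of x cs] False layD(3) by blast
  have q: "rquad P y b x a x" using layered_rquad[OF s] .
  then have "quad P y b x a" unfolding rquad_def by blast
  from quad_adj[OF layD(1) this] show ?thesis using q layered_pair[OF s] unfolding rquad_def by blast
qed

lemma butlast_in: "x \<in> set (butlast cs) \<Longrightarrow> x \<in> set cs" by (rule in_set_butlastD)

lemma ldarts_face: "d \<in> ldarts cs \<Longrightarrow> d \<in> odarts \<or> (\<exists>x y. rquad P x b y a y \<and> d \<in> qdarts x b y a)"
  using ldarts_cases[OF layD(3)] layered_rquad by blast

lemma odarts_ldarts: "odarts \<subseteq> ldarts cs"
  using c_in unfolding odarts_def ldarts_def by blast

lemma rquad_ldarts: "cs = us @ x # y # vs \<Longrightarrow> qdarts x b y a \<subseteq> ldarts cs"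
proof -
  assume s: "cs = us @ x # y # vs"
  have "x \<in> set (butlast cs)" "y \<in> set cs" unfolding s by (auto simp: butlast_append)
  then show ?thesis unfolding qdarts_def ldarts_def by blast
qed

lemma ldarts_fclosed: "fclosed P (ldarts cs)"
  unfolding fclosed_def
proof (intro conjI allI impI)
  show "ldarts cs \<subseteq> darts (cadj P)"
  proof
    fix d assume "d \<in> ldarts cs"
    from ldarts_face[OF this] show "d \<in> darts (cadj P)"
    proof
      assume "d \<in> odarts"
      then show ?thesis using odarts_adj[OF layD(1)] by blast
    next
      assume "\<exists>x y. rquad P x b y a y \<and> d \<in> qdarts x b y a"
      then obtain x y where "quad P x b y a" "d \<in> qdarts x b y a" unfolding rquad_def by blast
      then show ?thesis using isfaceE[OF layD(1) quad_isface[OF layD(1)]] by blast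
    qed
  qed
  fix s t assume "(s, t) \<in> ldarts cs"
  then consider "s = a" "t = b" | "s = b" "t \<in> set cs" | "s \<in> set cs" "t = a"
    | "s \<in> set (butlast cs)" "t = b" | "s = a" "t \<in> set (butlast cs)" unfolding ldarts_def by blast
  then show "(t, crot P t s) \<in> ldarts cs"
  proof cases
    case 1
    then show ?thesis using outer_rot c_in unfolding ldarts_def by simp
  next
    case 2
    then show ?thesis using layer_adj[OF 2(2)] unfolding ldarts_def by simp
  next
    case 3
    show ?thesis
    proof (cases "s = c")
      case True
      then show ?thesis using 3 outer_rot unfolding ldarts_def by simp
    next
      case False
      then obtain us y vs where sp: "cs = us @ y # s # vs" using 3 not_hd_split[of s cs] layD(3) by blast
      have "y \<in> set (butlast cs)" unfolding sp by (auto simp: butlast_append)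
      then show ?thesis using 3 layered_pair(3)[OF sp] unfolding ldarts_def by simp
    qed
  next
    case 4
    obtain us y vs where sp: "cs = us @ s # y # vs" using butlast_split[OF 4(1)] by blast
    have "y \<in> set cs" unfolding sp by simp
    moreover have "crot P t s = y" using layered_pair(1)[OF sp] 4(2) by simp
    ultimately show ?thesis using 4(2) unfolding ldarts_def by simp
  next
    case 5
    obtain us y vs where sp: "cs = us @ t # y # vs" using butlast_split[OF 5(2)] by blast
    have "crot P t s = b" using layered_pair(4)[OF sp] 5(1) by simp
    then show ?thesis using 5(2) unfolding ldarts_def by simp
  qed
qed

lemma itri_ldarts: "itri P x y z \<Longrightarrow> tdarts x y z \<inter> ldarts cs = {}"
proof (rule ccontr)
  assume t: "itri P x y z" "tdarts x y z \<inter> ldarts cs \<noteq> {}"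
  then obtain d where d: "d \<in> tdarts x y z" "d \<in> ldarts cs" by blast
  have tt: "tri P x y z" using t(1) unfolding itri_def by blast
  have "d \<notin> odarts" using t(1) d(1) unfolding itri_def by blast
  with ldarts_face[OF d(2)] obtain x' y' where q: "rquad P x' b y' a y'" "d \<in> qdarts x' b y' a" by blast
  have qq: "quad P x' b y' a" using q(1) unfolding rquad_def by blast
  have "tdarts x y z = qdarts x' b y' a"
    by (rule isface_eq[OF layD(1) tri_isface[OF layD(1) tt] quad_isface[OF layD(1) qq] d(1) q(2)])
  then show False using card_tdarts[OF layD(1) tt] card_qdarts[OF layD(1) qq] by simp
qed

text \<open>All of \<open>a\<close>, \<open>b\<close> and \<open>cs\<close> have spent their reflex
  angle on the outer face or on a layer, so none is left for a face further in.\<close>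

lemma reflex_out:
  assumes q: "rquad P x y z w t" and n: "d \<in> qdarts x y z w" "d \<notin> ldarts cs"
  shows "t \<notin> {a, b} \<union> set cs"
proof
  assume t: "t \<in> {a, b} \<union> set cs"
  have qq: "quad P x y z w" using q unfolding rquad_def by blast
  have dj: "qdarts x y z w \<inter> ldarts cs = {}"
    using fclosed_quad[OF qq ldarts_fclosed] n by blast
  obtain s where s: "(s, t) \<in> qdarts x y z w" "cadj P t s" "creflex P t s"
    using rquad_corner[OF layD(1) q] by blast
  have "t \<noteq> a" "t \<noteq> b" using rquad_outer[OF layD(1) q] by auto
  then have "t \<in> set cs" using t by blast
  then have "s = b" using layer_adj reflex_unique[OF layD(1) s(2,3)] adj_sym[OF layD(1)] by blast
  then have "(s, t) \<in> ldarts cs" using \<open>t \<in> set cs\<close> unfolding ldarts_def by blast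
  then show False using dj s(1) by blast
qed

lemma corner_last: "(s, last cs) \<in> ldarts cs \<longleftrightarrow> s = b"
proof -
  have "last cs \<in> set cs" using layD(2) by simp
  moreover have "last cs \<notin> set (butlast cs)" using last_notin_butlast layD(2,4) by blast
  moreover have "last cs \<noteq> a" "last cs \<noteq> b" using calculation(1) layD(5,6) by auto
  ultimately show ?thesis unfolding ldarts_def by auto
qed

text \<open>The protected corners at \<open>b\<close> form an interval of the rotation that begins
  at \<open>a\<close>, as \<open>rot_to\<close> with target \<open>a\<close> demands. At
  \<open>a\<close>, the corresponding interval begins at \<open>last cs\<close>.\<close>

lemma corner_b: "(s, b) \<in> ldarts cs \<Longrightarrow> s \<noteq> a \<Longrightarrow> \<exists>s'. (s', b) \<in> ldarts cs \<and> crot P b s' = s"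
proof -
  assume h: "(s, b) \<in> ldarts cs" "s \<noteq> a"
  have "s \<in> set (butlast cs)" using h ab layD(6) unfolding ldarts_def by (auto dest: butlast_in)
  then have sc: "s \<in> set cs" by (rule butlast_in)
  show ?thesis
  proof (cases "s = c")
    case True
    then show ?thesis using outer_rot by (intro exI[of _ a]) (simp add: ldarts_def)
  next
    case False
    then obtain us y vs where sp: "cs = us @ y # s # vs" using sc not_hd_split[of s cs] layD(3) by blast
    have "y \<in> set (butlast cs)" unfolding sp by (auto simp: butlast_append)
    then show ?thesis using layered_pair(1)[OF sp] by (intro exI[of _ y]) (simp add: ldarts_def)
  qed
qed

lemma corner_a: "(s, a) \<in> ldarts cs \<Longrightarrow> s \<noteq> last cs \<Longrightarrow> \<exists>s'. (s', a) \<in> ldarts cs \<and> crot P a s' = s"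
proof -
  assume h: "(s, a) \<in> ldarts cs" "s \<noteq> last cs"
  have sc: "s \<in> set cs" using h ab layD(5) unfolding ldarts_def by (auto dest: butlast_in)
  then have "s \<in> set (butlast cs)" using h(2) layD(2) by (metis append_butlast_last_id rotate1.simps(2) set_ConsD set_rotate1)
  then obtain us y vs where sp: "cs = us @ s # y # vs" using butlast_split[of s cs] by blast
  have "y \<in> set cs" unfolding sp by simp
  then show ?thesis using layered_pair(3)[OF sp] by (intro exI[of _ y]) (simp add: ldarts_def)
qed

lemma layered_keep: "good P' \<Longrightarrow> keep (ldarts cs) P P' \<Longrightarrow> layered P' cs"
proof -
  assume h: "good P'" "keep (ldarts cs) P P'"
  have "chain P' b a cs"
    unfolding successively_conv_nth
  proof (intro allI impI)
    fix i assume i: "Suc i < length cs"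
    then have s: "cs = take i cs @ cs ! i # cs ! Suc i # drop (Suc (Suc i)) cs"
      by (metis Cons_nth_drop_Suc Suc_lessD append_take_drop_id)
    show "rquad P' (cs ! i) b (cs ! Suc i) a (cs ! Suc i)"
      by (rule keep_rquad[OF h(2) rquad_ldarts[OF s] layered_rquad[OF s]])
  qed
  then show ?thesis using h(1) layered unfolding layered_def by blast
qed

text \<open>The face on the outer side of \<open>x\<close> and the layer below it lead from
  \<open>b\<close> to \<open>a\<close> and back in the rotation, so \<open>x\<close> has degree
  2.\<close>

lemma inner_nbrs: "x \<in> set (butlast cs) \<Longrightarrow> cadj P x s \<Longrightarrow> s = a \<or> s = b"
proof -
  assume h: "x \<in> set (butlast cs)" "cadj P x s"
  have xc: "x \<in> set cs" using h(1) by (rule butlast_in)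
  obtain us y vs where sp: "cs = us @ x # y # vs" using butlast_split[OF h(1)] by blast
  have "s \<in> {a, b}"
    by (rule rot_closed[OF layD(1) _ _ _ h(2), of a]) (use layer_adj[OF xc] layered_pair[OF sp] in auto)
  then show ?thesis by blast
qed

text \<open>When the interior triangle and the last layer meet at a vertex, a 3-cycle separating the two
  must pass through that vertex.\<close>
lemma no_triangle_avoiding:
  assumes T: "itri P x (last cs) y" and c3: "cadj P p q" "cadj P q r" "cadj P r p"
    and n: "set cs \<inter> {p, q, r} = {}"
  shows False
proof -
  note g = layD(1)
  obtain I where I: "inside3 P p q r I"
    "\<And>x y z. tri P x y z \<Longrightarrow> (x, y) \<notin> odarts \<Longrightarrow> tdarts x y z \<subseteq> I"
    using tricycle[OF g c3] by blast
  have "tdarts x (last cs) y \<subseteq> I" using T I(2)[of x "last cs" y] unfolding itri_def tdarts_def by blast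
  then have xI: "(x, last cs) \<in> I" unfolding tdarts_def by blast
  have lc: "last cs \<in> set cs" using layD(2) by simp
  have "(b, last cs) \<in> I"
    by (rule inside3_vertex[OF g I(1) _ adj_sym[OF g] xI adj_sym[OF g]])
      (use n lc itri_adj[OF g T] layer_adj[OF lc] in auto)
  \<comment> \<open>Crossing the layers one by one: no edge between \<open>b\<close> and a layer
    vertex belongs to the cycle, so the outer side is never left.\<close>
  moreover have "(b, cs ! j) \<notin> I" if "j < length cs" for j
    using that
  proof (induction j)
    case 0
    have "(b, cs ! 0) \<in> odarts" using layD(2,3) unfolding odarts_def by (simp add: hd_conv_nth)
    then show ?case using inside3D(5)[OF g I(1)] by blast
  next
    case (Suc j)
    then have j: "j < length cs" "Suc j < length cs" by auto
    have q: "rquad P (cs ! j) b (cs ! Suc j) a (cs ! Suc j)"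
      using layD(7) j(2) unfolding successively_conv_nth by blast
    then have qq: "quad P (cs ! j) b (cs ! Suc j) a" unfolding rquad_def by blast
    have "cs ! j \<in> set cs" using j by simp
    then have "{b, cs ! j} \<notin> {{p, q}, {q, r}, {r, p}}" using n by (auto simp: doubleton_eq_iff)
    from inside3D(3)[OF g I(1) _ this] Suc.IH[OF j(1)] layer_adj[OF \<open>cs ! j \<in> set cs\<close>]
    have "(cs ! j, b) \<notin> I" by blast
    then have nI: "(cs ! j, b) \<notin> I" .
    have "(b, cs ! Suc j) \<in> I \<longleftrightarrow> qdarts b (cs ! Suc j) a (cs ! j) \<subseteq> I"
      by (rule inside3_quad[OF g I(1) quad_rotate[OF g qq]])
    then show ?case using nI unfolding qdarts_def by blast
  qed
  then have "(b, last cs) \<notin> I" using layD(2) by (simp add: last_conv_nth)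
  ultimately show False by blast
qed

end

text \<open>Up to three turns of at most \<open>card V\<close> flips each: around
  \<open>last cs\<close> to \<open>b\<close>, around \<open>b\<close> to \<open>a\<close>, around
  \<open>a\<close> to \<open>last cs\<close>. Each target is the point where the protected interval
  begins.\<close>

lemma to_leftmost:
  assumes L: "layered P cs" and T: "itri P x y z" and x: "x \<in> {a, b, last cs}"
  shows "\<exists>P' w. reach (3 * card V) P P' \<and> layered P' cs \<and> itri P' a (last cs) w"
proof -
  let ?k = "last cs"
  let ?X = "ldarts cs"
  have kc: "?k \<in> set cs" using layD(2)[OF L] by simp
  have kn: "?k \<noteq> a" "?k \<noteq> b" using kc layD(5,6)[OF L] by auto
  have A: "\<exists>P' w. reach (card V) P P' \<and> layered P' cs \<and> itri P' a ?k w"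
    if L: "layered P cs" and T: "itri P u a w" for P u w
  proof -
    note g = layD(1)[OF L]
    have uX: "(u, a) \<notin> ?X" using itri_ldarts[OF L T] unfolding tdarts_def by blast
    obtain P' u' w' where P': "reach (card V) P P'" "good P'" "itri P' u' a w'" "u' \<in> {?k} \<or> w' \<in> {?k}" "keep ?X P P'"
      using rot_to[OF g T ldarts_fclosed[OF L] uX odarts_ldarts[OF L], of "{?k}" ?k]
        corner_a[OF L] kn adj_sym[OF g] layer_adj[OF L kc] by auto
    have L': "layered P' cs" using layered_keep[OF L P'(2,5)] .
    have "(?k, a) \<in> ?X" using kc unfolding ldarts_def by blast
    \<comment> \<open>The corner at \<open>a\<close> that starts at \<open>last cs\<close> is
      protected, so \<open>T\<close> occupies the corner that ends there.\<close>
    then have "u' \<noteq> ?k" using itri_ldarts[OF L' P'(3)] unfolding tdarts_def by blast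
    then have "itri P' u' a ?k" using P'(3,4) by simp
    from itri_rot[OF P'(2) this] show ?thesis using P'(1) L' by blast
  qed
  have B: "\<exists>P' w. reach (2 * card V) P P' \<and> layered P' cs \<and> itri P' a ?k w"
    if L: "layered P cs" and T: "itri P u b w" for P u w
  proof -
    note g = layD(1)[OF L]
    have uX: "(u, b) \<notin> ?X" using itri_ldarts[OF L T] unfolding tdarts_def by blast
    have "cadj P b a" using tri_adj[OF g tri_outer[OF g]] adj_sym[OF g] by blast
    then obtain P' u' w' where P': "reach (card V) P P'" "good P'" "itri P' u' b w'" "u' \<in> {a} \<or> w' \<in> {a}" "keep ?X P P'"
      using rot_to[OF g T ldarts_fclosed[OF L] uX odarts_ldarts[OF L], of "{a}" a]
        corner_b[OF L] ab by auto
    have L': "layered P' cs" using layered_keep[OF L P'(2,5)] .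
    have "\<exists>s t. itri P' s a t"
      using P'(3,4) itri_rot[OF P'(2)] by blast
    then obtain P'' w where "reach (card V) P' P''" "layered P'' cs" "itri P'' a ?k w" using A[OF L'] by blast
    then show ?thesis using reach_trans[OF P'(1), of "card V" P''] by (auto simp: mult_2)
  qed
  have C: "\<exists>P' w. reach (3 * card V) P P' \<and> layered P' cs \<and> itri P' a ?k w"
    if L: "layered P cs" and T: "itri P u ?k w" for P u w
  proof -
    note g = layD(1)[OF L]
    have uX: "(u, ?k) \<notin> ?X" using itri_ldarts[OF L T] unfolding tdarts_def by blast
    have kb: "cadj P ?k b" using layer_adj[OF L kc] adj_sym[OF g] by blast
    then obtain P' u' w' where P': "reach (card V) P P'" "good P'" "itri P' u' ?k w'" "u' \<in> {b} \<or> w' \<in> {b}" "keep ?X P P'"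
      using rot_to[OF g T ldarts_fclosed[OF L] uX odarts_ldarts[OF L], of "{b}" b]
        corner_last[OF L] kn by auto
    have L': "layered P' cs" using layered_keep[OF L P'(2,5)] .
    have "\<exists>s t. itri P' s b t"
      using P'(3,4) itri_rot[OF P'(2)] by blast
    then obtain P'' w where "reach (2 * card V) P' P''" "layered P'' cs" "itri P'' a ?k w" using B[OF L'] by blast
    then show ?thesis using reach_trans[OF P'(1), of "2 * card V" P''] by auto
  qed
  note g = layD(1)[OF L]
  have T2: "itri P z x y" using itri_rot[OF g itri_rot[OF g T]] .
  from x consider "x = a" | "x = b" | "x = ?k" by blast
  then show ?thesis
  proof cases
    case 1
    then obtain P' w where P': "reach (card V) P P'" "layered P' cs" "itri P' a ?k w" using A[OF L] T2 by blast
    then show ?thesis using reach_mono[OF P'(1), of "3 * card V"] by auto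
  next
    case 2
    then obtain P' w where P': "reach (2 * card V) P P'" "layered P' cs" "itri P' a ?k w" using B[OF L] T2 by blast
    then show ?thesis using reach_mono[OF P'(1), of "3 * card V"] by auto
  next
    case 3
    then show ?thesis using C[OF L] T2 by blast
  qed
qed

definition deg :: "'a tagged_emb \<Rightarrow> 'a \<Rightarrow> nat" where
  "deg P v = card {s. cadj P v s}"

section \<open>Stripping the last layer\<close>

text \<open>In state A, the triangle is in the first corner, counted from \<open>a\<close>, of the last layer vertex. It
  cannot move on by cutting off that vertex if the next neighbour \<open>w\<close> is adjacent to \<open>a\<close>; then it
  sits in the second corner instead, which is state B.\<close>

definition stateA :: "'a tagged_emb \<Rightarrow> 'a list \<Rightarrow> 'a \<Rightarrow> bool" where
  "stateA P cs w \<longleftrightarrow> layered P cs \<and> itri P a (last cs) w \<and> w \<noteq> b"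

definition stateB :: "'a tagged_emb \<Rightarrow> 'a list \<Rightarrow> 'a \<Rightarrow> 'a \<Rightarrow> 'a \<Rightarrow> bool" where
  "stateB P cs y w x \<longleftrightarrow>
     layered P cs \<and> itri P y (last cs) w \<and> quad P a (last cs) y x \<and> cadj P a w"

text \<open>The new triangle touches the new layer vertex \<open>d\<close>, as
  \<open>to_leftmost\<close> requires in the next round.\<close>

definition extends :: "nat \<Rightarrow> 'a tagged_emb \<Rightarrow> 'a list \<Rightarrow> bool" where
  "extends m P cs \<longleftrightarrow> (\<exists>P' d s t. reach m P P' \<and> layered P' (cs @ [d]) \<and> itri P' d s t)"

lemma layered_snoc:
  assumes L: "layered P cs" and q: "rquad P (last cs) b y a y" and y: "y \<notin> {a, b} \<union> set cs"
  shows "layered P (cs @ [y])"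
  using layD[OF L] q y ab unfolding layered_def by (auto simp: successively_append_iff)

lemma ldarts_avoid:
  assumes L: "layered P cs" and T: "itri P u v w" and F: "quad P v u p q"
    and d: "d \<in> qdarts v u p q" "d \<notin> ldarts cs"
  shows "ldarts cs \<subseteq> darts (cadj P) - (tdarts u v w \<union> qdarts v u p q)"
  using itri_ldarts[OF L T] fclosed_quad[OF F ldarts_fclosed[OF L] _] d ldarts_fclosed[OF L]
  unfolding fclosed_def by blast

lemma last_facts:
  assumes L: "layered P cs"
  shows "last cs \<noteq> a" "last cs \<noteq> b" "crot P (last cs) b = a" "cadj P (last cs) b" "cadj P (last cs) a"
    "(a, last cs) \<notin> ldarts cs"
proof -
  have k: "last cs \<in> set cs" using layD(2)[OF L] by simp
  then show "last cs \<noteq> a" "last cs \<noteq> b" using layD(5,6)[OF L] by auto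
  show "crot P (last cs) b = a" "cadj P (last cs) b" "cadj P (last cs) a"
    using layer_adj[OF L k] adj_sym[OF layD(1)[OF L]] by auto
  show "(a, last cs) \<notin> ldarts cs" unfolding corner_last[OF L] using ab by blast
qed

lemma ab_adj: "layered P cs \<Longrightarrow> cadj P a b"
  using tri_outer[OF layD(1)] unfolding tri_def by blast

text \<open>Let \<open>k = last cs\<close>, which now has only the neighbours \<open>a\<close>,
  \<open>y\<close>, \<open>b\<close>. Dropping \<open>ky\<close> opens the pentagon
  \<open>b y x a k\<close>. Its reflex vertex is \<open>x\<close> or \<open>y\<close>, and the chord
  that leaves this vertex in a quadrilateral with \<open>a\<close>, \<open>k\<close>,
  \<open>b\<close> makes it the next layer.\<close>

lemma final_B:
  assumes B: "stateB P cs y b x"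
  shows "extends 1 P cs"
proof -
  let ?k = "last cs"
  have L: "layered P cs" and T: "itri P y ?k b" and Q: "quad P a ?k y x" using B unfolding stateB_def by auto
  note g = layD(1)[OF L] and lf = last_facts[OF L]
  have Q': "quad P ?k y x a" using quad_rotate[OF g Q] .
  have qd: "distinct [a, ?k, y, x]" using quad_distinct[OF g Q] .
  have td: "y \<noteq> ?k" "?k \<noteq> b" "b \<noteq> y" using itri_distinct[OF g T] by auto
  have qA: "cadj P a ?k" "cadj P ?k y" "cadj P y x" "cadj P x a" using quad_adj[OF g Q] by auto
  have tA: "cadj P y ?k" "cadj P ?k b" "cadj P b y" using itri_adj[OF g T] by auto
  obtain z where z: "rquad P ?k y x a z" using quad_reflex[OF g Q'] by blast
  have dq: "(a, ?k) \<in> qdarts ?k y x a" unfolding qdarts_def by blast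
  have zo: "z \<notin> {a, b} \<union> set cs" by (rule reflex_out[OF L z dq lf(6)])
  have kc: "?k \<in> set cs" using layD(2)[OF L] by simp
  have zxy: "z = y \<or> z = x" using z zo kc unfolding rquad_def by auto
  have yc: "y \<notin> set cs"
  proof
    assume "y \<in> set cs"
    then have "y \<in> set (butlast cs)" using td(1) by (metis append_butlast_last_id layD(2)[OF L] rotate1.simps(2) set_ConsD set_rotate1)
    from inner_nbrs[OF L this tA(1)] show False using lf by blast
  qed
  have xc: "x \<notin> set cs"
  proof
    assume "x \<in> set cs"
    then have "x \<in> set (butlast cs)" using qd by (metis append_butlast_last_id distinct_length_2_or_more layD(2)[OF L] rotate1.simps(2) set_ConsD set_rotate1)
    from inner_nbrs[OF L this adj_sym[OF g qA(3)]] show False using qd td by auto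
  qed
  have av: "ldarts cs \<subseteq> darts (cadj P) - (tdarts y ?k b \<union> qdarts ?k y x a)"
    by (rule ldarts_avoid[OF L T Q' dq lf(6)])
  show ?thesis
  proof (cases "z = x")
    case False
    then have zy: "z = y" using zxy by blast
    \<comment> \<open>An existing edge would close a 3-cycle that has \<open>T\<close> inside and
      misses all layer vertices.\<close>
    have "\<not> cadj P y a"
    proof
      assume ya: "cadj P y a"
      have "set cs \<inter> {a, x, y} = {}" using xc yc layD(5)[OF L] by blast
      from no_triangle_avoiding[OF L T adj_sym[OF g qA(4)] adj_sym[OF g qA(3)] ya this] show False .
    qed
    then obtain P' where P': "reach 1 P P'" "good P'" "itri P' y x a" "rquad P' y a ?k b z"
      "keep (darts (cadj P) - (tdarts y ?k b \<union> qdarts ?k y x a)) P P'"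
      using chord_flip[OF g T z, of y x a ?k b] qd ab zy by auto
    have L': "layered P' cs" by (rule layered_keep[OF L P'(2) keep_mono[OF P'(5) av]])
    have "rquad P' ?k b y a y"
      using rquad_rotate[OF P'(2) rquad_rotate[OF P'(2) P'(4)]] zy by simp
    from layered_snoc[OF L' this] have "layered P' (cs @ [y])" using zo zy by blast
    then show ?thesis unfolding extends_def using P'(1,3) by blast
  next
    case True
    have xb: "x \<noteq> b" using zo True by blast
    have "\<not> cadj P b x"
    proof
      assume bx: "cadj P b x"
      have "set cs \<inter> {b, x, y} = {}" using xc yc layD(6)[OF L] by blast
      from no_triangle_avoiding[OF L T bx adj_sym[OF g qA(3)] adj_sym[OF g tA(3)] this] show False .
    qed
    then obtain P' where P': "reach 1 P P'" "good P'" "itri P' b y x" "rquad P' b x a ?k z"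
      "keep (darts (cadj P) - (tdarts y ?k b \<union> qdarts ?k y x a)) P P'"
      using chord_flip[OF g T z, of b y x a ?k] qd ab xb True by auto
    have L': "layered P' cs" by (rule layered_keep[OF L P'(2) keep_mono[OF P'(5) av]])
    have "rquad P' ?k b x a x"
      using rquad_rotate[OF P'(2) rquad_rotate[OF P'(2) rquad_rotate[OF P'(2) P'(4)]]] True by simp
    from layered_snoc[OF L' this] have "layered P' (cs @ [x])" using zo True by blast
    moreover have "itri P' x b y" using itri_rot[OF P'(2) itri_rot[OF P'(2) P'(3)]] .
    ultimately show ?thesis unfolding extends_def using P'(1) by blast
  qed
qed

lemma corner_ne_b: "layered P cs \<Longrightarrow> w \<noteq> b \<Longrightarrow> (w, last cs) \<notin> ldarts cs"
  using corner_last by blast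

lemma last_rot_ne:
  assumes L: "layered P cs" and w: "cadj P (last cs) w" "w \<noteq> b"
  shows "crot P (last cs) w \<noteq> a"
  using rot_inj[OF layD(1)[OF L] w(1) last_facts(4)[OF L]] last_facts(3)[OF L] w(2) by auto

text \<open>Let \<open>k = last cs\<close> and let \<open>w'\<close> follow \<open>w\<close> at
  \<open>k\<close>. Replacing \<open>kw\<close> by \<open>yw'\<close> is always possible: the
  3-cycle \<open>k a w\<close> has \<open>y\<close> strictly inside and \<open>w'\<close> not
  inside. If \<open>a\<close> is not adjacent to \<open>w'\<close>, a second flip exchanges
  \<open>yk\<close> for \<open>aw'\<close>.\<close>

lemma step_B:
  assumes B: "stateB P cs y w x" and wb: "w \<noteq> b"
  shows "\<exists>P' w'. (reach 1 P P' \<and> stateB P' cs y w' x \<or> reach 2 P P' \<and> stateA P' cs w') \<and>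
    deg P' (last cs) < deg P (last cs)"
proof -
  let ?k = "last cs"
  have L: "layered P cs" and T: "itri P y ?k w" and Q0: "quad P a ?k y x" and aw: "cadj P a w"
    using B unfolding stateB_def by auto
  note g = layD(1)[OF L] and lf = last_facts[OF L]
  have kc: "?k \<in> set cs" using layD(2)[OF L] by simp
  have qd: "distinct [a, ?k, y, x]" using quad_distinct[OF g Q0] .
  have td: "y \<noteq> ?k" "?k \<noteq> w" "w \<noteq> y" using itri_distinct[OF g T] by auto
  have qA: "cadj P a ?k" "cadj P ?k y" "cadj P y x" "cadj P x a" using quad_adj[OF g Q0] by auto
  have tA: "cadj P y ?k" "cadj P ?k w" "cadj P w y" using itri_adj[OF g T] by auto
  have awne: "a \<noteq> w" using adj_ne[OF g aw] .
  have wX: "(w, ?k) \<notin> ldarts cs" by (rule corner_ne_b[OF L wb])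
  have wo: "(w, ?k) \<notin> odarts" using wX odarts_ldarts[OF L] by blast
  let ?w = "crot P ?k w"
  obtain y2 where Q: "quad P w ?k ?w y2" using corner_quad[OF g T wo] by blast
  obtain z2 where z2: "rquad P w ?k ?w y2 z2" using quad_reflex[OF g Q] by blast
  have Qd: "distinct [w, ?k, ?w, y2]" using quad_distinct[OF g Q] .
  have QA: "cadj P w ?k" "cadj P ?k ?w" "cadj P ?w y2" "cadj P y2 w" using quad_adj[OF g Q] by auto
  have dQ: "(w, ?k) \<in> qdarts w ?k ?w y2" unfolding qdarts_def by blast
  have z2k: "z2 \<noteq> ?k" using reflex_out[OF L z2 dQ wX] kc by blast
  have z2in: "z2 \<in> {w, ?k, ?w, y2}" using z2 unfolding rquad_def by blast
  have ry: "crot P ?k y = w" using T unfolding itri_def tri_def by blast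
  have w'a: "?w \<noteq> a" by (rule last_rot_ne[OF L tA(2) wb])
  have w'y: "?w \<noteq> y"
  proof
    assume e: "?w = y"
    have "a \<in> {y, w}"
      by (rule rot_closed[OF g tA(2) _ _ lf(5)]) (use e ry in auto)
    then show False using awne qd by auto
  qed
  have yy2: "y2 \<noteq> y"
  proof
    assume e: "y2 = y"
    have "crot P w ?k = y" "crot P w y2 = ?k" using T Q unfolding itri_def tri_def quad_def by auto
    then have "a \<in> {?k, y}"
      by (intro rot_closed[OF g QA(1) _ _ adj_sym[OF g aw]]) (use e in auto)
    then show False using lf qd by auto
  qed
  have na: "\<not> cadj P y ?w"
  proof
    assume yw: "cadj P y ?w"
    obtain I where I: "inside3 P ?k a w I"
      "\<And>x y z. tri P x y z \<Longrightarrow> (x, y) \<notin> odarts \<Longrightarrow> tdarts x y z \<subseteq> I"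
      using tricycle[OF g lf(5) aw QA(1)] by blast
    have TI: "tdarts y ?k w \<subseteq> I" using T I(2)[of y ?k w] unfolding itri_def tdarts_def by blast
    have yn: "y \<notin> {?k, a, w}" using qd td by auto
    have wn: "?w \<notin> {?k, a, w}" using Qd w'a by auto
    have "(w, y) \<in> I" using TI unfolding tdarts_def by blast
    from inside3_vertex[OF g I(1) yn adj_sym[OF g tA(3)] this yw] have "(?w, y) \<in> I" .
    then have "(y, ?w) \<in> I"
      using inside3D(3)[OF g I(1) adj_sym[OF g yw]] yn wn by (auto simp: doubleton_eq_iff)
    from inside3_vertex[OF g I(1) wn adj_sym[OF g yw] this adj_sym[OF g QA(2)]]
    have "(?k, ?w) \<in> I" .
    then have "(w, ?k) \<in> I" using inside3D(2)[OF g I(1) QA(1)] by blast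
    moreover have "(?k, w) \<in> I" using TI unfolding tdarts_def by blast
    ultimately show False using inside3D(4)[OF g I(1) QA(1)] by (auto simp: insert_commute)
  qed
  have T': "itri P ?k w y" using itri_rot[OF g T] .
  obtain P1 where P1: "reach 1 P P1" "good P1"
    "\<And>s t. cadj P1 s t \<longleftrightarrow> (cadj P s t \<and> {s, t} \<noteq> {?k, w}) \<or> {s, t} = {y, ?w}"
    "itri P1 y ?k ?w" "keep (darts (cadj P) - (tdarts ?k w y \<union> qdarts w ?k ?w y2)) P P1"
    using chord_flip[OF g T' z2, of y ?k ?w y2 w] na w'y yy2 Qd z2k z2in by auto
  have L1: "layered P1 cs"
    by (rule layered_keep[OF L P1(2) keep_mono[OF P1(5) ldarts_avoid[OF L T' Q dQ wX]]])
  obtain z0 where z0: "rquad P a ?k y x z0" using quad_reflex[OF g Q0] by blast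
  have d0: "(a, ?k) \<in> qdarts a ?k y x" unfolding qdarts_def by blast
  have z0o: "z0 \<notin> {a, b} \<union> set cs" by (rule reflex_out[OF L z0 d0 lf(6)])
  have "(a, ?k) \<notin> tdarts ?k w y" "(a, ?k) \<notin> qdarts w ?k ?w y2"
    using lf qd awne Qd unfolding tdarts_def qdarts_def by auto
  from face_disjoint[OF g quad_isface[OF g Q0] T' Q d0 this]
  have z01: "rquad P1 a ?k y x z0" by (rule keep_rquad[OF P1(5) _ z0])
  then have Q01: "quad P1 a ?k y x" unfolding rquad_def by blast
  have N1: "{s. cadj P1 ?k s} = {s. cadj P ?k s} - {w}"
    using td Qd w'y unfolding P1(3) by (auto simp: doubleton_eq_iff)
  have d1: "deg P1 ?k < deg P ?k"
    unfolding deg_def N1 using tA(2) nbrs_fin[OF g, of ?k]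
    by (metis card_Diff1_less mem_Collect_eq)
  show ?thesis
  proof (cases "cadj P1 a ?w")
    case True
    then have "stateB P1 cs y ?w x" unfolding stateB_def using L1 P1(4) Q01 by blast
    then show ?thesis using P1(1) d1 by blast
  next
    case False
    have F1: "rquad P1 ?k y x a z0" using rquad_rotate[OF P1(2) z01] .
    have Q1: "quad P1 ?k y x a" using quad_rotate[OF P1(2) Q01] .
    have xw: "?w \<noteq> x" using False adj_sym[OF P1(2)] quad_adj[OF P1(2) Q01] by blast
    have z0in: "z0 = y \<or> z0 = x" using z0 z0o kc unfolding rquad_def by auto
    obtain P2 where P2: "reach 1 P1 P2" "good P2"
      "\<And>s t. cadj P2 s t \<longleftrightarrow> (cadj P1 s t \<and> {s, t} \<noteq> {y, ?k}) \<or> {s, t} = {a, ?w}"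
      "itri P2 a ?k ?w" "keep (darts (cadj P1) - (tdarts y ?k ?w \<union> qdarts ?k y x a)) P1 P2"
      using chord_flip[OF P1(2) P1(4) F1, of a ?k ?w y x] False w'a xw qd z0in by auto
    have d1': "(a, ?k) \<in> qdarts ?k y x a" unfolding qdarts_def by blast
    have L2: "layered P2 cs"
      by (rule layered_keep[OF L1 P2(2) keep_mono[OF P2(5) ldarts_avoid[OF L1 P1(4) Q1 d1' lf(6)]]])
    have "?w \<noteq> b" using False ab_adj[OF L1] by blast
    then have "stateA P2 cs ?w" unfolding stateA_def using L2 P2(4) by blast
    moreover have "reach 2 P P2" using reach_trans[OF P1(1) P2(1)] by (simp add: numeral_2_eq_2)
    moreover have "{s. cadj P2 ?k s} \<subseteq> {s. cadj P1 ?k s}"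
      unfolding P2(3) using lf Qd by (auto simp: doubleton_eq_iff)
    then have "deg P2 ?k \<le> deg P1 ?k"
      unfolding deg_def by (intro card_mono nbrs_fin[OF P1(2)])
    ultimately show ?thesis using d1 by (meson le_less_trans)
  qed
qed

text \<open>Let \<open>w k w' y\<close> be the face across \<open>kw\<close> with
  \<open>k = last cs\<close>. If \<open>y = a\<close>, then \<open>w\<close> has degree 2 and its
  edge to \<open>a\<close> is swung to \<open>w'\<close>; if \<open>aw'\<close> is free, it replaces
  \<open>kw\<close>; otherwise \<open>blocked\<close> makes \<open>ky\<close> available. The first
  and the last case lead to state B without raising the degree of \<open>k\<close>.\<close>

lemma step_A:
  assumes A: "stateA P cs w"
  shows "\<exists>P' y w' x. reach 1 P P' \<and>
    (stateA P' cs w' \<and> deg P' (last cs) < deg P (last cs) \<or>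
     stateB P' cs y w' x \<and> deg P' (last cs) \<le> deg P (last cs))"
proof -
  let ?k = "last cs"
  have L: "layered P cs" and T: "itri P a ?k w" and wb: "w \<noteq> b" using A unfolding stateA_def by auto
  note g = layD(1)[OF L]
  have kc: "?k \<in> set cs" using layD(2)[OF L] by simp
  have td: "a \<noteq> ?k" "?k \<noteq> w" "w \<noteq> a" using itri_distinct[OF g T] by auto
  have tA: "cadj P a ?k" "cadj P ?k w" "cadj P w a" using itri_adj[OF g T] by auto
  have wX: "(w, ?k) \<notin> ldarts cs" by (rule corner_ne_b[OF L wb])
  have wo: "(w, ?k) \<notin> odarts" using wX odarts_ldarts[OF L] by blast
  let ?w = "crot P ?k w"
  obtain y where Q: "quad P w ?k ?w y" using corner_quad[OF g T wo] by blast
  obtain z where z: "rquad P w ?k ?w y z" using quad_reflex[OF g Q] by blast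
  have Qd: "distinct [w, ?k, ?w, y]" using quad_distinct[OF g Q] .
  have QA: "cadj P w ?k" "cadj P ?k ?w" "cadj P ?w y" "cadj P y w" using quad_adj[OF g Q] by auto
  have dQ: "(w, ?k) \<in> qdarts w ?k ?w y" unfolding qdarts_def by blast
  have zk: "z \<noteq> ?k" using reflex_out[OF L z dQ wX] kc by blast
  have zin: "z \<in> {w, ?k, ?w, y}" using z unfolding rquad_def by blast
  have w'a: "?w \<noteq> a" by (rule last_rot_ne[OF L tA(2) wb])
  show ?thesis
  proof (cases "y = a")
    case True
    have F': "rquad P a w ?k ?w z"
      using rquad_rotate[OF g rquad_rotate[OF g rquad_rotate[OF g z]]] True by simp
    then have Q': "quad P a w ?k ?w" unfolding rquad_def by blast
    have T': "itri P w a ?k" using itri_rot[OF g itri_rot[OF g T]] .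
    have cr: "crot P w ?k = a" "crot P w a = ?k"
      using T F' unfolding itri_def tri_def rquad_def quad_def by auto
    have na: "\<not> cadj P w ?w"
    proof
      assume "cadj P w ?w"
      have "?w \<in> {a, ?k}"
        by (rule rot_closed[OF g QA(1) _ _ \<open>cadj P w ?w\<close>]) (use cr in auto)
      then show False using w'a Qd by auto
    qed
    obtain P' where P': "reach 1 P P'" "good P'"
      "\<And>s t. cadj P' s t \<longleftrightarrow> (cadj P s t \<and> {s, t} \<noteq> {w, a}) \<or> {s, t} = {w, ?w}"
      "itri P' w ?k ?w" "rquad P' w ?w a ?k z" "keep (darts (cadj P) - (tdarts w a ?k \<union> qdarts a w ?k ?w)) P P'"
      using chord_flip[OF g T' F', of w ?k ?w a ?k] na Qd td zin True by auto
    have d': "(w, ?k) \<in> qdarts a w ?k ?w" unfolding qdarts_def by blast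
    have L': "layered P' cs"
      by (rule layered_keep[OF L P'(2) keep_mono[OF P'(6) ldarts_avoid[OF L T' Q' d' wX]]])
    have "quad P' w ?w a ?k" using P'(5) unfolding rquad_def by blast
    from quad_rotate[OF P'(2) quad_rotate[OF P'(2) this]] have q: "quad P' a ?k w ?w" .
    have "cadj P' a ?w" using quad_adj[OF P'(2) q] adj_sym[OF P'(2)] by blast
    then have "stateB P' cs w ?w ?w" unfolding stateB_def using L' P'(4) q by blast
    moreover have "{s. cadj P' ?k s} \<subseteq> {s. cadj P ?k s}"
      unfolding P'(3) using td Qd by (auto simp: doubleton_eq_iff)
    then have "deg P' ?k \<le> deg P ?k" unfolding deg_def by (intro card_mono nbrs_fin[OF g])
    ultimately show ?thesis using P'(1) by blast
  next
    case ya: False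
    have T': "itri P ?k w a" using itri_rot[OF g T] .
    have av: "ldarts cs \<subseteq> darts (cadj P) - (tdarts ?k w a \<union> qdarts w ?k ?w y)"
      by (rule ldarts_avoid[OF L T' Q dQ wX])
    show ?thesis
    proof (cases "cadj P a ?w")
      case False
      obtain P' where P': "reach 1 P P'" "good P'"
        "\<And>s t. cadj P' s t \<longleftrightarrow> (cadj P s t \<and> {s, t} \<noteq> {?k, w}) \<or> {s, t} = {a, ?w}"
        "itri P' a ?k ?w" "keep (darts (cadj P) - (tdarts ?k w a \<union> qdarts w ?k ?w y)) P P'"
        using chord_flip[OF g T' z, of a ?k ?w y w] False w'a ya Qd zk zin by auto
      have L': "layered P' cs" by (rule layered_keep[OF L P'(2) keep_mono[OF P'(5) av]])
      have "?w \<noteq> b" using False ab_adj[OF L] by blast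
      then have "stateA P' cs ?w" unfolding stateA_def using L' P'(4) by blast
      moreover have "{s. cadj P' ?k s} = {s. cadj P ?k s} - {w}"
        using td Qd unfolding P'(3) by (auto simp: doubleton_eq_iff)
      then have "deg P' ?k < deg P ?k"
        unfolding deg_def using tA(2) nbrs_fin[OF g, of ?k] by (metis card_Diff1_less mem_Collect_eq)
      ultimately show ?thesis using P'(1) by blast
    next
      case True
      note bl = blocked[OF g T z ya w'a[symmetric] True]
      obtain P' where P': "reach 1 P P'" "good P'"
        "\<And>s t. cadj P' s t \<longleftrightarrow> (cadj P s t \<and> {s, t} \<noteq> {?k, w}) \<or> {s, t} = {?k, y}"
        "itri P' ?k ?w y" "rquad P' ?k y w a z" "keep (darts (cadj P) - (tdarts ?k w a \<union> qdarts w ?k ?w y)) P P'"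
        using chord_flip[OF g T' z, of ?k ?w y w a] bl ya Qd zin by auto
      have L': "layered P' cs" by (rule layered_keep[OF L P'(2) keep_mono[OF P'(6) av]])
      have T2: "itri P' y ?k ?w" using itri_rot[OF P'(2) itri_rot[OF P'(2) P'(4)]] .
      have "quad P' ?k y w a" using P'(5) unfolding rquad_def by blast
      from quad_rotate[OF P'(2) quad_rotate[OF P'(2) quad_rotate[OF P'(2) this]]]
      have q: "quad P' a ?k y w" .
      have "cadj P' a ?w" unfolding P'(3) using True td by (auto simp: doubleton_eq_iff)
      then have "stateB P' cs y ?w w" unfolding stateB_def using L' T2 q by blast
      moreover have "deg P' ?k \<le> deg P ?k"
      proof -
        have "{s. cadj P' ?k s} = insert y ({s. cadj P ?k s} - {w})"
          using Qd unfolding P'(3) by (auto simp: doubleton_eq_iff)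
        then have "deg P' ?k \<le> Suc (card ({s. cadj P ?k s} - {w}))"
          unfolding deg_def by (simp add: card_insert_le_m1 card_insert_if nbrs_fin[OF g])
        also have "\<dots> = deg P ?k"
          unfolding deg_def using tA(2) nbrs_fin[OF g, of ?k] by (intro card_Suc_Diff1) auto
        finally show ?thesis .
      qed
      ultimately show ?thesis using P'(1) by blast
    qed
  qed
qed

lemma extends_reach: "reach i P P' \<Longrightarrow> extends j P' cs \<Longrightarrow> i + j \<le> m \<Longrightarrow> extends m P cs"
  unfolding extends_def using reach_trans reach_mono by blast

text \<open>Each \<open>step_B\<close> lowers the degree and costs at most two flips; state A holds
  one flip in reserve for the move to state B that need not lower it. Hence 3 per unit of degree,
  plus 1 in state A.\<close>

lemma strip:
  "(stateA P cs w \<longrightarrow> extends (3 * deg P (last cs) + 1) P cs) \<and>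
   (stateB P cs y w x \<longrightarrow> extends (3 * deg P (last cs)) P cs)"
proof (induction "deg P (last cs)" arbitrary: P w y x rule: less_induct)
  case less
  let ?k = "last cs"
  \<comment> \<open>Proved for every embedding of no larger degree, because state B may be entered
    from \<open>P\<close> with the degree unchanged.\<close>
  have B: "extends (3 * deg Q ?k) Q cs"
    if B: "stateB Q cs y w x" and le: "deg Q ?k \<le> deg P ?k" for Q w y x
  proof (cases "w = b")
    case True
    have L: "layered Q cs" using B unfolding stateB_def by blast
    have "{s. cadj Q ?k s} \<noteq> {}" using last_facts(4)[OF L] by blast
    then have pos: "deg Q ?k > 0"
      unfolding deg_def using nbrs_fin[OF layD(1)[OF L], of ?k] by (simp add: card_gt_0_iff)
    have e: "extends 1 Q cs" using final_B[of Q cs y x] B True by simp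
    show ?thesis by (rule extends_reach[OF reach_refl e]) (use pos in linarith)
  next
    case False
    obtain P' w' where P': "reach 1 Q P' \<and> stateB P' cs y w' x \<or> reach 2 Q P' \<and> stateA P' cs w'"
      "deg P' ?k < deg Q ?k" using step_B[OF B False] by blast
    have lt: "deg P' ?k < deg P ?k" using P'(2) le by linarith
    from P'(1) show ?thesis
    proof (elim disjE conjE)
      assume h: "reach 1 Q P'" "stateB P' cs y w' x"
      have e: "extends (3 * deg P' ?k) P' cs" using less[OF lt] h(2) by blast
      show ?thesis by (rule extends_reach[OF h(1) e]) (use P'(2) in linarith)
    next
      assume h: "reach 2 Q P'" "stateA P' cs w'"
      have e: "extends (3 * deg P' ?k + 1) P' cs" using less[OF lt] h(2) by blast
      show ?thesis by (rule extends_reach[OF h(1) e]) (use P'(2) in linarith)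
    qed
  qed
  have "extends (3 * deg P ?k + 1) P cs" if A: "stateA P cs w"
  proof -
    obtain P' y' w' x' where P': "reach 1 P P'" "stateA P' cs w' \<and> deg P' ?k < deg P ?k \<or>
      stateB P' cs y' w' x' \<and> deg P' ?k \<le> deg P ?k" using step_A[OF A] by blast
    from P'(2) show ?thesis
    proof (elim disjE conjE)
      assume h: "stateA P' cs w'" "deg P' ?k < deg P ?k"
      have e: "extends (3 * deg P' ?k + 1) P' cs" using less[OF h(2)] h(1) by blast
      show ?thesis by (rule extends_reach[OF P'(1) e]) (use h(2) in linarith)
    next
      assume h: "stateB P' cs y' w' x'" "deg P' ?k \<le> deg P ?k"
      show ?thesis by (rule extends_reach[OF P'(1) B[OF h]]) (use h(2) in linarith)
    qed
  qed
  then show ?case using B by blast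
qed

lemma deg_le: "good P \<Longrightarrow> deg P v \<le> card V"
  unfolding deg_def using finV[of P] adj_V[of P] by (intro card_mono) auto

text \<open>The triangle left inside the last layer is itself a face, so the layers use up all
  vertices.\<close>

definition fan :: "'a tagged_emb \<Rightarrow> 'a list \<Rightarrow> bool" where
  "fan P cs \<longleftrightarrow> layered P cs \<and> itri P a (last cs) b"

text \<open>One layer costs at most \<open>3 * card V\<close> flips for the approach and
  \<open>3 * deg + 1\<close>, hence at most \<open>4 * card V\<close>, for the stripping.\<close>

lemma to_fan_layers:
  assumes "layered P cs" "itri P x y z" "x \<in> {a, b, last cs}" "card V - length cs \<le> n"
  shows "\<exists>P' cs'. reach (7 * card V * (n + 1)) P P' \<and> fan P' cs'"
  using assms
proof (induction n arbitrary: P cs x y z rule: nat_induct)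
  case (0 P cs x y z)
  \<comment> \<open>Vacuous: \<open>a\<close> is not in \<open>cs\<close>, so \<open>cs\<close> is
    always shorter than \<open>card V\<close>.\<close>
  note L = 0(1)
  have "set cs \<subseteq> V"
    using layer_adj[OF L] adj_V[OF layD(1)[OF L]] by blast
  moreover have "a \<in> V" using abcV[OF layD(1)[OF L]] by blast
  ultimately have "insert a (set cs) \<subseteq> V" by blast
  then have "card (insert a (set cs)) \<le> card V" using finV[OF layD(1)[OF L]] by (intro card_mono)
  then have "length cs < card V" using layD(4,5)[OF L] by (simp add: distinct_card)
  then show ?case using 0(4) by simp
next
  case (Suc n P cs x y z)
  obtain P1 w where P1: "reach (3 * card V) P P1" "layered P1 cs" "itri P1 a (last cs) w"
    using to_leftmost[OF Suc.prems(1-3)] by blast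
  show ?case
  proof (cases "w = b")
    case True
    then have "fan P1 cs" unfolding fan_def using P1 by blast
    moreover have "reach (7 * card V * (Suc n + 1)) P P1" using reach_mono[OF P1(1)] by simp
    ultimately show ?thesis by blast
  next
    case False
    then have "stateA P1 cs w" unfolding stateA_def using P1 by blast
    then obtain P2 d s t where P2: "reach (3 * deg P1 (last cs) + 1) P1 P2" "layered P2 (cs @ [d])" "itri P2 d s t"
      using strip unfolding extends_def by blast
    have "a \<in> V" "finite V" using abcV finV layD(1)[OF P1(2)] by blast+
    then have V1: "card V \<ge> 1" by (metis One_nat_def Suc_leI card_gt_0_iff empty_iff)
    have "3 * deg P1 (last cs) + 1 \<le> 4 * card V" using deg_le[OF layD(1)[OF P1(2)], of "last cs"] V1 by linarith
    from reach_trans[OF P1(1) reach_mono[OF P2(1) this]] have r: "reach (7 * card V) P P2" by simp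
    obtain P' cs' where P': "reach (7 * card V * (n + 1)) P2 P'" "fan P' cs'"
    proof -
      have "card V - length (cs @ [d]) \<le> n" using Suc.prems(4) by simp
      from Suc.IH[OF P2(2,3) _ this] that show ?thesis by auto
    qed
    have "reach (7 * card V * (Suc n + 1)) P P'"
      using reach_trans[OF r P'(1)] by (simp add: algebra_simps)
    then show ?thesis using P'(2) by blast
  qed
qed

lemma to_fan:
  assumes g: "good P"
  shows "\<exists>P' cs. reach (8 * card V * card V) P P' \<and> fan P' cs"
proof -
  obtain P1 x y z where P1: "reach (card V * card V) P P1" "good P1" "itri P1 x y z" "x \<in> {a, b, c}"
    using travel[OF g] by blast
  \<comment> \<open>The list \<open>[c]\<close> is the layering in which nothing has been peeled off
    yet.\<close>
  have "layered P1 [c]" unfolding layered_def using P1(2) ab bc ca by auto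
  moreover have V1: "card V \<ge> 1"
    using abcV[OF g] finV[OF g] by (metis One_nat_def Suc_leI card_gt_0_iff empty_iff insert_subset)
  ultimately obtain P' cs where P': "reach (7 * card V * (card V - 1 + 1)) P1 P'" "fan P' cs"
    using to_fan_layers[of P1 "[c]" x y z "card V - 1"] P1(3,4) by auto
  have "reach (8 * card V * card V) P P'"
    using reach_trans[OF P1(1) P'(1)] V1 by (simp add: algebra_simps)
  then show ?thesis using P'(2) by blast
qed

end

section \<open>Reversing flips\<close>

lemma simple_of: "comb_4ppt V od P \<Longrightarrow> cadj P u v \<Longrightarrow> cadj P v u \<and> u \<noteq> v"
  unfolding comb_4ppt_def comb_ppt_def comb_pt_def comb_embedding_def simple_graph_def by blast

lemma od_dart: "comb_4ppt V od P \<Longrightarrow> cadj P (fst od) (snd od)"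
  unfolding comb_4ppt_def comb_ppt_def comb_pt_def comb_embedding_def darts_def by auto

lemma del_rot_commute: "u \<noteq> v \<Longrightarrow> del_rot r u v = del_rot r v u"
  unfolding del_rot_def by (auto simp: fun_eq_iff)

lemma del_adj_commute: "del_adj A u v = del_adj A v u"
  unfolding del_adj_def by (simp add: insert_commute)

lemma region_commute: "region r u v = region r v u"
  unfolding region_def by (simp add: Un_commute insert_commute)

lemma face_region: "face r (u, v) \<union> face r (v, u) = region r u v \<union> {(u, v), (v, u)}"
  unfolding region_def using face_self[of "(u, v)" r] face_self[of "(v, u)" r] by blast

lemma flipI:
  assumes "comb_4ppt V od P" "comb_4ppt V od P'"
    "cadj P u v" "\<not> cadj P x y" "cadj P' x y" "card (face (crot P) (u, v)) = 3"
    "od \<notin> face (crot P) (u, v)" "od \<notin> face (crot P) (v, u)"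
    "del_adj (cadj P) u v = del_adj (cadj P') x y"
    "\<And>s t. del_adj (cadj P) u v s t \<Longrightarrow> del_rot (crot P) u v s t = del_rot (crot P') x y s t"
    "region (crot P) u v = region (crot P') x y"
    "(card (face (crot P') (x, y)) = 3 \<and> card (face (crot P') (y, x)) = card (face (crot P) (v, u))) \<or>
      (card (face (crot P') (y, x)) = 3 \<and> card (face (crot P') (x, y)) = card (face (crot P) (v, u)))"
    "\<And>s t. cadj P s t \<Longrightarrow> (t, s) \<notin> face (crot P) (u, v) \<union> face (crot P) (v, u) \<Longrightarrow> creflex P' s t = creflex P s t"
  shows "flip V od P P'"
  unfolding flip_def
  by (rule conjI[OF assms(1) conjI[OF assms(2)]], rule exI[of _ u], rule exI[of _ v],
      rule exI[of _ x], rule exI[of _ y]) (use assms in blast)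

text \<open>The definition of \<open>flip\<close> fixes the side of \<open>uv\<close> on which the
  triangle lies but leaves it open for \<open>xy\<close>; so the reversal has two cases, the second
  with \<open>x\<close> and \<open>y\<close> exchanged. The conditions on the outer dart and the
  tags carry over because both flips share the same region.\<close>

lemma flip_sym:
  assumes "flip V od P P'"
  shows "flip V od P' P"
proof -
  from assms obtain u v x y where
    g: "comb_4ppt V od P" "comb_4ppt V od P'" and
    A: "cadj P u v" "\<not> cadj P x y" "cadj P' x y" and
    c3: "card (face (crot P) (u, v)) = 3" and
    o: "od \<notin> face (crot P) (u, v)" "od \<notin> face (crot P) (v, u)" and
    da: "del_adj (cadj P) u v = del_adj (cadj P') x y" and
    dr: "\<And>s t. del_adj (cadj P) u v s t \<Longrightarrow> del_rot (crot P) u v s t = del_rot (crot P') x y s t" and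
    re: "region (crot P) u v = region (crot P') x y" and
    sz: "(card (face (crot P') (x, y)) = 3 \<and> card (face (crot P') (y, x)) = card (face (crot P) (v, u))) \<or>
      (card (face (crot P') (y, x)) = 3 \<and> card (face (crot P') (x, y)) = card (face (crot P) (v, u)))" and
    tg: "\<And>s t. cadj P s t \<Longrightarrow> (t, s) \<notin> face (crot P) (u, v) \<union> face (crot P) (v, u) \<Longrightarrow> creflex P' s t = creflex P s t"
    unfolding flip_def by blast
  have uv: "cadj P v u" "u \<noteq> v" using simple_of[OF g(1) A(1)] by auto
  have xy: "cadj P' y x" "x \<noteq> y" using simple_of[OF g(2) A(3)] by auto
  have nyx: "\<not> cadj P y x" using simple_of[OF g(1), of y x] A(2) by blast
  have dai: "(cadj P s t \<and> {s, t} \<noteq> {u, v}) \<longleftrightarrow> (cadj P' s t \<and> {s, t} \<noteq> {x, y})" for s t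
    using fun_cong[OF fun_cong[OF da, of s], of t] unfolding del_adj_def .
  have nuv: "\<not> cadj P' u v"
    using dai[of u v] A uv nyx by (auto simp: doubleton_eq_iff)
  have rP: "region (crot P) u v \<subseteq> face (crot P) (u, v) \<union> face (crot P) (v, u)" unfolding region_def by blast
  have "od \<noteq> (x, y)" "od \<noteq> (y, x)" using od_dart[OF g(1)] A(2) nyx by auto
  then have o': "od \<notin> face (crot P') (x, y) \<union> face (crot P') (y, x)"
    unfolding face_region using re o rP by blast
  have tg': "creflex P s t = creflex P' s t"
    if "cadj P' s t" "(t, s) \<notin> face (crot P') (x, y) \<union> face (crot P') (y, x)" for s t
  proof -
    have n: "(t, s) \<noteq> (x, y)" "(t, s) \<noteq> (y, x)" "(t, s) \<notin> region (crot P) u v"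
      using that(2) unfolding face_region re by auto
    then have "{s, t} \<noteq> {x, y}" by (auto simp: doubleton_eq_iff)
    then have "cadj P s t" "{s, t} \<noteq> {u, v}" using dai[of s t] that(1) by blast+
    moreover have "(t, s) \<notin> face (crot P) (u, v) \<union> face (crot P) (v, u)"
      unfolding face_region using n \<open>{s, t} \<noteq> {u, v}\<close> by (auto simp: doubleton_eq_iff)
    ultimately show ?thesis using tg by simp
  qed
  have dr': "del_rot (crot P') x y s t = del_rot (crot P) u v s t" if "del_adj (cadj P') x y s t" for s t
    using dr[of s t] that unfolding da by simp
  from sz show ?thesis
  proof
    assume s: "card (face (crot P') (x, y)) = 3 \<and> card (face (crot P') (y, x)) = card (face (crot P) (v, u))"
    show ?thesis
    proof (rule flipI[OF g(2,1) A(3) nuv A(1) conjunct1[OF s] _ _ da[symmetric] dr' re[symmetric] _ tg'])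
      show "od \<notin> face (crot P') (x, y)" "od \<notin> face (crot P') (y, x)" using o' by auto
    qed (use s c3 in auto)
  next
    assume s: "card (face (crot P') (y, x)) = 3 \<and> card (face (crot P') (x, y)) = card (face (crot P) (v, u))"
    have dr2: "del_rot (crot P') y x s t = del_rot (crot P) u v s t" if "del_adj (cadj P') y x s t" for s t
      using dr'[of s t] that del_rot_commute[OF xy(2)] del_adj_commute by metis
    have da2: "del_adj (cadj P') y x = del_adj (cadj P) u v" using da del_adj_commute by metis
    have re2: "region (crot P') y x = region (crot P) u v" using re region_commute by metis
    show ?thesis
    proof (rule flipI[OF g(2,1) xy(1) nuv A(1) conjunct1[OF s] _ _ da2 dr2 re2])
      show "od \<notin> face (crot P') (y, x)" "od \<notin> face (crot P') (x, y)" using o' by auto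
      show "creflex P s t = creflex P' s t"
        if "cadj P' s t" "(t, s) \<notin> face (crot P') (y, x) \<union> face (crot P') (x, y)" for s t
        using tg'[of s t] that by blast
    qed (use s c3 in auto)
  qed
qed

lemma flip_pow_sym: "(flip V od ^^ j) P P' \<Longrightarrow> (flip V od ^^ j) P' P"
proof (induction j arbitrary: P')
  case (Suc j)
  then obtain P1 where "(flip V od ^^ j) P P1" "flip V od P1 P'" by auto
  then show ?case using Suc.IH flip_sym relpowp_Suc_I2 by metis
qed simp

lemma same_emb_face:
  assumes s: "same_emb P Q" and Q: "\<And>s t. cadj P s t \<Longrightarrow> cadj P t s \<and> cadj P t (crot P t s)" and d: "d \<in> darts (cadj P)"
  shows "face (crot Q) d = face (crot P) d"
proof (rule face_cong[OF d])
  fix e assume e: "e \<in> darts (cadj P)"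
  then obtain u v where uv: "e = (u, v)" "cadj P u v" unfolding darts_def by blast
  then show "fnext (crot P) e \<in> darts (cadj P)" using Q[OF uv(2)] unfolding darts_def fnext_def by simp
  show "fnext (crot Q) e = fnext (crot P) e"
    using s Q[OF uv(2)] uv unfolding same_emb_def fnext_def by simp
qed

text \<open>A flip depends on its source only through values on darts, so an equivalent embedding
  serves as well. This joins two flip sequences that end in equivalent fans.\<close>

lemma (in frame) flip_cong_left:
  assumes f: "flip V (a, b) P P'" and s: "same_emb P Q" and g: "good P" "good Q"
  shows "flip V (a, b) Q P'"
proof -
  from f obtain u v x y where
    gP: "comb_4ppt V (a, b) P" "comb_4ppt V (a, b) P'" and
    A: "cadj P u v" "\<not> cadj P x y" "cadj P' x y" and
    c3: "card (face (crot P) (u, v)) = 3" and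
    o: "(a, b) \<notin> face (crot P) (u, v)" "(a, b) \<notin> face (crot P) (v, u)" and
    da: "del_adj (cadj P) u v = del_adj (cadj P') x y" and
    dr: "\<And>s t. del_adj (cadj P) u v s t \<Longrightarrow> del_rot (crot P) u v s t = del_rot (crot P') x y s t" and
    re: "region (crot P) u v = region (crot P') x y" and
    sz: "(card (face (crot P') (x, y)) = 3 \<and> card (face (crot P') (y, x)) = card (face (crot P) (v, u))) \<or>
      (card (face (crot P') (y, x)) = 3 \<and> card (face (crot P') (x, y)) = card (face (crot P) (v, u)))" and
    tg: "\<And>s t. cadj P s t \<Longrightarrow> (t, s) \<notin> face (crot P) (u, v) \<union> face (crot P) (v, u) \<Longrightarrow> creflex P' s t = creflex P s t"
    unfolding flip_def by blast
  have eA: "cadj Q = cadj P" using s unfolding same_emb_def by simp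
  have er: "crot Q s t = crot P s t" "creflex Q s t = creflex P s t" if "cadj P s t" for s t
    using s that unfolding same_emb_def by simp_all
  have fe: "face (crot Q) d = face (crot P) d" if "d \<in> darts (cadj P)" for d
    by (rule same_emb_face[OF s _ that]) (use adj_sym[OF g(1)] rot_adj[OF g(1)] in blast)
  have vu: "cadj P v u" using adj_sym[OF g(1) A(1)] .
  have f1: "face (crot Q) (u, v) = face (crot P) (u, v)" "face (crot Q) (v, u) = face (crot P) (v, u)"
    using fe A(1) vu unfolding darts_def by auto
  have re': "region (crot Q) u v = region (crot P') x y" using re unfolding region_def f1 by simp
  have dr': "del_rot (crot Q) u v s t = del_rot (crot P') x y s t" if "del_adj (cadj Q) u v s t" for s t
  proof -
    have "cadj P s t" using that unfolding eA del_adj_def by blast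
    then have "del_rot (crot Q) u v s t = del_rot (crot P) u v s t"
      unfolding del_rot_def using er A(1) vu by auto
    then show ?thesis using dr[of s t] that unfolding eA by simp
  qed
  have gQ: "comb_4ppt V (a, b) Q" using g(2) unfolding good_def by blast
  show ?thesis
  proof (rule flipI[OF gQ gP(2) _ _ A(3) _ _ _ _ dr' re'])
    show "creflex P' s t = creflex Q s t"
      if "cadj Q s t" "(t, s) \<notin> face (crot Q) (u, v) \<union> face (crot Q) (v, u)" for s t
      using tg[of s t] er[of s t] that unfolding f1 eA by simp
  qed (use A c3 o da sz in \<open>simp_all add: f1 eA\<close>)
qed

lemma disjoint_ball: "X \<inter> A = {} \<longleftrightarrow> (\<forall>d\<in>A. d \<notin> X)"
  by blast

context frame
begin

section \<open>Sorting a fan\<close>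

text \<open>One chord exchange, packaged for explicit sequences. The first tuple names the removed
  edge \<open>uv\<close>, the triangle and the quadrilateral beside it; the second lists the
  pentagon starting from the new chord.\<close>

definition flips_to where
  "flips_to P P' X = (\<lambda>(u, v, w, p, q) (y0, y1, y2, y3, y4) z. reach 1 P P' \<and> good P' \<and>
    (\<forall>s t. cadj P' s t \<longleftrightarrow> (cadj P s t \<and> {s, t} \<noteq> {u, v}) \<or> {s, t} = {y0, y2}) \<and>
    itri P' y0 y1 y2 \<and> rquad P' y0 y2 y3 y4 z \<and>
    keep X P P' \<and> X \<subseteq> darts (cadj P') \<and> X \<inter> (tdarts y0 y1 y2 \<union> qdarts y0 y2 y3 y4) = {} \<and>
    (\<forall>s t e f r. rquad P s t e f r \<longrightarrow> (s, t) \<notin> tdarts u v w \<union> qdarts v u p q \<longrightarrow> rquad P' s t e f r))"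

lemma flips_toD:
  assumes "flips_to P P' X (u, v, w, p, q) (y0, y1, y2, y3, y4) z"
  shows "reach 1 P P'" "good P'"
    "\<And>s t. cadj P' s t \<longleftrightarrow> (cadj P s t \<and> {s, t} \<noteq> {u, v}) \<or> {s, t} = {y0, y2}"
    "itri P' y0 y1 y2" "rquad P' y0 y2 y3 y4 z" "keep X P P'" "X \<subseteq> darts (cadj P')"
    "X \<inter> (tdarts y0 y1 y2 \<union> qdarts y0 y2 y3 y4) = {}"
    "\<And>s t e f r. rquad P s t e f r \<Longrightarrow> (s, t) \<notin> tdarts u v w \<union> qdarts v u p q \<Longrightarrow> rquad P' s t e f r"
  using assms unfolding flips_to_def prod.case by simp_all

lemma chord_flip_avoiding:
  assumes g: "good P" and T: "itri P u v w" and F: "rquad P v u p q z"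
    and X: "X \<subseteq> darts (cadj P)" "X \<inter> (tdarts u v w \<union> qdarts v u p q) = {}"
    and pent: "(y0, y1, y2, y3, y4) \<in>
      {(w, u, p, q, v), (u, p, q, v, w), (p, q, v, w, u), (q, v, w, u, p), (v, w, u, p, q)}"
    and na: "\<not> cadj P y0 y2" and ne: "y0 \<noteq> y2" "y0 \<noteq> y3" "y2 \<noteq> y4" and z: "z \<in> {y0, y2, y3, y4}"
  shows "\<exists>P'. flips_to P P' X (u, v, w, p, q) (y0, y1, y2, y3, y4) z"
proof -
  obtain P' where P': "reach 1 P P'" "good P'"
    "\<And>s t. cadj P' s t \<longleftrightarrow> (cadj P s t \<and> {s, t} \<noteq> {u, v}) \<or> {s, t} = {y0, y2}"
    "itri P' y0 y1 y2" "rquad P' y0 y2 y3 y4 z"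
    "keep (darts (cadj P) - (tdarts u v w \<union> qdarts v u p q)) P P'"
    using chord_flip[OF g T F pent na ne z] by blast
  have k: "keep X P P'" using keep_mono[OF P'(6)] X by blast
  have XD: "X \<subseteq> darts (cadj P')" using k unfolding keep_def darts_def by auto
  have "{(y0, y1), (y1, y2), (y2, y3), (y3, y4), (y4, y0)} \<subseteq> tdarts u v w \<union> qdarts v u p q"
    using pent unfolding tdarts_def qdarts_def by auto
  moreover have "(y0, y2) \<notin> X" "(y2, y0) \<notin> X"
    using X(1) na adj_sym[OF g, of y2 y0] unfolding darts_def by auto
  ultimately have "X \<inter> (tdarts y0 y1 y2 \<union> qdarts y0 y2 y3 y4) = {}"
    using X(2) unfolding tdarts_def qdarts_def by blast
  moreover have "rquad P' s t e f r"
    if "rquad P s t e f r" "(s, t) \<notin> tdarts u v w \<union> qdarts v u p q" for s t e f r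
  proof -
    have Q: "quad P v u p q" using F unfolding rquad_def by blast
    have Q': "quad P s t e f" using that(1) unfolding rquad_def by blast
    have "(s, t) \<in> qdarts s t e f" unfolding qdarts_def by blast
    from face_disjoint[OF g quad_isface[OF g Q'] T Q this] that(2)
    show ?thesis by (intro keep_rquad[OF P'(6) _ that(1)]) blast
  qed
  ultimately show ?thesis using P' k XD unfolding flips_to_def prod.case
    by (intro exI[of _ P'] conjI allI impI) simp_all
qed

lemma rquad_rot2: "good P \<Longrightarrow> rquad P x y z w t \<Longrightarrow> rquad P z w x y t"
  using rquad_rotate by blast

lemma rquad_rot3: "good P \<Longrightarrow> rquad P x y z w t \<Longrightarrow> rquad P w x y z t"
  using rquad_rotate rquad_rot2 by blast

lemma itri_rot2: "good P \<Longrightarrow> itri P x y z \<Longrightarrow> itri P z x y"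
  using itri_rot by blast

text \<open>The flip sequences of the two exchanges were found by breadth-first search. In the first one,
  \<open>d = a\<close> is allowed, which covers the innermost vertices.\<close>

lemma swap_local:
  assumes g: "good P" and T: "itri P a k h" and Q1: "rquad P k b x h x" and Q2: "rquad P x b y h y"
    and Q3: "rquad P y b d h t"
    and X: "X \<subseteq> darts (cadj P)"
      "X \<inter> (tdarts a k h \<union> qdarts k b x h \<union> qdarts x b y h \<union> qdarts y b d h) = {}"
  shows "\<exists>P'. reach 7 P P' \<and> good P' \<and> itri P' a y h \<and> rquad P' k b y a y \<and> rquad P' y b x h x \<and>
    rquad P' x b d h t \<and> keep X P P'"
proof -
  have q1: "quad P k b x h" and q2: "quad P x b y h" and q3: "quad P y b d h"
    using Q1 Q2 Q3 unfolding rquad_def by auto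
  note tA = itri_adj[OF g T] and A1 = quad_adj[OF g q1] and A2 = quad_adj[OF g q2] and A3 = quad_adj[OF g q3]
  have d1: "distinct [k, b, x, h]" and d2: "distinct [x, b, y, h]" and d3: "distinct [y, b, d, h]"
    and dT: "a \<noteq> k" "k \<noteq> h" "h \<noteq> a"
    using quad_distinct[OF g q1] quad_distinct[OF g q2] quad_distinct[OF g q3] itri_distinct[OF g T] by auto
  \<comment> \<open>Two consecutive quadrilaterals meet at \<open>x\<close> along both of its edges,
    so it has degree 2.\<close>
  have Nx: "s = b \<or> s = h" if "cadj P x s" for s
  proof -
    have "crot P x b = h" "crot P x h = b" using q1 q2 unfolding quad_def by auto
    then have "s \<in> {b, h}" using A2 by (intro rot_closed[OF g, of x b _ s]) (use that in auto)
    then show ?thesis by blast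
  qed
  have Ny: "s = b \<or> s = h" if "cadj P y s" for s
  proof -
    have "crot P y b = h" "crot P y h = b" using q2 q3 unfolding quad_def by auto
    then have "s \<in> {b, h}" using A3 by (intro rot_closed[OF g, of y b _ s]) (use that in auto)
    then show ?thesis by blast
  qed
  have xa: "x \<noteq> a" using Nx[of k] tA d1 by auto
  have ya: "y \<noteq> a" using Ny[of k] tA d1 by auto
  have yk: "y \<noteq> k" using Ny[of a] tA adj_sym[OF g] dT ab by blast
  \<comment> \<open>Otherwise the rotation at \<open>b\<close> would lead to \<open>x\<close> both
    from \<open>y\<close> and from \<open>k\<close>.\<close>
  have xd: "x \<noteq> d"
  proof
    assume "x = d"
    then have "crot P b y = crot P b k" using q1 q3 unfolding quad_def by simp
    then have "y = k" using rot_inj[OF g] A1 A3 adj_sym[OF g] by blast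
    then show False using yk by blast
  qed
  have n1: "\<not> cadj P k x" "\<not> cadj P x y" "\<not> cadj P a x" "\<not> cadj P a y"
    using Nx[of k] Nx[of y] Nx[of a] Ny[of a] adj_sym[OF g, of k x] adj_sym[OF g, of a x] adj_sym[OF g, of a y]
      d1 d2 dT ab by auto
  note n0 = n1 n1[THEN contrapos_nn, OF adj_sym[OF g]]
  \<comment> \<open>\<open>y\<close> already has its reflex angle in the face
    \<open>x b y h\<close>.\<close>
  have ty: "t \<noteq> y"
  proof
    assume "t = y"
    then have "qdarts x b y h = qdarts y b d h" using rquad_unique[OF g Q2] Q3 by blast
    then have "(y, b) \<in> qdarts x b y h" unfolding qdarts_def by blast
    then show False using d1 d2 d3 unfolding qdarts_def by auto
  qed
  have tin: "t \<in> {x, b, d, h}" using Q3 ty unfolding rquad_def by blast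
  note dd = d1 d2 d3 dT xa ya yk xd ab
  have "\<exists>P'. flips_to P P' X (k, h, a, b, x) (k, b, x, h, a) x"
  proof (rule chord_flip_avoiding[OF g itri_rot[OF g T] rquad_rot3[OF g Q1] X(1)])
    show "k \<noteq> x" "k \<noteq> h" "x \<noteq> a" using dd by auto
    show "x \<in> {k, x, h, a}" using tin by simp
    show "\<not> cadj P k x" using n0 dd by (auto simp: doubleton_eq_iff)
    show "X \<inter> (tdarts k h a \<union> qdarts h k b x) = {}"
      using X(2) by (simp add: disjoint_ball tdarts_def qdarts_def ball_Un)
  qed simp
  then obtain P1 where "flips_to P P1 X (k, h, a, b, x) (k, b, x, h, a) x" ..
  note P1 = flips_toD[OF this]
  have Q21: "rquad P1 x b y h y"
    by (rule P1(9)[OF Q2]) (use dd in \<open>auto simp: tdarts_def qdarts_def\<close>)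
  have Q31: "rquad P1 y b d h t"
    by (rule P1(9)[OF Q3]) (use dd in \<open>auto simp: tdarts_def qdarts_def\<close>)
  have "\<exists>P'. flips_to P1 P' X (b, x, k, y, h) (y, h, x, k, b) y"
  proof (rule chord_flip_avoiding[OF P1(2) itri_rot[OF P1(2) P1(4)] Q21 P1(7)])
    show "y \<noteq> x" "y \<noteq> k" "x \<noteq> b" using dd by auto
    show "y \<in> {y, x, k, b}" using tin by simp
    show "\<not> cadj P1 y x" unfolding P1(3) using n0 dd by (auto simp: doubleton_eq_iff)
    show "X \<inter> (tdarts b x k \<union> qdarts x b y h) = {}"
      using X(2) P1(8) by (simp add: disjoint_ball tdarts_def qdarts_def ball_Un)
  qed simp
  then obtain P2 where "flips_to P1 P2 X (b, x, k, y, h) (y, h, x, k, b) y" ..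
  note P2 = flips_toD[OF this]
  have F12: "rquad P2 k x h a x"
    by (rule P2(9)[OF P1(5)]) (use dd in \<open>auto simp: tdarts_def qdarts_def\<close>)
  have Q32: "rquad P2 y b d h t"
    by (rule P2(9)[OF Q31]) (use dd in \<open>auto simp: tdarts_def qdarts_def\<close>)
  have "\<exists>P'. flips_to P2 P' X (h, x, y, a, k) (a, k, x, y, h) x"
  proof (rule chord_flip_avoiding[OF P2(2) itri_rot[OF P2(2) P2(4)] rquad_rotate[OF P2(2) F12] P2(7)])
    show "a \<noteq> x" "a \<noteq> y" "x \<noteq> h" using dd by auto
    show "x \<in> {a, x, y, h}" using tin by simp
    show "\<not> cadj P2 a x" unfolding P2(3) P1(3) using n0 dd by (auto simp: doubleton_eq_iff)
    show "X \<inter> (tdarts h x y \<union> qdarts x h a k) = {}"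
      using P1(8) P2(8) by (simp add: disjoint_ball tdarts_def qdarts_def ball_Un)
  qed simp
  then obtain P3 where "flips_to P2 P3 X (h, x, y, a, k) (a, k, x, y, h) x" ..
  note P3 = flips_toD[OF this]
  have F23: "rquad P3 y x k b y"
    by (rule P3(9)[OF P2(5)]) (use dd in \<open>auto simp: tdarts_def qdarts_def\<close>)
  have Q33: "rquad P3 y b d h t"
    by (rule P3(9)[OF Q32]) (use dd in \<open>auto simp: tdarts_def qdarts_def\<close>)
  have "\<exists>P'. flips_to P3 P' X (k, x, a, b, y) (y, x, a, k, b) y"
  proof (rule chord_flip_avoiding[OF P3(2) itri_rot[OF P3(2) P3(4)] rquad_rotate[OF P3(2) F23] P3(7)])
    show "y \<noteq> a" "y \<noteq> k" "a \<noteq> b" using dd by auto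
    show "y \<in> {y, a, k, b}" using tin by simp
    show "\<not> cadj P3 y a" unfolding P3(3) P2(3) P1(3) using n0 dd by (auto simp: doubleton_eq_iff)
    show "X \<inter> (tdarts k x a \<union> qdarts x k b y) = {}"
      using P2(8) P3(8) by (simp add: disjoint_ball tdarts_def qdarts_def ball_Un)
  qed simp
  then obtain P4 where "flips_to P3 P4 X (k, x, a, b, y) (y, x, a, k, b) y" ..
  note P4 = flips_toD[OF this]
  have F34: "rquad P4 a x y h x"
    by (rule P4(9)[OF P3(5)]) (use dd in \<open>auto simp: tdarts_def qdarts_def\<close>)
  have Q34: "rquad P4 y b d h t"
    by (rule P4(9)[OF Q33]) (use dd in \<open>auto simp: tdarts_def qdarts_def\<close>)
  \<comment> \<open>By now \<open>x\<close> has only the neighbours \<open>a\<close> and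
    \<open>y\<close>; without \<open>xa\<close> it hangs in the pentagon, which therefore passes
    \<open>y\<close> twice.\<close>
  have "\<exists>P'. flips_to P4 P' X (x, a, y, y, h) (x, y, h, a, y) x"
  proof (rule chord_flip_avoiding[OF P4(2) itri_rot[OF P4(2) P4(4)] F34 P4(7)])
    show "x \<noteq> h" "x \<noteq> a" "h \<noteq> y" using dd by auto
    show "x \<in> {x, h, a, y}" using tin by simp
    show "\<not> cadj P4 x h" unfolding P4(3) P3(3) P2(3) P1(3) using n0 dd by (auto simp: doubleton_eq_iff)
    show "X \<inter> (tdarts x a y \<union> qdarts a x y h) = {}"
      using P3(8) P4(8) by (simp add: disjoint_ball tdarts_def qdarts_def ball_Un)
  qed simp
  then obtain P5 where "flips_to P4 P5 X (x, a, y, y, h) (x, y, h, a, y) x" ..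
  note P5 = flips_toD[OF this]
  have F45: "rquad P5 y a k b y"
    by (rule P5(9)[OF P4(5)]) (use dd in \<open>auto simp: tdarts_def qdarts_def\<close>)
  have Q35: "rquad P5 y b d h t"
    by (rule P5(9)[OF Q34]) (use dd in \<open>auto simp: tdarts_def qdarts_def\<close>)
  have "\<exists>P'. flips_to P5 P' X (y, h, x, b, d) (x, y, b, d, h) t"
  proof (rule chord_flip_avoiding[OF P5(2) itri_rot[OF P5(2) P5(4)] rquad_rot3[OF P5(2) Q35] P5(7)])
    show "x \<noteq> b" "x \<noteq> d" "b \<noteq> h" using dd by auto
    show "t \<in> {x, b, d, h}" using tin by simp
    show "\<not> cadj P5 x b" unfolding P5(3) P4(3) P3(3) P2(3) P1(3) using n0 dd by (auto simp: doubleton_eq_iff)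
    show "X \<inter> (tdarts y h x \<union> qdarts h y b d) = {}"
      using X(2) P5(8) by (simp add: disjoint_ball tdarts_def qdarts_def ball_Un)
  qed simp
  then obtain P6 where "flips_to P5 P6 X (y, h, x, b, d) (x, y, b, d, h) t" ..
  note P6 = flips_toD[OF this]
  have F46: "rquad P6 y a k b y"
    by (rule P6(9)[OF F45]) (use dd in \<open>auto simp: tdarts_def qdarts_def\<close>)
  have F56: "rquad P6 x h a y x"
    by (rule P6(9)[OF P5(5)]) (use dd in \<open>auto simp: tdarts_def qdarts_def\<close>)
  have "\<exists>P'. flips_to P6 P' X (x, y, b, h, a) (h, a, y, b, x) x"
  proof (rule chord_flip_avoiding[OF P6(2) P6(4) rquad_rot3[OF P6(2) F56] P6(7)])
    show "h \<noteq> y" "h \<noteq> b" "y \<noteq> x" using dd by auto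
    show "x \<in> {h, y, b, x}" using tin by simp
    show "\<not> cadj P6 h y" unfolding P6(3) P5(3) P4(3) P3(3) P2(3) P1(3) using n0 dd by (auto simp: doubleton_eq_iff)
    show "X \<inter> (tdarts x y b \<union> qdarts y x h a) = {}"
      using P5(8) P6(8) by (simp add: disjoint_ball tdarts_def qdarts_def ball_Un)
  qed simp
  then obtain P7 where "flips_to P6 P7 X (x, y, b, h, a) (h, a, y, b, x) x" ..
  note P7 = flips_toD[OF this]
  have F47: "rquad P7 y a k b y"
    by (rule P7(9)[OF F46]) (use dd in \<open>auto simp: tdarts_def qdarts_def\<close>)
  have F67: "rquad P7 x b d h t"
    by (rule P7(9)[OF P6(5)]) (use dd in \<open>auto simp: tdarts_def qdarts_def\<close>)
  have "itri P7 a y h" using itri_rot[OF P7(2) P7(4)] .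
  moreover have "rquad P7 k b y a y" using rquad_rot2[OF P7(2) F47] .
  moreover have "rquad P7 y b x h x" using rquad_rotate[OF P7(2) P7(5)] .
  moreover have "reach 7 P P7"
    using reach_trans[OF reach_trans[OF reach_trans[OF reach_trans[OF reach_trans[OF reach_trans[OF
      P1(1) P2(1)] P3(1)] P4(1)] P5(1)] P6(1)] P7(1)] by (simp add: numeral_eq_Suc)
  moreover have "keep X P P7"
    using keep_trans[OF keep_trans[OF keep_trans[OF keep_trans[OF keep_trans[OF keep_trans[OF
      P1(6) P2(6)] P3(6)] P4(6)] P5(6)] P6(6)] P7(6)] .
  ultimately show ?thesis using P7(2) F67 by blast
qed

text \<open>The exchanges made while \<open>h\<close> is carried never involve \<open>h\<close>
  itself; this one trades places between \<open>h\<close> and its neighbour in the fan.\<close>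

lemma swap_last_local:
  assumes g: "good P" and T: "itri P a h b" and Q1: "rquad P k b x a x" and Q2: "rquad P x b h a h"
    and X: "X \<subseteq> darts (cadj P)" "X \<inter> (tdarts a h b \<union> qdarts k b x a \<union> qdarts x b h a) = {}"
  shows "\<exists>P'. reach 6 P P' \<and> good P' \<and> itri P' a x b \<and> rquad P' k b h a h \<and> rquad P' h b x a x \<and>
    keep X P P'"
proof -
  have q1: "quad P k b x a" and q2: "quad P x b h a" using Q1 Q2 unfolding rquad_def by auto
  note A2 = quad_adj[OF g q2]
  have d1: "distinct [k, b, x, a]" and d2: "distinct [x, b, h, a]"
    using quad_distinct[OF g q1] quad_distinct[OF g q2] by auto
  have Nx: "s = b \<or> s = a" if "cadj P x s" for s
  proof -
    have "crot P x b = a" "crot P x a = b" using q1 q2 unfolding quad_def by auto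
    then have "s \<in> {b, a}" using A2 by (intro rot_closed[OF g, of x b _ s]) (use that in auto)
    then show ?thesis by blast
  qed
  \<comment> \<open>The rotation at \<open>b\<close> tells them apart: \<open>k\<close> is followed
    by \<open>x\<close>, but \<open>h\<close> by \<open>a\<close>.\<close>
  have kh: "k \<noteq> h"
  proof
    assume "k = h"
    then have "crot P b h = x" using q1 unfolding quad_def by simp
    moreover have "crot P b h = a" using T unfolding itri_def tri_def by blast
    ultimately show False using d1 by simp
  qed
  have n1: "\<not> cadj P x h" "\<not> cadj P x k" using Nx[of h] Nx[of k] d1 d2 by auto
  note n0 = n1 n1[THEN contrapos_nn, OF adj_sym[OF g]]
  note dd = d1 d2 kh ab
  have tin: True by simp
  \<comment> \<open>\<open>h\<close> has degree 2 here, so the pentagon passes \<open>b\<close>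
    twice.\<close>
  have "\<exists>P'. flips_to P P' X (a, h, b, x, b) (x, b, h, b, a) h"
  proof (rule chord_flip_avoiding[OF g T rquad_rot2[OF g Q2] X(1)])
    show "x \<noteq> h" "x \<noteq> b" "h \<noteq> a" using dd by auto
    show "h \<in> {x, h, b, a}" using tin by simp
    show "\<not> cadj P x h" using n0 dd by (auto simp: doubleton_eq_iff)
    show "X \<inter> (tdarts a h b \<union> qdarts h a x b) = {}"
      using X(2) by (simp add: disjoint_ball tdarts_def qdarts_def ball_Un)
  qed simp
  then obtain P1 where "flips_to P P1 X (a, h, b, x, b) (x, b, h, b, a) h" ..
  note P1 = flips_toD[OF this]
  have Q11: "rquad P1 k b x a x"
    by (rule P1(9)[OF Q1]) (use dd in \<open>auto simp: tdarts_def qdarts_def\<close>)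
  have "\<exists>P'. flips_to P1 P' X (x, b, h, a, k) (x, a, k, b, h) x"
  proof (rule chord_flip_avoiding[OF P1(2) P1(4) rquad_rotate[OF P1(2) Q11] P1(7)])
    show "x \<noteq> k" "x \<noteq> b" "k \<noteq> h" using dd by auto
    show "x \<in> {x, k, b, h}" using tin by simp
    show "\<not> cadj P1 x k" unfolding P1(3) using n0 dd by (auto simp: doubleton_eq_iff)
    show "X \<inter> (tdarts x b h \<union> qdarts b x a k) = {}"
      using X(2) P1(8) by (simp add: disjoint_ball tdarts_def qdarts_def ball_Un)
  qed simp
  then obtain P2 where "flips_to P1 P2 X (x, b, h, a, k) (x, a, k, b, h) x" ..
  note P2 = flips_toD[OF this]
  have F12: "rquad P2 x h b a h"
    by (rule P2(9)[OF P1(5)]) (use dd in \<open>auto simp: tdarts_def qdarts_def\<close>)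
  have "\<exists>P'. flips_to P2 P' X (x, a, k, h, b) (h, b, a, k, x) h"
  proof (rule chord_flip_avoiding[OF P2(2) P2(4) rquad_rot3[OF P2(2) F12] P2(7)])
    show "h \<noteq> a" "h \<noteq> k" "a \<noteq> x" using dd by auto
    show "h \<in> {h, a, k, x}" using tin by simp
    show "\<not> cadj P2 h a" unfolding P2(3) P1(3) using n0 dd by (auto simp: doubleton_eq_iff)
    show "X \<inter> (tdarts x a k \<union> qdarts a x h b) = {}"
      using P1(8) P2(8) by (simp add: disjoint_ball tdarts_def qdarts_def ball_Un)
  qed simp
  then obtain P3 where "flips_to P2 P3 X (x, a, k, h, b) (h, b, a, k, x) h" ..
  note P3 = flips_toD[OF this]
  have F23: "rquad P3 x k b h x"
    by (rule P3(9)[OF P2(5)]) (use dd in \<open>auto simp: tdarts_def qdarts_def\<close>)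
  have "\<exists>P'. flips_to P3 P' X (h, b, a, x, k) (x, k, b, a, h) x"
  proof (rule chord_flip_avoiding[OF P3(2) P3(4) rquad_rot2[OF P3(2) F23] P3(7)])
    show "x \<noteq> b" "x \<noteq> a" "b \<noteq> h" using dd by auto
    show "x \<in> {x, b, a, h}" using tin by simp
    show "\<not> cadj P3 x b" unfolding P3(3) P2(3) P1(3) using n0 dd by (auto simp: doubleton_eq_iff)
    show "X \<inter> (tdarts h b a \<union> qdarts b h x k) = {}"
      using P2(8) P3(8) by (simp add: disjoint_ball tdarts_def qdarts_def ball_Un)
  qed simp
  then obtain P4 where "flips_to P3 P4 X (h, b, a, x, k) (x, k, b, a, h) x" ..
  note P4 = flips_toD[OF this]
  have F34: "rquad P4 h a k x h"
    by (rule P4(9)[OF P3(5)]) (use dd in \<open>auto simp: tdarts_def qdarts_def\<close>)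
  have "\<exists>P'. flips_to P4 P' X (x, k, b, h, a) (b, x, h, a, k) h"
  proof (rule chord_flip_avoiding[OF P4(2) P4(4) rquad_rot2[OF P4(2) F34] P4(7)])
    show "b \<noteq> h" "b \<noteq> a" "h \<noteq> k" using dd by auto
    show "h \<in> {b, h, a, k}" using tin by simp
    show "\<not> cadj P4 b h" unfolding P4(3) P3(3) P2(3) P1(3) using n0 dd by (auto simp: doubleton_eq_iff)
    show "X \<inter> (tdarts x k b \<union> qdarts k x h a) = {}"
      using P3(8) P4(8) by (simp add: disjoint_ball tdarts_def qdarts_def ball_Un)
  qed simp
  then obtain P5 where "flips_to P4 P5 X (x, k, b, h, a) (b, x, h, a, k) h" ..
  note P5 = flips_toD[OF this]
  have F45: "rquad P5 x b a h x"
    by (rule P5(9)[OF P4(5)]) (use dd in \<open>auto simp: tdarts_def qdarts_def\<close>)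
  have "\<exists>P'. flips_to P5 P' X (x, h, b, b, a) (x, b, a, h, b) x"
  proof (rule chord_flip_avoiding[OF P5(2) itri_rot[OF P5(2) P5(4)] rquad_rot3[OF P5(2) F45] P5(7)])
    show "x \<noteq> a" "x \<noteq> h" "a \<noteq> b" using dd by auto
    show "x \<in> {x, a, h, b}" using tin by simp
    show "\<not> cadj P5 x a" unfolding P5(3) P4(3) P3(3) P2(3) P1(3) using n0 dd by (auto simp: doubleton_eq_iff)
    show "X \<inter> (tdarts x h b \<union> qdarts h x b a) = {}"
      using P4(8) P5(8) by (simp add: disjoint_ball tdarts_def qdarts_def ball_Un)
  qed simp
  then obtain P6 where "flips_to P5 P6 X (x, h, b, b, a) (x, b, a, h, b) x" ..
  note P6 = flips_toD[OF this]
  have F56: "rquad P6 b h a k h"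
    by (rule P6(9)[OF P5(5)]) (use dd in \<open>auto simp: tdarts_def qdarts_def\<close>)
  have "rquad P6 k b h a h" using rquad_rot3[OF P6(2) F56] .
  moreover have "rquad P6 h b x a x" using rquad_rot2[OF P6(2) P6(5)] .
  moreover have "itri P6 a x b" using itri_rot[OF P6(2) itri_rot[OF P6(2) P6(4)]] .
  moreover have "reach 6 P P6"
    using reach_trans[OF reach_trans[OF reach_trans[OF reach_trans[OF reach_trans[OF
      P1(1) P2(1)] P3(1)] P4(1)] P5(1)] P6(1)] by (simp add: numeral_eq_Suc)
  moreover have "keep X P P6"
    using keep_trans[OF keep_trans[OF keep_trans[OF keep_trans[OF keep_trans[OF
      P1(6) P2(6)] P3(6)] P4(6)] P5(6)] P6(6)] .
  ultimately show ?thesis using P6(2) by blast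
qed

end

text \<open>The faces below the carried vertex \<open>h\<close>: like layers with \<open>h\<close>
  in the role of \<open>a\<close>, except that the last one closes with \<open>a\<close> and has
  \<open>h\<close> as its reflex vertex. The list is headed by the last layer vertex, so it is never
  empty.\<close>

fun lower_chain :: "'a tagged_emb \<Rightarrow> 'a \<Rightarrow> 'a \<Rightarrow> 'a \<Rightarrow> 'a list \<Rightarrow> bool" where
  "lower_chain P b a h [] \<longleftrightarrow> False"
| "lower_chain P b a h [e] \<longleftrightarrow> rquad P e b a h h"
| "lower_chain P b a h (e # f # es) \<longleftrightarrow> rquad P e b f h f \<and> lower_chain P b a h (f # es)"

lemma lower_chain_keep:
  assumes "lower_chain P b a h es"
    and "\<And>e z t. e \<in> set es \<Longrightarrow> rquad P e b z h t \<Longrightarrow> rquad P' e b z h t"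
  shows "lower_chain P' b a h es"
  using assms by (induction P b a h es rule: lower_chain.induct) auto

lemma lower_chain_head: "lower_chain P b a h (e # es) \<Longrightarrow> \<exists>z t. rquad P e b z h t"
  by (cases es) auto

context frame
begin

text \<open>The triangle has carried the innermost vertex \<open>h\<close> of a fan up to the layers \<open>cs\<close>: the vertices \<open>ds\<close>
  below are joined to \<open>b\<close> and \<open>h\<close> instead of \<open>b\<close> and \<open>a\<close>.\<close>

definition carried :: "'a tagged_emb \<Rightarrow> 'a list \<Rightarrow> 'a list \<Rightarrow> 'a \<Rightarrow> bool" where
  "carried P cs ds h \<longleftrightarrow> layered P cs \<and> itri P a (last cs) h \<and> lower_chain P b a h (last cs # ds) \<and>
     distinct (ds @ [h]) \<and> set (ds @ [h]) \<inter> ({a, b} \<union> set cs) = {}"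

lemma to_b_out: "layered P cs \<Longrightarrow> s \<noteq> a \<Longrightarrow> s \<notin> set (butlast cs) \<Longrightarrow> (s, b) \<notin> ldarts cs"
  using layD(6)[of P cs] ab unfolding ldarts_def by (auto dest: in_set_butlastD)

lemma last_b_out: "layered P cs \<Longrightarrow> (last cs, b) \<notin> ldarts cs"
  using to_b_out last_facts(1) last_notin_butlast layD(2,4) by metis

lemma new_b_out: "layered P cs \<Longrightarrow> s \<noteq> a \<Longrightarrow> s \<notin> set cs \<Longrightarrow> (s, b) \<notin> ldarts cs"
  using to_b_out by (meson in_set_butlastD)

lemma ldarts_sub: "layered P cs \<Longrightarrow> ldarts cs \<subseteq> darts (cadj P)"
  using ldarts_fclosed unfolding fclosed_def by blast

lemma ldarts_disj:
  assumes L: "layered P cs" and T: "itri P u v w" and F: "quad P v u p q"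
    and d: "d \<in> qdarts v u p q" "d \<notin> ldarts cs"
  shows "ldarts cs \<inter> (tdarts u v w \<union> qdarts v u p q) = {}"
  using ldarts_avoid[OF L T F d] by blast

lemma layered_prefix: "layered P (cs @ [x]) \<Longrightarrow> cs \<noteq> [] \<Longrightarrow>
    layered P cs \<and> rquad P (last cs) b x a x \<and> x \<notin> {a, b} \<union> set cs"
  unfolding layered_def by (auto simp: successively_append_iff)

text \<open>Exchanging \<open>kh\<close> for \<open>xa\<close>, where \<open>k = last cs\<close>,
  turns the topmost lower face into a layer; its reflex vertex is \<open>x\<close> before and
  after.\<close>

lemma move_down:
  assumes S: "carried P cs (x # ds) h"
  shows "\<exists>P'. reach 1 P P' \<and> carried P' (cs @ [x]) ds h"
proof -
  let ?k = "last cs"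
  have L: "layered P cs" and T: "itri P a ?k h" and Q: "rquad P ?k b x h x" and lo: "lower_chain P b a h (x # ds)"
    and d: "distinct (x # ds @ [h])" "set (x # ds @ [h]) \<inter> ({a, b} \<union> set cs) = {}"
    using S unfolding carried_def by auto
  note g = layD(1)[OF L] and lf = last_facts[OF L]
  have kc: "?k \<in> set cs" using layD(2)[OF L] by simp
  have q: "quad P ?k b x h" using Q unfolding rquad_def by blast
  have dd: "x \<noteq> ?k" "h \<noteq> ?k" "x \<noteq> h" "x \<noteq> a" "x \<noteq> b" "h \<noteq> a" "h \<noteq> b" using d kc by auto
  have xk: "\<not> cadj P x a"
  proof
    assume xa: "cadj P x a"
    obtain z t where Q': "rquad P x b z h t" using lower_chain_head[OF lo] by blast
    have cr: "crot P x b = h" "crot P x h = b" using q Q' unfolding rquad_def quad_def by auto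
    have "a \<in> {b, h}"
      by (rule rot_closed[OF g _ _ _ xa, of b]) (use cr quad_adj[OF g q] adj_sym[OF g] in auto)
    then show False using ab dd by auto
  qed
  have F: "rquad P h ?k b x x" using rquad_rot3[OF g Q] .
  have q': "quad P h ?k b x" using F unfolding rquad_def by blast
  have T': "itri P ?k h a" using itri_rot[OF g T] .
  have mem: "(?k, b) \<in> qdarts h ?k b x" unfolding qdarts_def by blast
  have "\<exists>P'. flips_to P P' (ldarts cs) (?k, h, a, b, x) (x, h, a, ?k, b) x"
    by (rule chord_flip_avoiding[OF g T' F ldarts_sub[OF L] ldarts_disj[OF L T' q' mem last_b_out[OF L]] _ xk])
      (use dd ab in auto)
  then obtain P' where "flips_to P P' (ldarts cs) (?k, h, a, b, x) (x, h, a, ?k, b) x" ..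
  note P' = flips_toD[OF this]
  have L': "layered P' cs" by (rule layered_keep[OF L P'(2,6)])
  have "rquad P' ?k b x a x" using rquad_rot2[OF P'(2) P'(5)] .
  from layered_snoc[OF L' this] have L2: "layered P' (cs @ [x])" using d by auto
  have "lower_chain P' b a h (x # ds)"
  proof (rule lower_chain_keep[OF lo])
    fix e z t assume e: "e \<in> set (x # ds)" "rquad P e b z h t"
    have "e \<noteq> ?k" "e \<noteq> b" using e(1) d(2) kc by auto
    then show "rquad P' e b z h t"
      using dd ab lf(1,2) by (intro P'(9)[OF e(2)]) (auto simp: tdarts_def qdarts_def)
  qed
  moreover have "itri P' a x h" using itri_rot2[OF P'(2) P'(4)] .
  ultimately have "carried P' (cs @ [x]) ds h" unfolding carried_def using L2 d by auto
  then show ?thesis using P'(1) by blast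
qed

text \<open>The inverse exchange, \<open>ax\<close> for \<open>hk\<close> with
  \<open>k = last cs\<close>. The chord is free because \<open>k\<close> lies above the layer vertex
  \<open>x\<close> and so has degree 2.\<close>

lemma move_up:
  assumes S: "carried P (cs @ [x]) ds h" and ne: "cs \<noteq> []"
  shows "\<exists>P'. reach 1 P P' \<and> carried P' cs (x # ds) h"
proof -
  let ?k = "last cs"
  have L1: "layered P (cs @ [x])" and T: "itri P a x h" and lo: "lower_chain P b a h (x # ds)"
    and d: "distinct (ds @ [h])" "set (ds @ [h]) \<inter> ({a, b} \<union> set (cs @ [x])) = {}"
    using S unfolding carried_def by auto
  have L: "layered P cs" and Q: "rquad P ?k b x a x" and x: "x \<notin> {a, b} \<union> set cs"
    using layered_prefix[OF L1 ne] by auto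
  note g = layD(1)[OF L] and lf = last_facts[OF L]
  have kc: "?k \<in> set cs" using layD(2)[OF L] by simp
  have dd: "x \<noteq> ?k" "h \<noteq> ?k" "x \<noteq> h" "x \<noteq> a" "x \<noteq> b" "h \<noteq> a" "h \<noteq> b" using d x kc by auto
  have hk: "\<not> cadj P h ?k"
  proof
    assume "cadj P h ?k"
    then have "h = a \<or> h = b"
      using inner_nbrs[OF L1, of ?k h] kc adj_sym[OF g] by simp
    then show False using dd by blast
  qed
  have F: "rquad P x a ?k b x" using rquad_rot2[OF g Q] .
  have q': "quad P x a ?k b" using F unfolding rquad_def by blast
  have mem: "(?k, b) \<in> qdarts x a ?k b" unfolding qdarts_def by blast
  have "\<exists>P'. flips_to P P' (ldarts cs) (a, x, h, ?k, b) (h, a, ?k, b, x) x"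
    by (rule chord_flip_avoiding[OF g T F ldarts_sub[OF L] ldarts_disj[OF L T q' mem last_b_out[OF L]] _ hk])
      (use dd ab in auto)
  then obtain P' where "flips_to P P' (ldarts cs) (a, x, h, ?k, b) (h, a, ?k, b, x) x" ..
  note P' = flips_toD[OF this]
  have L': "layered P' cs" by (rule layered_keep[OF L P'(2,6)])
  have Q': "rquad P' ?k b x h x" using rquad_rotate[OF P'(2) P'(5)] .
  have "lower_chain P' b a h (x # ds)"
  proof (rule lower_chain_keep[OF lo])
    fix e z t assume e: "e \<in> set (x # ds)" "rquad P e b z h t"
    have "e \<noteq> ?k" "e \<noteq> b" using e(1) d(2) x kc by auto
    then show "rquad P' e b z h t"
      using dd ab lf(1,2) by (intro P'(9)[OF e(2)]) (auto simp: tdarts_def qdarts_def)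
  qed
  then have "lower_chain P' b a h (?k # x # ds)" using Q' by simp
  moreover have "itri P' a ?k h" using itri_rot[OF P'(2) P'(4)] .
  ultimately have "carried P' cs (x # ds) h" unfolding carried_def using L' d x dd by auto
  then show ?thesis using P'(1) by blast
qed

text \<open>The edge from \<open>h\<close> to \<open>b\<close> gives way to one from
  \<open>h\<close> to the vertex above it; the lower part is still empty.\<close>

lemma fan_to_carried:
  assumes S: "fan P (cs @ [h])" and ne: "cs \<noteq> []"
  shows "\<exists>P'. reach 1 P P' \<and> carried P' cs [] h"
proof -
  let ?k = "last cs"
  have L1: "layered P (cs @ [h])" and T: "itri P a h b" using S unfolding fan_def by auto
  have L: "layered P cs" and Q: "rquad P ?k b h a h" and x: "h \<notin> {a, b} \<union> set cs"
    using layered_prefix[OF L1 ne] by auto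
  note g = layD(1)[OF L] and lf = last_facts[OF L]
  have kc: "?k \<in> set cs" using layD(2)[OF L] by simp
  have dd: "h \<noteq> ?k" "h \<noteq> a" "h \<noteq> b" using x kc by auto
  have hk: "\<not> cadj P h ?k"
  proof
    assume "cadj P h ?k"
    then have "h = a \<or> h = b"
      using inner_nbrs[OF L1, of ?k h] kc adj_sym[OF g] by simp
    then show False using dd by blast
  qed
  have F: "rquad P b h a ?k h" using rquad_rotate[OF g Q] .
  have q': "quad P b h a ?k" using F unfolding rquad_def by blast
  have T': "itri P h b a" using itri_rot[OF g T] .
  have mem: "(?k, b) \<in> qdarts b h a ?k" unfolding qdarts_def by blast
  have "\<exists>P'. flips_to P P' (ldarts cs) (h, b, a, a, ?k) (h, a, ?k, b, a) h"
    by (rule chord_flip_avoiding[OF g T' F ldarts_sub[OF L] ldarts_disj[OF L T' q' mem last_b_out[OF L]] _ hk])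
      (use dd lf(1,2) in auto)
  then obtain P' where "flips_to P P' (ldarts cs) (h, b, a, a, ?k) (h, a, ?k, b, a) h" ..
  note P' = flips_toD[OF this]
  have L': "layered P' cs" by (rule layered_keep[OF L P'(2,6)])
  have "rquad P' ?k b a h h" using rquad_rotate[OF P'(2) P'(5)] .
  moreover have "itri P' a ?k h" using itri_rot[OF P'(2) P'(4)] .
  ultimately have "carried P' cs [] h" unfolding carried_def using L' x by auto
  then show ?thesis using P'(1) by blast
qed

lemma carried_to_fan:
  assumes S: "carried P cs [] h"
  shows "\<exists>P'. reach 1 P P' \<and> fan P' (cs @ [h])"
proof -
  let ?k = "last cs"
  have L: "layered P cs" and T: "itri P a ?k h" and Q: "rquad P ?k b a h h" and h: "h \<notin> {a, b} \<union> set cs"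
    using S unfolding carried_def by auto
  note g = layD(1)[OF L] and lf = last_facts[OF L]
  have kc: "?k \<in> set cs" using layD(2)[OF L] by simp
  have dd: "h \<noteq> ?k" "h \<noteq> a" "h \<noteq> b" using h kc by auto
  have q: "quad P ?k b a h" using Q unfolding rquad_def by blast
  have bh: "\<not> cadj P b h"
  proof
    assume bh: "cadj P b h"
    have cr: "crot P h a = ?k" "crot P h ?k = a"
      using T q unfolding itri_def tri_def quad_def by auto
    have "b \<in> {a, ?k}"
      by (rule rot_closed[OF g _ _ _ adj_sym[OF g bh], of a])
        (use cr quad_adj[OF g q] adj_sym[OF g] in auto)
    then show False using ab lf by auto
  qed
  have F: "rquad P h ?k b a h" using rquad_rot3[OF g Q] .
  have q': "quad P h ?k b a" using F unfolding rquad_def by blast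
  have T': "itri P ?k h a" using itri_rot[OF g T] .
  have mem: "(?k, b) \<in> qdarts h ?k b a" unfolding qdarts_def by blast
  have "\<exists>P'. flips_to P P' (ldarts cs) (?k, h, a, b, a) (b, a, h, a, ?k) h"
    by (rule chord_flip_avoiding[OF g T' F ldarts_sub[OF L] ldarts_disj[OF L T' q' mem last_b_out[OF L]] _ bh])
      (use dd ab in auto)
  then obtain P' where "flips_to P P' (ldarts cs) (?k, h, a, b, a) (b, a, h, a, ?k) h" ..
  note P' = flips_toD[OF this]
  have L': "layered P' cs" by (rule layered_keep[OF L P'(2,6)])
  have "rquad P' ?k b h a h" using rquad_rot3[OF P'(2) P'(5)] .
  from layered_snoc[OF L' this h] have "layered P' (cs @ [h])" .
  moreover have "itri P' a h b" using itri_rot[OF P'(2) P'(4)] .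
  ultimately have "fan P' (cs @ [h])" unfolding fan_def by simp
  then show ?thesis using P'(1) by blast
qed

lemma isface_disjoint: "good P \<Longrightarrow> isface P f \<Longrightarrow> isface P f' \<Longrightarrow> d \<in> f \<Longrightarrow> d \<notin> f' \<Longrightarrow> f \<inter> f' = {}"
  using isface_eq[of P f f'] by blast

text \<open>Besides exchanging \<open>x\<close> and \<open>y\<close>, the sequence of
  \<open>swap_local\<close> leaves \<open>T\<close> one layer further down, with \<open>y\<close> as
  the new layer.\<close>

lemma swap_down:
  assumes S: "carried P cs (x # y # ds) h"
  shows "\<exists>P'. reach 7 P P' \<and> carried P' (cs @ [y]) (x # ds) h"
proof -
  let ?k = "last cs"
  have L: "layered P cs" and T: "itri P a ?k h" and Q1: "rquad P ?k b x h x" and Q2: "rquad P x b y h y"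
    and lo: "lower_chain P b a h (y # ds)"
    and d: "distinct (x # y # ds @ [h])" "set (x # y # ds @ [h]) \<inter> ({a, b} \<union> set cs) = {}"
    using S unfolding carried_def by auto
  note g = layD(1)[OF L] and lf = last_facts[OF L]
  have kc: "?k \<in> set cs" using layD(2)[OF L] by simp
  \<comment> \<open>The face below \<open>y\<close> is an ordinary one or, if \<open>ds\<close> is
    empty, the closing one with corner \<open>a\<close> and reflex vertex \<open>h\<close>.\<close>
  define e t where "e = (case ds of [] \<Rightarrow> a | f # _ \<Rightarrow> f)" and "t = (case ds of [] \<Rightarrow> h | f # _ \<Rightarrow> f)"
  have Q3: "rquad P y b e h t" using lo unfolding e_def t_def by (cases ds) auto
  define L4 where "L4 = tdarts a ?k h \<union> qdarts ?k b x h \<union> qdarts x b y h \<union> qdarts y b e h"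
  \<comment> \<open>Everything off the four faces is protected, so that the rest of the lower part
    survives along with the layers.\<close>
  define X where "X = darts (cadj P) - L4"
  have dd: "x \<noteq> ?k" "y \<noteq> ?k" "h \<noteq> ?k" "x \<noteq> y" "x \<noteq> h" "y \<noteq> h" "x \<noteq> a" "x \<noteq> b" "y \<noteq> a" "y \<noteq> b" "h \<noteq> a" "h \<noteq> b"
    using d kc by auto
  obtain P' where P': "reach 7 P P'" "good P'" "itri P' a y h" "rquad P' ?k b y a y" "rquad P' y b x h x"
    "rquad P' x b e h t" "keep X P P'"
    using swap_local[OF g T Q1 Q2 Q3, of X] unfolding X_def L4_def by blast
  have q: "quad P ?k b x h" "quad P x b y h" "quad P y b e h" using Q1 Q2 Q3 unfolding rquad_def by auto
  have fc: "fclosed P (ldarts cs)" by (rule ldarts_fclosed[OF L])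
  have "ldarts cs \<inter> qdarts ?k b x h = {}"
    using fclosed_quad[OF q(1) fc] last_b_out[OF L] unfolding qdarts_def by blast
  moreover have "ldarts cs \<inter> qdarts x b y h = {}"
    using fclosed_quad[OF q(2) fc] new_b_out[OF L, of x] d dd unfolding qdarts_def by auto
  moreover have "ldarts cs \<inter> qdarts y b e h = {}"
    using fclosed_quad[OF q(3) fc] new_b_out[OF L, of y] d dd unfolding qdarts_def by auto
  ultimately have "ldarts cs \<subseteq> X"
    using itri_ldarts[OF L T] ldarts_sub[OF L] unfolding X_def L4_def by blast
  then have L': "layered P' cs" using layered_keep[OF L P'(2)] keep_mono[OF P'(7)] by blast
  have L2: "layered P' (cs @ [y])" by (rule layered_snoc[OF L' P'(4)]) (use d in auto)
  have kp: "rquad P' f b z h s" if f: "f \<in> set ds" "rquad P f b z h s" for f z s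
  proof -
    have qf: "quad P f b z h" using f(2) unfolding rquad_def by blast
    have If: "isface P (qdarts f b z h)" by (rule quad_isface[OF g qf])
    have m: "(f, b) \<in> qdarts f b z h" unfolding qdarts_def by blast
    have n: "f \<noteq> ?k" "f \<noteq> x" "f \<noteq> y" "f \<noteq> b" using f(1) d kc by auto
    have eb: "e \<noteq> b" using quad_distinct[OF g q(3)] by auto
    have "tri P a ?k h" using T unfolding itri_def by blast
    note tf = tri_isface[OF g this]
    have "(f, b) \<notin> tdarts a ?k h" "(f, b) \<notin> qdarts ?k b x h" "(f, b) \<notin> qdarts x b y h" "(f, b) \<notin> qdarts y b e h"
      using n dd eb lf(1,2) ab by (auto simp: tdarts_def qdarts_def)
    note 1 = isface_disjoint[OF g If tf m this(1)] and 2 = isface_disjoint[OF g If quad_isface[OF g q(1)] m this(2)]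
      and 3 = isface_disjoint[OF g If quad_isface[OF g q(2)] m this(3)]
      and 4 = isface_disjoint[OF g If quad_isface[OF g q(3)] m this(4)]
    have "qdarts f b z h \<subseteq> darts (cadj P)" using isfaceE[OF g If] by blast
    then have "qdarts f b z h \<subseteq> X" using 1 2 3 4 unfolding X_def L4_def by blast
    then show ?thesis by (rule keep_rquad[OF P'(7) _ f(2)])
  qed
  have "lower_chain P' b a h (x # ds)"
  proof (cases ds)
    case Nil
    then show ?thesis using P'(6) unfolding e_def t_def by simp
  next
    case (Cons f fs)
    have "lower_chain P b a h (f # fs)" using lo Cons by simp
    then have "lower_chain P' b a h (f # fs)" by (rule lower_chain_keep) (use kp Cons in auto)
    then show ?thesis using P'(6) Cons unfolding e_def t_def by simp
  qed
  then have "lower_chain P' b a h (y # x # ds)" using P'(5) by simp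
  then have "carried P' (cs @ [y]) (x # ds) h" unfolding carried_def using L2 P'(3) d by auto
  then show ?thesis using P'(1) by blast
qed

lemma swap_last:
  assumes S: "fan P (cs @ [x, h])" and ne: "cs \<noteq> []"
  shows "\<exists>P'. reach 6 P P' \<and> fan P' (cs @ [h, x])"
proof -
  let ?k = "last cs"
  have L2: "layered P ((cs @ [x]) @ [h])" and T: "itri P a h b" using S unfolding fan_def by auto
  have L1: "layered P (cs @ [x])" and Q2: "rquad P x b h a h" and h: "h \<notin> {a, b} \<union> set (cs @ [x])"
    using layered_prefix[OF L2] by auto
  have L: "layered P cs" and Q1: "rquad P ?k b x a x" and x: "x \<notin> {a, b} \<union> set cs"
    using layered_prefix[OF L1 ne] by auto
  note g = layD(1)[OF L]
  have q: "quad P ?k b x a" "quad P x b h a" using Q1 Q2 unfolding rquad_def by auto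
  have fc: "fclosed P (ldarts cs)" by (rule ldarts_fclosed[OF L])
  have "ldarts cs \<inter> qdarts ?k b x a = {}"
    using fclosed_quad[OF q(1) fc] last_b_out[OF L] unfolding qdarts_def by blast
  moreover have "ldarts cs \<inter> qdarts x b h a = {}"
    using fclosed_quad[OF q(2) fc] new_b_out[OF L, of x] x unfolding qdarts_def by auto
  ultimately have X: "ldarts cs \<inter> (tdarts a h b \<union> qdarts ?k b x a \<union> qdarts x b h a) = {}"
    using itri_ldarts[OF L T] by blast
  obtain P' where P': "reach 6 P P'" "good P'" "itri P' a x b" "rquad P' ?k b h a h" "rquad P' h b x a x"
    "keep (ldarts cs) P P'"
    using swap_last_local[OF g T Q1 Q2 ldarts_sub[OF L] X] by blast
  have L': "layered P' cs" by (rule layered_keep[OF L P'(2,6)])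
  have "layered P' (cs @ [h])" by (rule layered_snoc[OF L' P'(4)]) (use h in auto)
  from layered_snoc[OF this, of x] have "layered P' ((cs @ [h]) @ [x])" using P'(5) x h by auto
  then have "fan P' (cs @ [h, x])" unfolding fan_def using P'(3) by simp
  then show ?thesis using P'(1) by blast
qed

section \<open>Sequences of moves and their lengths\<close>

lemma moves_up:
  "carried P (cs @ us) ds h \<Longrightarrow> cs \<noteq> [] \<Longrightarrow> \<exists>P'. reach (length us) P P' \<and> carried P' cs (us @ ds) h"
proof (induction us arbitrary: P ds rule: rev_induct)
  case Nil
  then show ?case using reach_refl by auto
next
  case (snoc u us)
  have "carried P ((cs @ us) @ [u]) ds h" using snoc.prems(1) by simp
  then obtain P1 where P1: "reach 1 P P1" "carried P1 (cs @ us) (u # ds) h"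
    using move_up[of P "cs @ us" u ds h] snoc.prems(2) by auto
  obtain P2 where P2: "reach (length us) P1 P2" "carried P2 cs (us @ u # ds) h"
    using snoc.IH[OF P1(2) snoc.prems(2)] by blast
  then show ?case using reach_trans[OF P1(1) P2(1)] by auto
qed

lemma moves_down:
  "carried P cs (us @ ds) h \<Longrightarrow> \<exists>P'. reach (length us) P P' \<and> carried P' (cs @ us) ds h"
proof (induction us arbitrary: P cs)
  case Nil
  then show ?case using reach_refl by auto
next
  case (Cons u us)
  have "carried P cs (u # (us @ ds)) h" using Cons.prems by simp
  then obtain P1 where P1: "reach 1 P P1" "carried P1 (cs @ [u]) (us @ ds) h" using move_down by blast
  obtain P2 where P2: "reach (length us) P1 P2" "carried P2 ((cs @ [u]) @ us) ds h"
    using Cons.IH[OF P1(2)] by blast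
  then show ?case using reach_trans[OF P1(1) P2(1)] by auto
qed

lemma carried_ne: "carried P cs ds h \<Longrightarrow> cs \<noteq> []"
  unfolding carried_def layered_def by blast

text \<open>Each position passed costs one move down, two moves up and an exchange of 7 flips, 10 in
  all.\<close>

lemma to_front:
  "carried P cs (us @ t # vs) h \<Longrightarrow> \<exists>P'. reach (10 * length us) P P' \<and> carried P' cs (t # us @ vs) h"
proof (induction us arbitrary: P cs)
  case Nil
  then show ?case using reach_refl by auto
next
  case (Cons u us)
  have "carried P cs (u # (us @ t # vs)) h" using Cons.prems by simp
  then obtain P1 where P1: "reach 1 P P1" "carried P1 (cs @ [u]) (us @ t # vs) h" using move_down by blast
  obtain P2 where P2: "reach (10 * length us) P1 P2" "carried P2 (cs @ [u]) (t # us @ vs) h"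
    using Cons.IH[OF P1(2)] by blast
  obtain P3 where P3: "reach 1 P2 P3" "carried P3 cs (u # t # us @ vs) h"
    using move_up[OF P2(2) carried_ne[OF Cons.prems]] by blast
  obtain P4 where P4: "reach 7 P3 P4" "carried P4 (cs @ [t]) (u # us @ vs) h" using swap_down[OF P3(2)] by blast
  obtain P5 where P5: "reach 1 P4 P5" "carried P5 cs (t # u # us @ vs) h"
    using move_up[OF P4(2) carried_ne[OF Cons.prems]] by blast
  have "reach (1 + 10 * length us + 1 + 7 + 1) P P5"
    by (rule reach_trans[OF reach_trans[OF reach_trans[OF reach_trans[OF P1(1) P2(1)] P3(1)] P4(1)] P5(1)])
  then show ?case using P5(2) by auto
qed

text \<open>The wanted first element is fetched with at most \<open>10 * m\<close> flips,
  \<open>T\<close> steps below it, the rest is sorted, and \<open>T\<close> steps back up.\<close>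

lemma sort_low:
  assumes "carried P cs ds h" "distinct ts" "set ts = set ds" "length ts \<le> m"
  shows "\<exists>P'. reach (length ts * (10 * m + 2)) P P' \<and> carried P' cs ts h"
  using assms
proof (induction ts arbitrary: P cs ds)
  case Nil
  then show ?case using reach_refl by auto
next
  case (Cons t ts)
  have dds: "distinct ds" using Cons.prems(1) unfolding carried_def by simp
  have "t \<in> set ds" using Cons.prems(3) by auto
  then obtain us vs where ds: "ds = us @ t # vs" by (meson split_list)
  have len: "length ds = length (t # ts)"
    using Cons.prems(2,3) dds by (metis distinct_card)
  obtain P1 where P1: "reach (10 * length us) P P1" "carried P1 cs (t # us @ vs) h"
    using to_front Cons.prems(1) ds by blast
  obtain P2 where P2: "reach 1 P1 P2" "carried P2 (cs @ [t]) (us @ vs) h" using move_down[OF P1(2)] by blast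
  have "set ts = set (us @ vs)" using Cons.prems(2,3) dds unfolding ds by auto
  then obtain P3 where P3: "reach (length ts * (10 * m + 2)) P2 P3" "carried P3 (cs @ [t]) ts h"
    using Cons.IH[OF P2(2)] Cons.prems by auto
  obtain P4 where P4: "reach 1 P3 P4" "carried P4 cs (t # ts) h"
    using move_up[OF P3(2) carried_ne[OF Cons.prems(1)]] by blast
  have "reach (10 * length us + 1 + length ts * (10 * m + 2) + 1) P P4"
    by (rule reach_trans[OF reach_trans[OF reach_trans[OF P1(1) P2(1)] P3(1)] P4(1)])
  moreover have "length us \<le> m" using len ds Cons.prems(4) by simp
  then have "10 * length us + 1 + length ts * (10 * m + 2) + 1 \<le> length (t # ts) * (10 * m + 2)" by simp
  ultimately show ?case using P4(2) reach_mono by blast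
qed

text \<open>Only the vertices above the carried one are permuted. The way up and down adds at most
  \<open>2 * m\<close> flips, the conversions between fan and carried form add 2.\<close>

lemma fan_sort:
  assumes F: "fan P (c # xs @ [h])" and ys: "distinct ys" "set ys = set xs" and m: "length ys \<le> m"
  shows "\<exists>P'. reach (m * (10 * m + 4) + 2) P P' \<and> fan P' (c # ys @ [h])"
proof -
  obtain P1 where P1: "reach 1 P P1" "carried P1 (c # xs) [] h" using fan_to_carried[of P "c # xs" h] F by auto
  then have s1: "carried P1 ([c] @ xs) [] h" by simp
  have "distinct xs" using F unfolding fan_def layered_def by simp
  then have len: "length xs = length ys" using ys by (metis distinct_card)
  obtain P2 where P2: "reach (length xs) P1 P2" "carried P2 [c] (xs @ []) h" using moves_up[OF s1] by blast
  obtain P3 where P3: "reach (length ys * (10 * m + 2)) P2 P3" "carried P3 [c] ys h"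
    using sort_low[OF P2(2) ys(1) _ m] ys(2) by auto
  then have s3: "carried P3 [c] (ys @ []) h" by simp
  obtain P4 where P4: "reach (length ys) P3 P4" "carried P4 ([c] @ ys) [] h" using moves_down[OF s3] by blast
  obtain P5 where P5: "reach 1 P4 P5" "fan P5 (([c] @ ys) @ [h])" using carried_to_fan[OF P4(2)] by blast
  have r: "reach (1 + length xs + length ys * (10 * m + 2) + length ys + 1) P P5"
    by (rule reach_trans[OF reach_trans[OF reach_trans[OF reach_trans[OF P1(1) P2(1)] P3(1)] P4(1)] P5(1)])
  have "length ys * (10 * m + 4) \<le> m * (10 * m + 4)" using m by (rule mult_le_mono1)
  then have le: "1 + length xs + length ys * (10 * m + 2) + length ys + 1 \<le> m * (10 * m + 4) + 2"
    using len by (simp add: algebra_simps)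
  have "fan P5 (c # ys @ [h])" using P5(2) by simp
  then show ?thesis using reach_mono[OF r le] by blast
qed

text \<open>If the innermost vertex has to change, the new one is first sorted next to it,
  \<open>swap_last\<close> exchanges the two in 6 flips, and a second sort arranges the
  others.\<close>

lemma fan_permute:
  assumes F: "fan P (c # xs)" and ys: "distinct ys" "set ys = set xs" and m: "length ys \<le> m"
  shows "\<exists>P'. reach (2 * (m * (10 * m + 4) + 2) + 6) P P' \<and> fan P' (c # ys)"
proof (cases "xs = []")
  case True
  then show ?thesis using F ys reach_mono[OF reach_refl] by auto
next
  case False
  then have ne: "ys \<noteq> []" using ys by auto
  obtain xs' h where xs: "xs = xs' @ [h]" using False by (metis rev_exhaust)
  obtain ys' h' where ys': "ys = ys' @ [h']" using ne by (metis rev_exhaust)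
  have dx: "distinct xs" using F unfolding fan_def layered_def by simp
  let ?N = "m * (10 * m + 4) + 2"
  show ?thesis
  proof (cases "h = h'")
    case True
    have "set ys' = set xs'" using ys dx True unfolding xs ys' by auto
    moreover have "fan P (c # xs' @ [h])" using F xs by simp
    ultimately obtain P' where "reach ?N P P'" "fan P' (c # ys' @ [h])"
      using fan_sort[of P xs' h ys' m] ys(1) m ys' by auto
    then show ?thesis using reach_mono[of ?N P P' "2 * ?N + 6"] True ys' by auto
  next
    case False
    define zs where "zs = remove1 h' xs'"
    have h': "h' \<in> set xs'" using ys False unfolding xs ys' by auto
    have dz: "distinct (zs @ [h'])" "set (zs @ [h']) = set xs'"
      using dx h' unfolding zs_def xs by auto
    have len: "length xs = length ys" using dx ys by (metis distinct_card)
    have lz: "length (zs @ [h']) \<le> m"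
    proof -
      have "length (zs @ [h']) = length xs'" using dz dx xs by (metis distinct_append distinct_card)
      then show ?thesis using len m xs by simp
    qed
    have "fan P (c # xs' @ [h])" using F xs by simp
    from fan_sort[OF this dz lz] obtain P1 where P1: "reach ?N P P1" "fan P1 (c # (zs @ [h']) @ [h])" by blast
    then have "fan P1 ((c # zs) @ [h', h])" by simp
    from swap_last[OF this] obtain P2 where P2: "reach 6 P1 P2" "fan P2 ((c # zs) @ [h, h'])" by auto
    then have f2: "fan P2 (c # (zs @ [h]) @ [h'])" by simp
    have "set ys' = set (zs @ [h])"
    proof -
      have "set ys' = set xs - {h'}" using ys unfolding ys' by auto
      also have "\<dots> = set (zs @ [h])" using dz dx False unfolding xs by auto
      finally show ?thesis .
    qed
    from fan_sort[OF f2 _ this, of m] obtain P3 where P3: "reach ?N P2 P3" "fan P3 (c # ys' @ [h'])"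
      using ys(1) m unfolding ys' by auto
    have "reach (?N + 6 + ?N) P P3" using reach_trans[OF reach_trans[OF P1(1) P2(1)] P3(1)] .
    moreover have "i + 6 + i = 2 * i + (6 :: nat)" for i by simp
    ultimately have "reach (2 * ?N + 6) P P3" by (simp only:)
    then show ?thesis using P3(2) ys' by blast
  qed
qed

text \<open>The layers lack the reverses of just the three darts of the innermost triangle, and
  \<open>T\<close> supplies them; so the listed darts are closed under reversal too, and by
  \<open>cover\<close> there are no others.\<close>

lemma fan_darts:
  assumes F: "fan P cs"
  shows "darts (cadj P) = ldarts cs \<union> tdarts a (last cs) b"
proof -
  have L: "layered P cs" and T: "itri P a (last cs) b" using F unfolding fan_def by auto
  note g = layD(1)[OF L]
  have ne: "cs \<noteq> []" using layD(2)[OF L] .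
  let ?X = "ldarts cs \<union> tdarts a (last cs) b"
  have tt: "tri P a (last cs) b" using T unfolding itri_def by blast
  have cs: "set cs = insert (last cs) (set (butlast cs))" using ne by (metis append_butlast_last_id list.simps(15) rotate1.simps(2) set_rotate1)
  have X: "(s, t) \<in> ?X \<longleftrightarrow> (s = a \<and> t = b \<or> s = b \<and> t = a \<or> s \<in> {a, b} \<and> t \<in> set cs \<or> s \<in> set cs \<and> t \<in> {a, b})" for s t
    unfolding ldarts_def tdarts_def using cs by auto
  have sub: "?X \<subseteq> darts (cadj P)"
    using ldarts_sub[OF L] isfaceE[OF g tri_isface[OF g tt]] by blast
  moreover have "darts (cadj P) \<subseteq> ?X"
  proof
    fix e assume e: "e \<in> darts (cadj P)"
    obtain s t where st: "e = (s, t)" by (cases e)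
    have "(s, t) \<in> ?X"
    proof (rule cover[OF g sub])
      show "(a, b) \<in> ?X" unfolding X by simp
      show "fnext (crot P) d \<in> ?X" if "d \<in> ?X" for d
        using that
      proof
        assume "d \<in> ldarts cs"
        then show ?thesis using ldarts_fclosed[OF L] unfolding fclosed_def fnext_def by (cases d) auto
      next
        assume "d \<in> tdarts a (last cs) b"
        then show ?thesis using tt unfolding tdarts_def tri_def fnext_def by auto
      qed
      show "(v, u) \<in> ?X" if "(u, v) \<in> ?X" for u v using that unfolding X by blast
      show "cadj P s t" using e st unfolding darts_def by simp
    qed
    then show "e \<in> ?X" using st by simp
  qed
  ultimately show ?thesis by blast
qed

lemma fan_V:
  assumes F: "fan P cs"
  shows "V = {a, b} \<union> set cs"
proof -
  have L: "layered P cs" using F unfolding fan_def by auto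
  note g = layD(1)[OF L]
  have "v \<in> {a, b} \<union> set cs" if v: "v \<in> V" for v
  proof -
    have "\<exists>w. cadj P v w" using pointed[OF g v] by blast
    then obtain w where "(v, w) \<in> darts (cadj P)" unfolding darts_def by blast
    moreover have "last cs \<in> set cs" using layD(2)[OF L] by simp
    ultimately show ?thesis unfolding fan_darts[OF F] ldarts_def tdarts_def
      by (auto dest: in_set_butlastD)
  qed
  moreover have "{a, b} \<union> set cs \<subseteq> V"
    using abcV[OF g] layer_adj[OF L] adj_V[OF g] by blast
  ultimately show ?thesis by blast
qed

text \<open>Every face of a fan is named by its list, which fixes rotation and tag at every
  dart.\<close>

lemma fan_same:
  assumes F: "fan P cs" "fan Q cs"
  shows "same_emb P Q"
proof -
  have L: "layered P cs" "layered Q cs" and T: "itri P a (last cs) b" "itri Q a (last cs) b"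
    using F unfolding fan_def by auto
  note g = layD(1)[OF L(1)] layD(1)[OF L(2)]
  have "darts (cadj P) = darts (cadj Q)" using fan_darts[OF F(1)] fan_darts[OF F(2)] by simp
  then have A: "cadj P = cadj Q" unfolding darts_def by (auto simp: fun_eq_iff set_eq_iff)
  have quads: "crot P t s = crot Q t s \<and> creflex P t s = creflex Q t s"
    if "rquad P x y z w r" "rquad Q x y z w r" "(s, t) \<in> qdarts x y z w" for x y z w r s t
    using that unfolding rquad_def quad_def qdarts_def by auto
  have "crot P t s = crot Q t s \<and> creflex P t s = creflex Q t s" if st: "(s, t) \<in> darts (cadj P)" for s t
  proof -
    have "(s, t) \<in> odarts \<or> (\<exists>us x y vs. cs = us @ x # y # vs \<and> (s, t) \<in> qdarts x b y a) \<or>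
      (s, t) \<in> tdarts a (last cs) b"
      using st ldarts_cases[OF layD(3)[OF L(1)]] unfolding fan_darts[OF F(1)] by blast
    then show ?thesis
    proof (elim disjE exE conjE)
      assume "(s, t) \<in> odarts"
      then show ?thesis
        using tri_outer[OF g(1)] tri_outer[OF g(2)] outer_reflex[OF g(1)] outer_reflex[OF g(2)]
        unfolding tri_def odarts_def by auto
    next
      fix us x y vs assume h: "cs = us @ x # y # vs" "(s, t) \<in> qdarts x b y a"
      show ?thesis by (rule quads[OF layered_rquad[OF L(1) h(1)] layered_rquad[OF L(2) h(1)] h(2)])
    next
      assume h: "(s, t) \<in> tdarts a (last cs) b"
      have n: "(a, last cs) \<notin> odarts" using T(1) unfolding itri_def tdarts_def by blast
      have t: "tri P a (last cs) b" "tri Q a (last cs) b" using T unfolding itri_def by auto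
      show ?thesis
        using h t tri_convex[OF g(1) t(1) n] tri_convex[OF g(2) t(2) n] unfolding tri_def tdarts_def by auto
    qed
  qed
  then show ?thesis unfolding same_emb_def A[symmetric]
    using adj_sym[OF g(1)] unfolding darts_def by blast
qed

text \<open>Only the first flip of the reversed sequence sees the start, so only this one is
  transferred to \<open>R\<close>. If the sequence is empty, nothing better than
  \<open>same_emb\<close> can be concluded.\<close>

lemma reach_rev_same:
  assumes r: "reach k Q PQ" and gq: "good PQ" and gr: "good R" and s: "same_emb PQ R"
  shows "\<exists>R'. reach k R R' \<and> same_emb R' Q"
proof -
  obtain j where j: "j \<le> k" "(flip V (a, b) ^^ j) Q PQ" using r unfolding reach_def by blast
  have b: "(flip V (a, b) ^^ j) PQ Q" by (rule flip_pow_sym[OF j(2)])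
  show ?thesis
  proof (cases j)
    case 0
    then have "PQ = Q" using b by simp
    have "same_emb R Q"
      using s \<open>PQ = Q\<close> unfolding same_emb_def by simp
    then show ?thesis using reach_mono[OF reach_refl] by blast
  next
    case (Suc i)
    then obtain P1 where P1: "flip V (a, b) PQ P1" "(flip V (a, b) ^^ i) P1 Q"
      using b relpowp_Suc_D2[of i "flip V (a, b)" PQ Q] by auto
    have "flip V (a, b) R P1" by (rule flip_cong_left[OF P1(1) s gq gr])
    then have "(flip V (a, b) ^^ j) R Q" unfolding Suc using P1(2) by (rule relpowp_Suc_I2)
    moreover have "same_emb Q Q" unfolding same_emb_def by simp
    ultimately show ?thesis using j(1) unfolding reach_def by blast
  qed
qed

lemma good_connected:
  assumes g: "good P" "good Q"
  shows "\<exists>R. reach (100 * card V * card V) P R \<and> same_emb R Q"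
proof -
  let ?n = "card V"
  obtain P1 cs where P1: "reach (8 * ?n * ?n) P P1" "fan P1 cs" using to_fan[OF g(1)] by blast
  obtain Q1 ds where Q1: "reach (8 * ?n * ?n) Q Q1" "fan Q1 ds" using to_fan[OF g(2)] by blast
  have lc: "layered P1 cs" "layered Q1 ds" using P1 Q1 unfolding fan_def by auto
  obtain xs where xs: "cs = c # xs" using layD(2,3)[OF lc(1)] by (cases cs) auto
  obtain ys where ys: "ds = c # ys" using layD(2,3)[OF lc(2)] by (cases ds) auto
  have dx: "distinct (a # b # c # xs)" "distinct (a # b # c # ys)"
    using lc unfolding layered_def xs ys by auto
  have "{a, b} \<union> set cs = {a, b} \<union> set ds" using fan_V[OF P1(2)] fan_V[OF Q1(2)] by simp
  then have st: "set ys = set xs" using dx unfolding xs ys by auto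
  have f1: "fan P1 (c # xs)" using P1(2) xs by simp
  have "insert a (set ds) \<subseteq> V" using fan_V[OF Q1(2)] by blast
  then have "card (insert a (set ds)) \<le> ?n" by (intro card_mono finV[OF g(1)])
  then have ln: "length ys + 2 \<le> ?n" using dx(2) unfolding ys by (simp add: distinct_card)
  then have ln': "length ys \<le> ?n" by simp
  obtain R where R: "reach (2 * (?n * (10 * ?n + 4) + 2) + 6) P1 R" "fan R (c # ys)"
    using fan_permute[OF f1 _ st ln'] dx(2) by auto
  have "fan Q1 (c # ys)" using Q1(2) ys by simp
  from fan_same[OF this R(2)] have s: "same_emb Q1 R" .
  have gg: "good Q1" "good R" using lc(2) R(2) layD(1) unfolding fan_def by blast+
  obtain R' where R': "reach (8 * ?n * ?n) R R'" "same_emb R' Q"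
    using reach_rev_same[OF Q1(1) gg s] by blast
  have r: "reach (8 * ?n * ?n + (2 * (?n * (10 * ?n + 4) + 2) + 6) + 8 * ?n * ?n) P R'"
    by (rule reach_trans[OF reach_trans[OF P1(1) R(1)] R'(1)])
  have n1: "?n \<ge> 1" using ln by simp
  have n2: "?n \<le> ?n * ?n" by simp
  have "8 * ?n * ?n + (2 * (?n * (10 * ?n + 4) + 2) + 6) + 8 * ?n * ?n = 36 * (?n * ?n) + 8 * ?n + 10"
    by (simp add: algebra_simps)
  \<comment> \<open>Since \<open>1 \<le> n\<close> and \<open>n \<le> q\<close>, the sum is at most
    \<open>54 * q\<close>; 100 is a rounded constant.\<close>
  also have "36 * q + 8 * n + 10 \<le> 100 * q" if "n \<le> q" "1 \<le> n" for n q :: nat using that by linarith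
  from this[OF n2 n1] have "36 * (?n * ?n) + 8 * ?n + 10 \<le> 100 * ?n * ?n" by (simp only: mult.assoc)
  finally show ?thesis using reach_mono[OF r] R'(2) by blast
qed

end

theorem theorem3:
  "\<exists>C::real. \<forall>(V::nat set) a b c P Q.
     finite V \<and> card V \<ge> 3 \<and> distinct [a, b, c] \<and>
     comb_4ppt V (a, b) P \<and> comb_4ppt V (a, b) Q \<and>
     face (crot P) (a, b) = {(a, b), (b, c), (c, a)} \<and>
     face (crot Q) (a, b) = {(a, b), (b, c), (c, a)} \<longrightarrow>
     (\<exists>k R. real k \<le> C * real (card V) ^ 2 \<and> (flip V (a, b) ^^ k) P R \<and> same_emb R Q)"
proof (rule exI[of _ 100], intro allI impI, elim conjE)
  fix V :: "nat set" and a b c :: nat and P Q :: "nat tagged_emb"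
  assume h: "distinct [a, b, c]" "comb_4ppt V (a, b) P" "comb_4ppt V (a, b) Q"
    "face (crot P) (a, b) = {(a, b), (b, c), (c, a)}" "face (crot Q) (a, b) = {(a, b), (b, c), (c, a)}"
  interpret frame V a b c by unfold_locales (use h(1) in auto)
  have "good P" "good Q" using h unfolding good_def by auto
  then obtain R where R: "reach (100 * card V * card V) P R" "same_emb R Q" using good_connected by blast
  then obtain k where k: "k \<le> 100 * card V * card V" "(flip V (a, b) ^^ k) P R" unfolding reach_def by blast
  have "real k \<le> real (100 * card V * card V)" using k(1) by linarith
  also have "\<dots> = 100 * real (card V) ^ 2" by (simp add: power2_eq_square)
  finally show "\<exists>k R. real k \<le> 100 * real (card V) ^ 2 \<and> (flip V (a, b) ^^ k) P R \<and> same_emb R Q"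
    using k(2) R(2) by blast
qed

end
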